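(* Let $G,N$ be Banach--Lie groups, and let $\pi: G\to \mathrm{Aut}(N)$ be a homomorphism defining a continuous action of $G$ on $N$. Then the half-Lie group $H:=N\rtimes_{\pi}G$ has the strong Trotter property: for each $C^1$-curve $\gamma: [0,1]\to H$ with $\gamma(0)=1_H$, $$\lim_{n\to\infty}\gamma(t/n)^n=\exp_H(t\gamma'(0))$$ uniformly in $t$ on compact subsets of $[0,\infty[$.
   Context: $\mathrm{Aut}(N)$ is the group of Lie group automorphisms of $N$; "$\pi$ defines a continuous action" means that $G\times N\to N$, $(g,n)\mapsto \pi(g)n$, is continuous. $H=N\rtimes_\pi G$ is the product Banach manifold $N\times G$ with multiplication $(n_1,g_1)(n_2,g_2)=(n_1\cdot\pi(g_1)n_2,\,g_1g_2)$; it is a topological group whose left multiplications $\lambda_h: x\mapsto hx$ are smooth (right multiplications are in general only continuous). Put $\mathfrak h:=T_1H=\mathfrak n\times\mathfrak g$ and, for $h\in H$, $x\in\mathfrak h$, $h.x:=T_1(\lambda_h)x\in T_hH$. The exponential function $\exp_H:\mathfrak h\to H$ is $\exp_H(x):=\eta(1)$, where $\eta:[0,1]\to H$ is the unique (existing) $C^1$ solution of $\eta'(t)=\eta(t).x$, $\eta(0)=1_H$; then $t\mapsto \exp_H(tx)$ is a $C^1$ one-parameter group with derivative $x$ at $0$. For a given compact subset of $[0,\infty[$, $\gamma(t/n)$ is defined for all sufficiently large $n$. Uniform convergence $\gamma_n(t)\to\gamma(t)$ on a compact set means: for each identity neighbourhood $U$ in $H$ one has $\gamma(t)^{-1}\gamma_n(t)\in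 U$ for all $t$ in that set and all large $n$. *)

theory Defs
  imports "HOL-Analysis.Analysis" "HOL-Algebra.Algebra"
begin

section \<open>Smooth maps between Banach spaces\<close>

definition bounded_multilinear :: "nat \<Rightarrow> ('a::real_normed_vector list \<Rightarrow> 'b::real_normed_vector) \<Rightarrow> bool" where
  "bounded_multilinear k L \<longleftrightarrow>
     (\<forall>vs. length vs = k \<longrightarrow> (\<forall>i<k. linear (\<lambda>v. L (vs[i := v])))) \<and>
     (\<exists>C. \<forall>vs. length vs = k \<longrightarrow> norm (L vs) \<le> C * prod_list (map norm vs))"

text \<open>Frechet smoothness on an open set. The map \<open>D k x\<close>, evaluated on lists of length \<open>k\<close>, is the
  \<open>k\<close>-th derivative at \<open>x\<close>, viewed as a bounded \<open>k\<close>-linear map. The last clause says that \<open>D (Suc k) x\<close> is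
  the Frechet derivative of \<open>D k\<close> at \<open>x\<close> with respect to the operator norm on \<open>k\<close>-linear maps.\<close>

definition frechet_smooth_on :: "'a::real_normed_vector set \<Rightarrow> ('a \<Rightarrow> 'b::real_normed_vector) \<Rightarrow> bool" where
  "frechet_smooth_on S f \<longleftrightarrow> open S \<and>
     (\<exists>D :: nat \<Rightarrow> 'a \<Rightarrow> 'a list \<Rightarrow> 'b.
        (\<forall>x\<in>S. D 0 x [] = f x) \<and>
        (\<forall>k. \<forall>x\<in>S. bounded_multilinear k (D k x) \<and>
          (\<forall>\<epsilon>>0. \<forall>\<^sub>F y in at x. \<forall>vs. length vs = k \<longrightarrow>
             norm (D k y vs - D k x vs - D (Suc k) x ((y - x) # vs))
               \<le> \<epsilon> * norm (y - x) * prod_list (map norm vs))))"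


section \<open>Banach manifolds\<close>

text \<open>A chart is a pair of its domain and a map, whose values outside the domain are irrelevant. Atlases
  need not be maximal: smoothness and velocities below depend only on the smooth structure.\<close>

type_synonym ('m, 'e) chart = "'m set \<times> ('m \<Rightarrow> 'e)"

record ('m, 'e) manifold =
  mtop :: "'m topology"
  atlas :: "('m, 'e) chart set"

definition banach_manifold :: "('m, 'e::banach) manifold \<Rightarrow> bool" where
  "banach_manifold M \<longleftrightarrow>
     Hausdorff_space (mtop M) \<and>
     (\<Union>(U, \<phi>)\<in>atlas M. U) = topspace (mtop M) \<and>
     (\<forall>(U, \<phi>)\<in>atlas M. openin (mtop M) U \<and> open (\<phi> ` U) \<and>
        homeomorphic_map (subtopology (mtop M) U) (top_of_set (\<phi> ` U)) \<phi>) \<and>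
     (\<forall>(U, \<phi>)\<in>atlas M. \<forall>(V, \<psi>)\<in>atlas M.
        frechet_smooth_on (\<phi> ` (U \<inter> V)) (\<psi> \<circ> inv_into U \<phi>))"

definition prod_manifold ::
    "('m, 'e) manifold \<Rightarrow> ('n, 'f) manifold \<Rightarrow> ('m \<times> 'n, 'e \<times> 'f) manifold" where
  "prod_manifold M N =
     \<lparr> mtop = prod_topology (mtop M) (mtop N),
       atlas = (\<lambda>((U, \<phi>), (V, \<psi>)). (U \<times> V, map_prod \<phi> \<psi>)) ` (atlas M \<times> atlas N) \<rparr>"

definition smooth_map ::
    "('m, 'e::banach) manifold \<Rightarrow> ('n, 'f::banach) manifold \<Rightarrow> ('m \<Rightarrow> 'n) \<Rightarrow> bool" where
  "smooth_map M N f \<longleftrightarrow>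
     continuous_map (mtop M) (mtop N) f \<and>
     (\<forall>(U, \<phi>)\<in>atlas M. \<forall>(V, \<psi>)\<in>atlas N.
        frechet_smooth_on (\<phi> ` {p \<in> U. f p \<in> V}) (\<psi> \<circ> f \<circ> inv_into U \<phi>))"


section \<open>Tangent vectors and curves\<close>

definition charts_at :: "('m, 'e) manifold \<Rightarrow> 'm \<Rightarrow> ('m, 'e) chart set" where
  "charts_at M p = {c \<in> atlas M. p \<in> fst c}"

text \<open>A tangent vector at \<open>p\<close> is the family of its coordinate representatives in all charts around \<open>p\<close>,
  related by the derivatives of the transition maps and extended by zero to all other pairs. The vector
  space operations are the pointwise ones.\<close>

type_synonym ('m, 'e) tangent = "('m, 'e) chart \<Rightarrow> 'e"

definition tangent_space :: "('m, 'e::banach) manifold \<Rightarrow> 'm \<Rightarrow> ('m, 'e) tangent set" where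
  "tangent_space M p = {v.
     (\<forall>c\<in>charts_at M p. \<forall>d\<in>charts_at M p.
        v d = frechet_derivative (snd d \<circ> inv_into (fst c) (snd c)) (at (snd c p)) (v c)) \<and>
     (\<forall>c. c \<notin> charts_at M p \<longrightarrow> v c = 0)}"

text \<open>By the chain rule, the choice of the chart \<open>c\<close> is irrelevant if \<open>f\<close> is differentiable at \<open>p\<close> and \<open>v\<close> is
  a tangent vector at \<open>p\<close>.\<close>

definition tangent_map ::
    "('m, 'e::banach) manifold \<Rightarrow> ('n, 'f::banach) manifold \<Rightarrow> ('m \<Rightarrow> 'n) \<Rightarrow> 'm
      \<Rightarrow> ('m, 'e) tangent \<Rightarrow> ('n, 'f) tangent" where
  "tangent_map M N f p v =
     (let c = (SOME c. c \<in> charts_at M p)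
      in (\<lambda>d. (if d \<in> charts_at N (f p)
            then frechet_derivative (snd d \<circ> f \<circ> inv_into (fst c) (snd c)) (at (snd c p)) (v c)
            else 0)))"

definition C1_curve :: "('m, 'e::banach) manifold \<Rightarrow> real set \<Rightarrow> (real \<Rightarrow> 'm) \<Rightarrow> bool" where
  "C1_curve M I \<gamma> \<longleftrightarrow>
     continuous_map (top_of_set I) (mtop M) \<gamma> \<and>
     (\<forall>(U, \<phi>)\<in>atlas M. \<exists>\<gamma>'.
        continuous_on {t \<in> I. \<gamma> t \<in> U} \<gamma>' \<and>
        (\<forall>t\<in>I. \<gamma> t \<in> U \<longrightarrow> ((\<phi> \<circ> \<gamma>) has_vector_derivative \<gamma>' t) (at t within I)))"

definition velocity ::
    "('m, 'e::banach) manifold \<Rightarrow> real set \<Rightarrow> (real \<Rightarrow> 'm) \<Rightarrow> real \<Rightarrow> ('m, 'e) tangent" where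
  "velocity M I \<gamma> t =
     (\<lambda>c. (if c \<in> charts_at M (\<gamma> t) then vector_derivative (snd c \<circ> \<gamma>) (at t within I) else 0))"


section \<open>Banach--Lie groups and semidirect products\<close>

record ('g, 'e) manifold_group = "'g monoid" +
  mfd :: "('g, 'e) manifold"

definition banach_lie_group :: "('g, 'e::banach) manifold_group \<Rightarrow> bool" where
  "banach_lie_group G \<longleftrightarrow>
     group G \<and> banach_manifold (mfd G) \<and> topspace (mtop (mfd G)) = carrier G \<and>
     smooth_map (prod_manifold (mfd G) (mfd G)) (mfd G) (\<lambda>(x, y). x \<otimes>\<^bsub>G\<^esub> y) \<and>
     smooth_map (mfd G) (mfd G) (\<lambda>x. inv\<^bsub>G\<^esub> x)"

text \<open>As in \<^const>\<open>BijGroup\<close>, automorphisms are extensional on the carrier.\<close>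

definition lie_Aut :: "('n, 'e::banach) manifold_group \<Rightarrow> ('n \<Rightarrow> 'n) monoid" where
  "lie_Aut N = BijGroup (carrier N)
     \<lparr> carrier := {f \<in> auto N. smooth_map (mfd N) (mfd N) f \<and>
                              smooth_map (mfd N) (mfd N) (inv_into (carrier N) f)} \<rparr>"

definition semidirect_product ::
    "('n, 'e) manifold_group \<Rightarrow> ('g, 'f) manifold_group \<Rightarrow> ('g \<Rightarrow> 'n \<Rightarrow> 'n)
      \<Rightarrow> ('n \<times> 'g, 'e \<times> 'f) manifold_group" where
  "semidirect_product N G \<pi> =
     \<lparr> carrier = carrier N \<times> carrier G,
       mult = (\<lambda>(n\<^sub>1, g\<^sub>1) (n\<^sub>2, g\<^sub>2). (n\<^sub>1 \<otimes>\<^bsub>N\<^esub> \<pi> g\<^sub>1 n\<^sub>2, g\<^sub>1 \<otimes>\<^bsub>G\<^esub> g\<^sub>2)),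
       one = (\<one>\<^bsub>N\<^esub>, \<one>\<^bsub>G\<^esub>),
       mfd = prod_manifold (mfd N) (mfd G) \<rparr>"


section \<open>Exponential function and the strong Trotter property\<close>

definition left_translate ::
    "('h, 'e::banach) manifold_group \<Rightarrow> 'h \<Rightarrow> ('h, 'e) tangent \<Rightarrow> ('h, 'e) tangent" where
  "left_translate H h x = tangent_map (mfd H) (mfd H) (\<lambda>y. h \<otimes>\<^bsub>H\<^esub> y) \<one>\<^bsub>H\<^esub> x"

text \<open>The description operator picks the end point \<open>\<eta> 1\<close>, because \<open>\<eta>\<close> itself is unconstrained outside the
  unit interval.\<close>

definition lie_exp :: "('h, 'e::banach) manifold_group \<Rightarrow> ('h, 'e) tangent \<Rightarrow> 'h" where
  "lie_exp H x = (THE h. \<exists>\<eta>. C1_curve (mfd H) {0..1} \<eta> \<and> \<eta> 0 = \<one>\<^bsub>H\<^esub> \<and>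
     (\<forall>t\<in>{0..1}. velocity (mfd H) {0..1} \<eta> t = left_translate H (\<eta> t) x) \<and> h = \<eta> 1)"

text \<open>The curve is only constrained on the unit interval; for compact \<open>K\<close> all \<open>t / n\<close> with \<open>t \<in> K\<close> lie in
  that interval for large \<open>n\<close>.\<close>

definition strong_trotter_property :: "('h, 'e::banach) manifold_group \<Rightarrow> bool" where
  "strong_trotter_property H \<longleftrightarrow>
     (\<forall>\<gamma>. C1_curve (mfd H) {0..1} \<gamma> \<and> \<gamma> 0 = \<one>\<^bsub>H\<^esub> \<longrightarrow>
       (\<forall>K. compact K \<and> K \<subseteq> {0..} \<longrightarrow>
         (\<forall>U. openin (mtop (mfd H)) U \<and> \<one>\<^bsub>H\<^esub> \<in> U \<longrightarrow>
           (\<forall>\<^sub>F n in sequentially. \<forall>t\<in>K.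
              inv\<^bsub>H\<^esub> (lie_exp H (\<lambda>c. t *\<^sub>R velocity (mfd H) {0..1} \<gamma> 0 c))
                \<otimes>\<^bsub>H\<^esub> (\<gamma> (t / real n) [^]\<^bsub>H\<^esub> n) \<in> U))))"

end

theory Submission
  imports Defs
begin

text \<open>In a chart at the identity, the group law of \<open>N\<close> satisfies \<open>\<bar>p q - p - q\<bar> \<le> C \<bar>p\<bar> \<bar>q\<bar>\<close>. This
  alone gives a discrete Gronwall inequality for products of small elements: if \<open>w\<^sub>i\<close> and \<open>w'\<^sub>i\<close> have size
  \<open>O(1/n)\<close> and distance \<open>o(1/n)\<close>, then the products of the first \<open>k \<le> n\<close> of them differ by \<open>o(1)\<close>. Hence
  for each continuous curve \<open>x\<close> in the Lie algebra the Euler products converge to a curve with logarithmic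
  derivative \<open>x\<close>, such a curve is unique, and every sequence of products with factors \<open>h x(kh) + o(h)\<close>
  converges to it.

  For \<open>\<gamma> = (a, b)\<close> the second component of \<open>\<gamma>(h)\<^sup>n\<close> is \<open>b(h)\<^sup>n\<close> and the first one is the product of the
  elements \<open>\<pi>(b(h)\<^sup>k) a(h)\<close> for \<open>k < n\<close>. If \<open>\<beta>\<close> is the one-parameter group of \<open>G\<close> with velocity \<open>x\<^sub>2\<close>, then
  \<open>b(h)\<^sup>k\<close> is close to \<open>\<beta>(kh)\<close>, so these elements are \<open>h L(\<beta>(kh)) x\<^sub>1 + o(h)\<close>, where \<open>L(g)\<close> is the derivative
  of \<open>\<pi>(g)\<close> at the identity. The error is uniform although \<open>\<pi>\<close> is only continuous: automorphisms which map
  a fixed neighbourhood of the identity into another one satisfy \<open>\<bar>\<pi>(g) v - L(g) v\<bar> \<le> K \<bar>v\<bar>\<^sup>2\<close> with a common \<open>K\<close>,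
  as one sees by comparing \<open>\<pi>(g) v\<close> with \<open>(\<pi>(g) (v/k))\<^sup>k\<close> for \<open>k \<rightarrow> \<infinity>\<close>.\<close>

section \<open>Groups with a chart at the identity\<close>

text \<open>The group \<open>H\<close> is not treated by these estimates directly: the bilinear
  bound for its multiplication would demand |\<pi>(g) n - n| \<le> C |g| |n| near the identities,
  which a merely continuous action need not satisfy. So the estimates are made in N and G
  separately, and the action enters N only through the operators L(\<pi>(g)). Norm continuity of g
  -> L(\<pi>(g)) is not to be expected either; what is available are bounds that are uniform near a
  compact piece of \<beta> and its inverses, and continuity in g for each fixed vector. All
  estimates concern increments \<nu>(s)^-1 \<nu>(t). These are invariant under left translation, so
  a curve may leave the chart at the identity while its short increments stay in it. Since
  \<open>lie_exp\<close> is a definite description, existence and uniqueness both have to be proved,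
  for two strengths of solution. The constructed curve has increments controlled uniformly in the
  base point, as the comparison of products requires. A competitor in \<open>lie_exp\<close> has
  derivatives at single points only, without a common rate, so uniqueness needs an argument with a
  barrier function.\<close>

primrec (in monoid) gprod :: "(nat \<Rightarrow> 'a) \<Rightarrow> nat \<Rightarrow> 'a" where
  "gprod w 0 = \<one>"
| "gprod w (Suc k) = gprod w k \<otimes> w k"

lemma (in monoid) gprod_closed: "(\<And>i. i < k \<Longrightarrow> w i \<in> carrier G) \<Longrightarrow> gprod w k \<in> carrier G"
  by (induction k) auto

lemma (in monoid) gprod_const: "gprod (\<lambda>_. x) k = x [^] k"
  by (induction k) auto

lemma (in monoid) gprod_add:
  assumes "\<And>i. i < j + k \<Longrightarrow> w i \<in> carrier G"
  shows "gprod w (j + k) = gprod w j \<otimes> gprod (\<lambda>i. w (j + i)) k"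
  using assms
proof (induction k)
  case 0
  then show ?case by (simp add: gprod_closed)
next
  case (Suc k)
  have "gprod w j \<in> carrier G" "gprod (\<lambda>i. w (j + i)) k \<in> carrier G" "w (j + k) \<in> carrier G"
    using Suc.prems by (auto intro!: gprod_closed)
  with Suc show ?case by (simp add: m_assoc)
qed

text \<open>In \<open>refine\<close> this turns a product over a fine grid into one with a single
  factor for each coarse step, so that the two can be compared factor by factor.\<close>

lemma (in monoid) gprod_blocks:
  assumes "\<And>i. w i \<in> carrier G"
  shows "gprod (\<lambda>i. gprod (\<lambda>j. w (m * i + j)) m) k = gprod w (m * k)"
proof (induction k)
  case (Suc k)
  have "gprod w (m * Suc k) = gprod w (m * k + m)" by (simp add: add.commute)
  also have "\<dots> = gprod w (m * k) \<otimes> gprod (\<lambda>j. w (m * k + j)) m"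
    by (rule gprod_add) (rule assms)
  finally show ?case using Suc by simp
qed simp

text \<open>A curve sampled on a grid becomes the product of its own increments, which makes it
  comparable with other products through \<open>gronwall\<close>.\<close>

lemma (in group) gprod_telescope:
  assumes "\<And>i. i \<le> k \<Longrightarrow> p i \<in> carrier G" "p 0 = \<one>"
  shows "gprod (\<lambda>i. inv (p i) \<otimes> p (Suc i)) k = p k"
  using assms(1)
proof (induction k)
  case 0 then show ?case using assms by simp
next
  case (Suc k)
  have "p k \<in> carrier G" "p (Suc k) \<in> carrier G" using Suc.prems by auto
  moreover have "gprod (\<lambda>i. inv (p i) \<otimes> p (Suc i)) k = p k" using Suc by auto
  ultimately show ?case by (simp add: m_assoc [symmetric])
qed

section \<open>Chart neighbourhoods of the identity\<close>

text \<open>\<open>lg\<close> and \<open>ex\<close> stand for a chart moved to 0 and its inverse,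
  not for the Lie logarithm and exponential. The last assumption is the only quantitative one:
  multiplication is addition up to a bilinear error. Of the inversion only continuity is assumed, so
  bounds for inverses have to be drawn from products.\<close>

locale chart_group = group N for N :: "('n, 'z) monoid_scheme" (structure) +
  fixes T :: "'n topology" and lg :: "'n \<Rightarrow> 'e::banach" and ex :: "'e \<Rightarrow> 'n"
    and dom :: "'n set" and R C :: real
  assumes topspace: "topspace T = carrier N"
    and cont_mult: "continuous_map (prod_topology T T) T (\<lambda>(x, y). x \<otimes> y)"
    and cont_inv: "continuous_map T T (\<lambda>x. inv x)"
    and open_dom: "openin T dom" and one_dom: "\<one> \<in> dom"
    and lg_one: "lg \<one> = 0"
    and lg_cont: "continuous_map (subtopology T dom) euclidean lg"
    and R_pos: "0 < R"
    and ex_dom: "norm u < R \<Longrightarrow> ex u \<in> dom" and lg_ex: "norm u < R \<Longrightarrow> lg (ex u) = u"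
    and ex_lg: "p \<in> dom \<Longrightarrow> ex (lg p) = p"
    and ex_cont: "continuous_map (top_of_set (ball 0 R)) T ex"
    and C_pos: "0 < C"
    and mult_dom: "\<lbrakk>p \<in> dom; q \<in> dom; norm (lg p) < R; norm (lg q) < R\<rbrakk> \<Longrightarrow> p \<otimes> q \<in> dom"
    and lg_mult: "\<lbrakk>p \<in> dom; q \<in> dom; norm (lg p) < R; norm (lg q) < R\<rbrakk>
      \<Longrightarrow> norm (lg (p \<otimes> q) - lg p - lg q) \<le> C * norm (lg p) * norm (lg q)"
begin

text \<open>For small radii these are the chart balls. By \<open>open_D\<close> and
  \<open>nbhd_D\<close> they form a neighbourhood base at the identity, which turns topological
  statements into norm estimates.\<close>

definition D :: "real \<Rightarrow> 'n set" where
  "D \<rho> = {p \<in> dom. norm (lg p) < \<rho>}"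

lemma dom_carrier: "p \<in> dom \<Longrightarrow> p \<in> carrier N"
  using open_dom openin_subset topspace by blast

lemma D_carrier: "p \<in> D \<rho> \<Longrightarrow> p \<in> carrier N"
  by (simp add: D_def dom_carrier)

lemma D_dom: "p \<in> D \<rho> \<Longrightarrow> p \<in> dom"
  by (simp add: D_def)

lemma D_norm: "p \<in> D \<rho> \<Longrightarrow> norm (lg p) < \<rho>"
  by (simp add: D_def)

lemma D_mono: "p \<in> D \<rho> \<Longrightarrow> \<rho> \<le> \<rho>' \<Longrightarrow> p \<in> D \<rho>'"
  by (simp add: D_def)

lemma one_D: "0 < \<rho> \<Longrightarrow> \<one> \<in> D \<rho>"
  by (simp add: D_def lg_one one_dom)

lemma ex_0: "ex 0 = \<one>"
  using ex_lg[OF one_dom] by (simp add: lg_one)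

lemma ex_D: "norm u < \<rho> \<Longrightarrow> norm u < R \<Longrightarrow> ex u \<in> D \<rho>"
  by (simp add: D_def ex_dom lg_ex)

lemma open_D: "openin T (D \<rho>)"
proof -
  have "openin (subtopology T dom) {p \<in> topspace (subtopology T dom). lg p \<in> ball 0 \<rho>}"
    using lg_cont by (rule openin_continuous_map_preimage) auto
  moreover have "{p \<in> topspace (subtopology T dom). lg p \<in> ball 0 \<rho>} = D \<rho>"
    by (auto simp: D_def topspace dom_carrier)
  ultimately show ?thesis
    using open_dom by (simp add: openin_open_subtopology)
qed

lemma nbhd_D:
  assumes "openin T W" "\<one> \<in> W"
  obtains \<rho> where "0 < \<rho>" "\<rho> \<le> R" "D \<rho> \<subseteq> W"
proof -
  have "openin (top_of_set (ball 0 R)) {u \<in> topspace (top_of_set (ball 0 R)). ex u \<in> W}"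
    using ex_cont assms(1) by (rule openin_continuous_map_preimage)
  then have "open {u \<in> ball 0 R. ex u \<in> W}"
    by (simp add: openin_open_eq)
  moreover have "0 \<in> {u \<in> ball 0 R. ex u \<in> W}"
    using assms by (simp add: ex_0 R_pos)
  ultimately obtain \<rho> where \<rho>: "0 < \<rho>" "ball 0 \<rho> \<subseteq> {u \<in> ball 0 R. ex u \<in> W}"
    unfolding open_contains_ball by blast
  have "D (min \<rho> R) \<subseteq> W"
  proof
    fix p assume p: "p \<in> D (min \<rho> R)"
    then have "lg p \<in> ball 0 \<rho>" by (simp add: D_def)
    then have "ex (lg p) \<in> W" using \<rho> by blast
    then show "p \<in> W" using p by (simp add: ex_lg D_def)
  qed
  then show thesis using that[of "min \<rho> R"] \<rho> R_pos by simp
qed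

lemma nbhd_inv:
  assumes "openin T W" "\<one> \<in> W"
  obtains \<rho> where "0 < \<rho>" "\<rho> \<le> R" "\<And>p. p \<in> D \<rho> \<Longrightarrow> inv p \<in> W"
proof -
  have "openin T {p \<in> topspace T. inv p \<in> W}"
    using cont_inv assms(1) by (rule openin_continuous_map_preimage)
  moreover have "\<one> \<in> {p \<in> topspace T. inv p \<in> W}" using assms by (simp add: topspace)
  ultimately obtain \<rho> where "0 < \<rho>" "\<rho> \<le> R" "D \<rho> \<subseteq> {p \<in> topspace T. inv p \<in> W}"
    by (rule nbhd_D)
  then show thesis using that[of \<rho>] by blast
qed

lemma nbhd_mult:
  assumes "openin T W" "\<one> \<in> W"
  obtains \<rho> where "0 < \<rho>" "\<rho> \<le> R" "\<And>p q. p \<in> D \<rho> \<Longrightarrow> q \<in> D \<rho> \<Longrightarrow> p \<otimes> q \<in> W"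
proof -
  have "openin (prod_topology T T) {z \<in> topspace (prod_topology T T). (\<lambda>(x, y). x \<otimes> y) z \<in> W}"
    using cont_mult assms(1) by (rule openin_continuous_map_preimage)
  moreover have "(\<one>, \<one>) \<in> {z \<in> topspace (prod_topology T T). (\<lambda>(x, y). x \<otimes> y) z \<in> W}"
    using assms by (simp add: topspace)
  ultimately have "\<exists>U V. openin T U \<and> openin T V \<and> \<one> \<in> U \<and> \<one> \<in> V \<and>
    U \<times> V \<subseteq> {z \<in> topspace (prod_topology T T). (\<lambda>(x, y). x \<otimes> y) z \<in> W}"
    unfolding openin_prod_topology_alt by (elim allE impE) assumption
  then obtain U V where UV: "openin T U" "openin T V" "\<one> \<in> U" "\<one> \<in> V"
    "U \<times> V \<subseteq> {z \<in> topspace (prod_topology T T). (\<lambda>(x, y). x \<otimes> y) z \<in> W}"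
    by auto
  obtain \<rho> where \<rho>: "0 < \<rho>" "\<rho> \<le> R" "D \<rho> \<subseteq> U \<inter> V"
    using nbhd_D[of "U \<inter> V"] UV by auto
  show thesis
  proof (rule that[OF \<rho>(1,2)])
    fix p q assume "p \<in> D \<rho>" "q \<in> D \<rho>"
    then have "(p, q) \<in> U \<times> V" using \<rho>(3) by auto
    then show "p \<otimes> q \<in> W" using UV(5) by auto
  qed
qed

lemma nbhd_conj: "\<exists>r. 0 < r \<and> r \<le> R \<and> C * r \<le> 1 / 2 \<and>
   (\<forall>w\<in>D r. \<forall>d\<in>D r. \<forall>w'\<in>D r. inv w \<otimes> d \<otimes> w' \<in> D R)"
proof -
  obtain a where a: "0 < a" "a \<le> R" "\<And>p q. p \<in> D a \<Longrightarrow> q \<in> D a \<Longrightarrow> p \<otimes> q \<in> D R"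
    using nbhd_mult[OF open_D one_D[OF R_pos]] by blast
  obtain b where b: "0 < b" "b \<le> R" "\<And>p q. p \<in> D b \<Longrightarrow> q \<in> D b \<Longrightarrow> p \<otimes> q \<in> D a"
    using nbhd_mult[OF open_D one_D[OF a(1)]] by blast
  obtain c where c: "0 < c" "c \<le> R" "\<And>p. p \<in> D c \<Longrightarrow> inv p \<in> D b"
    using nbhd_inv[OF open_D one_D[OF b(1)]] by blast
  define r where "r = Min {a, b, c, 1 / (2 * C)}"
  have r: "0 < r" "r \<le> a" "r \<le> b" "r \<le> c" "r \<le> 1 / (2 * C)"
    using a b c C_pos by (auto simp: r_def)
  have "inv w \<otimes> d \<otimes> w' \<in> D R" if "w \<in> D r" "d \<in> D r" "w' \<in> D r" for w d w'
    using that r by (meson a(3) b(3) c(3) D_mono)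
  moreover have "C * r \<le> 1 / 2" using r C_pos by (simp add: field_simps)
  ultimately show ?thesis using r a by (intro exI[of _ r]) auto
qed

text \<open>The working radius. \<open>C * r0 \<le> 1 / 2\<close> makes the error of a product at
  most half the size of one factor, and the conjugation property keeps the errors of the Gronwall
  recursion in the region where \<open>lg_mult\<close> applies.\<close>

definition r0 :: real where
  "r0 = (SOME r. 0 < r \<and> r \<le> R \<and> C * r \<le> 1 / 2 \<and>
   (\<forall>w\<in>D r. \<forall>d\<in>D r. \<forall>w'\<in>D r. inv w \<otimes> d \<otimes> w' \<in> D R))"

lemma r0_pos: "0 < r0" and r0_le: "r0 \<le> R" and r0_C: "C * r0 \<le> 1 / 2"
  and r0_conj: "w \<in> D r0 \<Longrightarrow> d \<in> D r0 \<Longrightarrow> w' \<in> D r0 \<Longrightarrow> inv w \<otimes> d \<otimes> w' \<in> D R"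
  using someI_ex[OF nbhd_conj] unfolding r0_def[symmetric] by auto

lemma D_r0_R: "p \<in> D r0 \<Longrightarrow> p \<in> D R"
  using D_mono r0_le by blast

lemma D_mult_dom: "p \<in> D R \<Longrightarrow> q \<in> D R \<Longrightarrow> p \<otimes> q \<in> dom"
  by (simp add: D_def mult_dom)

lemma D_lg_mult: "p \<in> D R \<Longrightarrow> q \<in> D R \<Longrightarrow>
   norm (lg (p \<otimes> q) - lg p - lg q) \<le> C * norm (lg p) * norm (lg q)"
  by (simp add: D_def lg_mult)

text \<open>Writing \<open>e = w\<^sup>-\<^sup>1 d w'\<close> as \<open>w e = d w'\<close> avoids estimating the inversion.\<close>

lemma conj_est:
  assumes "w \<in> D r0" "d \<in> D r0" "w' \<in> D r0" "norm (lg w) \<le> \<kappa>" "norm (lg w') \<le> \<kappa>" "\<kappa> \<le> r0"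
  shows "norm (lg (inv w \<otimes> d \<otimes> w')) \<le> norm (lg d) * (1 + 4 * C * \<kappa>) + 2 * norm (lg w - lg w')"
proof -
  define e where "e = inv w \<otimes> d \<otimes> w'"
  have car: "w \<in> carrier N" "d \<in> carrier N" "w' \<in> carrier N"
    using assms D_carrier by auto
  have eR: "e \<in> D R" unfolding e_def using assms r0_conj by blast
  have we: "w \<otimes> e = d \<otimes> w'"
    using car by (simp add: e_def m_assoc[symmetric])
  define y where "y = C * \<kappa>"
  have k0: "0 \<le> \<kappa>" using assms norm_ge_zero order_trans by blast
  have y: "0 \<le> y" "y \<le> 1/2"
    unfolding y_def using k0 C_pos r0_C mult_left_mono[OF assms(6), of C] by (simp, linarith)
  have "norm (lg (w \<otimes> e) - lg w - lg e) \<le> C * norm (lg w) * norm (lg e)"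
    using assms eR D_r0_R by (intro D_lg_mult) auto
  also have "\<dots> \<le> y * norm (lg e)"
    using assms C_pos by (simp add: y_def mult_right_mono mult_left_mono)
  finally have 1: "norm (lg (w \<otimes> e) - lg w - lg e) \<le> y * norm (lg e)" .
  have "norm (lg (d \<otimes> w') - lg d - lg w') \<le> C * norm (lg d) * norm (lg w')"
    using assms D_r0_R by (intro D_lg_mult) auto
  also have "\<dots> \<le> y * norm (lg d)"
    using mult_right_mono[OF assms(5) norm_ge_zero[of "lg d"]] C_pos by (simp add: y_def mult_ac)
  finally have 2: "norm (lg (d \<otimes> w') - lg d - lg w') \<le> y * norm (lg d)" .
  have "lg e = lg d - (lg w - lg w') - (lg (w \<otimes> e) - lg w - lg e) + (lg (d \<otimes> w') - lg d - lg w')"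
    by (simp add: we)
  then have "norm (lg e) \<le> norm (lg d) + norm (lg w - lg w') + norm (lg (w \<otimes> e) - lg w - lg e)
      + norm (lg (d \<otimes> w') - lg d - lg w')"
    by (smt (verit) norm_triangle_ineq norm_triangle_ineq4)
  then have "(1 - y) * norm (lg e) \<le> (1 + y) * norm (lg d) + norm (lg w - lg w')"
    using 1 2 by (simp add: algebra_simps)
  \<comment> \<open>For 0 \<le> y \<le> 1/2 one has 1 \<le> (1 + 2 y)(1 - y), so multiplication by 1
    + 2 y serves as division by 1 - y.\<close>
  then have "(1 + 2 * y) * ((1 - y) * norm (lg e))
      \<le> (1 + 2 * y) * ((1 + y) * norm (lg d) + norm (lg w - lg w'))"
    using y by (intro mult_left_mono) auto
  moreover have "norm (lg e) \<le> (1 + 2 * y) * ((1 - y) * norm (lg e))"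
  proof -
    have "(1 + 2 * y) * (1 - y) = 1 + y * (1 - 2 * y)" by (simp add: algebra_simps)
    then have "1 \<le> (1 + 2 * y) * (1 - y)" using y by simp
    then show ?thesis using mult_right_mono[OF _ norm_ge_zero[of "lg e"]]
      by (metis mult.assoc mult_1)
  qed
  moreover have "(1 + 2 * y) * ((1 + y) * norm (lg d) + norm (lg w - lg w'))
     \<le> norm (lg d) * (1 + 4 * y) + 2 * norm (lg w - lg w')"
  proof -
    have "(1 + 2 * y) * (1 + y) = 1 + 4 * y - y * (1 - 2 * y)" by (simp add: algebra_simps)
    then have "(1 + 2 * y) * (1 + y) \<le> 1 + 4 * y" using y by simp
    then have "(1 + 2 * y) * (1 + y) * norm (lg d) \<le> (1 + 4 * y) * norm (lg d)"
      by (intro mult_right_mono) auto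
    moreover have "(1 + 2 * y) * norm (lg w - lg w') \<le> 2 * norm (lg w - lg w')"
      using y by (intro mult_right_mono) auto
    ultimately show ?thesis by (simp add: algebra_simps)
  qed
  ultimately show ?thesis unfolding e_def y_def by (simp add: mult.assoc)
qed

section \<open>Comparison of products of small elements\<close>

text \<open>If \<open>E\<close> is the quotient of the two products of length \<open>k\<close>, the
  next quotient is \<open>inv (w k) \<otimes> E \<otimes> w' k\<close>. By \<open>conj_est\<close>
  its size is at most y |E| + 2 \<delta> with y = 1 + 4 C \<kappa>, and these bounds sum up.
  Membership in \<open>D r0\<close> is carried along because \<open>conj_est\<close> needs it; the
  smallness of the bound at \<open>n\<close> restores it in each step.\<close>

lemma gronwall_power:
  assumes "\<And>i. i < n \<Longrightarrow> w i \<in> dom" "\<And>i. i < n \<Longrightarrow> w' i \<in> dom"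
    and "\<And>i. i < n \<Longrightarrow> norm (lg (w i)) \<le> \<kappa>" "\<And>i. i < n \<Longrightarrow> norm (lg (w' i)) \<le> \<kappa>"
    and "\<And>i. i < n \<Longrightarrow> norm (lg (w i) - lg (w' i)) \<le> \<delta>" "\<kappa> < r0" "0 \<le> \<delta>" "0 \<le> \<kappa>"
    and "2 * real n * \<delta> * (1 + 4 * C * \<kappa>) ^ n < r0"
    and "k \<le> n"
  shows "inv (gprod w k) \<otimes> gprod w' k \<in> D r0 \<and>
    norm (lg (inv (gprod w k) \<otimes> gprod w' k)) \<le> 2 * real k * \<delta> * (1 + 4 * C * \<kappa>) ^ k"
  using assms(10)
proof (induction k)
  case 0
  then show ?case by (simp add: one_D r0_pos lg_one)
next
  case (Suc k)
  define y where "y = 1 + 4 * C * \<kappa>"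
  have y: "1 \<le> y" using C_pos assms by (simp add: y_def)
  define E where "E = inv (gprod w k) \<otimes> gprod w' k"
  have IH: "E \<in> D r0" "norm (lg E) \<le> 2 * real k * \<delta> * y ^ k"
    using Suc by (auto simp: E_def y_def)
  have k: "k < n" using Suc by simp
  have car: "w k \<in> carrier N" "w' k \<in> carrier N" "gprod w k \<in> carrier N" "gprod w' k \<in> carrier N"
    using assms(1,2) k dom_carrier by (auto intro!: gprod_closed)
  have wD: "w k \<in> D r0" "w' k \<in> D r0"
    using assms(1,2)[OF k] assms(3,4)[OF k] assms(6) by (auto simp: D_def)
  have eq: "inv (gprod w (Suc k)) \<otimes> gprod w' (Suc k) = inv (w k) \<otimes> E \<otimes> w' k"
    using car by (simp add: E_def inv_mult_group m_assoc)
  have "norm (lg (inv (w k) \<otimes> E \<otimes> w' k)) \<le> norm (lg E) * y + 2 * norm (lg (w k) - lg (w' k))"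
    unfolding y_def using wD IH assms(3,4)[OF k] assms(6) by (intro conj_est) auto
  also have "\<dots> \<le> 2 * real k * \<delta> * y ^ k * y + 2 * \<delta>"
    using IH(2) y assms(5)[OF k] by (intro add_mono mult_right_mono) auto
  also have "\<dots> \<le> 2 * real k * \<delta> * y ^ Suc k + 2 * \<delta> * y ^ Suc k"
    using one_le_power[OF y, of "Suc k"] assms(7) mult_left_mono[of 1 "y ^ Suc k" "2 * \<delta>"] by (simp add: mult_ac)
  also have "\<dots> = 2 * real (Suc k) * \<delta> * y ^ Suc k" by (simp add: algebra_simps)
  finally have b: "norm (lg (inv (w k) \<otimes> E \<otimes> w' k)) \<le> 2 * real (Suc k) * \<delta> * y ^ Suc k" .
  also have "\<dots> \<le> 2 * real n * \<delta> * y ^ n"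
    using Suc.prems assms(7) y by (intro mult_mono power_increasing) auto
  also have "\<dots> < r0" using assms(9) by (simp add: y_def)
  finally have "norm (lg (inv (w k) \<otimes> E \<otimes> w' k)) < r0" .
  moreover have "inv (w k) \<otimes> E \<otimes> w' k \<in> dom"
    using r0_conj[OF wD(1) IH(1) wD(2)] D_dom by blast
  ultimately show ?case using b unfolding eq y_def by (simp add: D_def)
qed

text \<open>The bound in a form independent of \<open>n\<close>: \<open>n * \<kappa> \<le> B\<close>
  turns the power into \<open>exp (4 * C * B)\<close>, so that only the total size \<open>B\<close>
  and the total deviation \<open>\<epsilon>\<close> matter.\<close>

lemma gronwall:
  assumes "\<And>i. i < n \<Longrightarrow> w i \<in> dom" "\<And>i. i < n \<Longrightarrow> w' i \<in> dom"
    and "\<And>i. i < n \<Longrightarrow> norm (lg (w i)) \<le> \<kappa>" "\<And>i. i < n \<Longrightarrow> norm (lg (w' i)) \<le> \<kappa>"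
    and "\<And>i. i < n \<Longrightarrow> norm (lg (w i) - lg (w' i)) \<le> \<delta>" "\<kappa> < r0" "0 \<le> \<delta>" "0 \<le> \<kappa>"
    and "n * \<kappa> \<le> B" "n * \<delta> \<le> \<epsilon>" "2 * \<epsilon> * exp (4 * C * B) < \<rho>" "\<rho> \<le> r0"
    and "k \<le> n"
  shows "inv (gprod w k) \<otimes> gprod w' k \<in> D \<rho>"
proof -
  define y where "y = 1 + 4 * C * \<kappa>"
  have y: "1 \<le> y" using C_pos assms by (simp add: y_def)
  have "y ^ n \<le> exp (4 * C * \<kappa>) ^ n"
    unfolding y_def using C_pos assms(8) by (intro power_mono) (auto intro: exp_ge_add_one_self)
  also have "\<dots> = exp (4 * C * (n * \<kappa>))"
    by (simp add: exp_of_nat_mult[symmetric] algebra_simps)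
  also have "\<dots> \<le> exp (4 * C * B)" using C_pos assms by simp
  finally have e: "y ^ n \<le> exp (4 * C * B)" .
  have m: "2 * real n * \<delta> * y ^ n < \<rho>"
  proof -
    have "0 \<le> n * \<delta>" using assms by simp
    then have "(n * \<delta>) * y ^ n \<le> \<epsilon> * exp (4 * C * B)"
      using e assms(10) y by (intro mult_mono[OF assms(10)]) auto
    then show ?thesis using assms by simp
  qed
  have G: "inv (gprod w k) \<otimes> gprod w' k \<in> D r0 \<and>
    norm (lg (inv (gprod w k) \<otimes> gprod w' k)) \<le> 2 * real k * \<delta> * (1 + 4 * C * \<kappa>) ^ k"
    by (rule gronwall_power[of n w w']) (use assms m in \<open>auto simp: y_def\<close>)
  have "2 * real k * \<delta> * y ^ k \<le> 2 * real n * \<delta> * y ^ n"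
    using assms y by (intro mult_mono power_increasing) auto
  with G m show ?thesis by (auto simp: D_def y_def)
qed

text \<open>Each further factor adds a product error of at most
  \<open>C * (2 * \<sigma>) * \<kappa>\<close>. The induction keeps the total error proportional to
  \<open>k * \<kappa>\<close>: with \<open>2 * C * \<sigma> \<le> 1\<close> it then gives the size
  bound \<open>2 * (k * \<kappa>)\<close> on which the next step relies.\<close>

lemma gprod_est:
  assumes "\<And>i. i < n \<Longrightarrow> w i \<in> dom" "\<And>i. i < n \<Longrightarrow> norm (lg (w i)) \<le> \<kappa>"
    and "n * \<kappa> \<le> \<sigma>" "2 * C * \<sigma> \<le> 1" "2 * \<sigma> < R"
  shows "gprod w n \<in> dom \<and> norm (lg (gprod w n)) \<le> 2 * \<sigma> \<and>
     norm (lg (gprod w n) - (\<Sum>i<n. lg (w i))) \<le> 2 * C * \<sigma>\<^sup>2"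
proof (cases "n = 0")
  case True
  then show ?thesis using assms C_pos by (simp add: one_dom lg_one)
next
  case False
  have k0: "0 \<le> \<kappa>" using assms(2)[of 0] False norm_ge_zero order_trans by blast
  have s0: "0 \<le> \<sigma>" using assms(3) k0 by (meson mult_nonneg_nonneg of_nat_0_le_iff order_trans)
  have "gprod w k \<in> dom \<and> norm (lg (gprod w k)) \<le> 2 * (k * \<kappa>) \<and>
     norm (lg (gprod w k) - (\<Sum>i<k. lg (w i))) \<le> 2 * C * \<sigma> * (k * \<kappa>)" if "k \<le> n" for k
    using that
  proof (induction k)
    case 0 then show ?case by (simp add: one_dom lg_one)
  next
    case (Suc k)
    have k: "k < n" using Suc by simp
    have le: "real (Suc k) * \<kappa> \<le> \<sigma>"
      using mult_right_mono[of "real (Suc k)" "real n" \<kappa>] k k0 assms(3) by linarith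
    then have le': "k * \<kappa> \<le> \<sigma>" "\<kappa> \<le> \<sigma>" using k0 by (simp_all add: algebra_simps)
      (smt (verit) mult_nonneg_nonneg of_nat_0_le_iff)
    have IH: "gprod w k \<in> dom" "norm (lg (gprod w k)) \<le> 2 * (k * \<kappa>)"
      "norm (lg (gprod w k) - (\<Sum>i<k. lg (w i))) \<le> 2 * C * \<sigma> * (k * \<kappa>)"
      using Suc by auto
    have D: "gprod w k \<in> D R" "w k \<in> D R"
      using IH le' assms(1,2)[OF k] assms(5) s0 by (auto simp: D_def)
    have "norm (lg (gprod w k \<otimes> w k) - lg (gprod w k) - lg (w k)) \<le> C * norm (lg (gprod w k)) * norm (lg (w k))"
      using D by (rule D_lg_mult)
    also have "\<dots> \<le> C * (2 * \<sigma>) * \<kappa>"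
      using IH le' C_pos assms(2)[OF k] k0 s0 by (intro mult_mono) auto
    finally have m: "norm (lg (gprod w k \<otimes> w k) - lg (gprod w k) - lg (w k)) \<le> C * (2 * \<sigma>) * \<kappa>" .
    have "lg (gprod w k \<otimes> w k) - (\<Sum>i<Suc k. lg (w i)) = (lg (gprod w k \<otimes> w k) - lg (gprod w k) - lg (w k))
      + (lg (gprod w k) - (\<Sum>i<k. lg (w i)))" by simp
    then have "norm (lg (gprod w k \<otimes> w k) - (\<Sum>i<Suc k. lg (w i))) \<le> C * (2 * \<sigma>) * \<kappa> + 2 * C * \<sigma> * (k * \<kappa>)"
      using m IH(3) norm_triangle_ineq by (smt (verit))
    also have "\<dots> = 2 * C * \<sigma> * (Suc k * \<kappa>)" by (simp add: algebra_simps)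
    finally have b: "norm (lg (gprod w k \<otimes> w k) - (\<Sum>i<Suc k. lg (w i))) \<le> 2 * C * \<sigma> * (Suc k * \<kappa>)" .
    also have "\<dots> \<le> 1 * (Suc k * \<kappa>)"
      using assms(4) k0 by (intro mult_right_mono) auto
    finally have c: "norm (lg (gprod w k \<otimes> w k) - (\<Sum>i<Suc k. lg (w i))) \<le> Suc k * \<kappa>" by simp
    have "norm (\<Sum>i<Suc k. lg (w i)) \<le> (\<Sum>i<Suc k. \<kappa>)"
      by (rule sum_norm_le) (use assms(2) k in auto)
    then have "norm (\<Sum>i<Suc k. lg (w i)) \<le> Suc k * \<kappa>" by (simp add: algebra_simps)
    then have "norm (lg (gprod w k \<otimes> w k)) \<le> 2 * (Suc k * \<kappa>)"
      using c norm_triangle_sub[of "lg (gprod w k \<otimes> w k)" "\<Sum>i<Suc k. lg (w i)"] by linarith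
    then show ?case using b D D_mult_dom by simp
  qed
  from this[of n] have G: "gprod w n \<in> dom" "norm (lg (gprod w n)) \<le> 2 * (n * \<kappa>)"
     "norm (lg (gprod w n) - (\<Sum>i<n. lg (w i))) \<le> 2 * C * \<sigma> * (n * \<kappa>)" by auto
  have "2 * C * \<sigma> * (n * \<kappa>) \<le> 2 * C * \<sigma> * \<sigma>"
    using assms(3) C_pos s0 by (intro mult_left_mono) auto
  then show ?thesis using G assms(3) by (auto simp: power2_eq_square)
qed


section \<open>Equicontinuous families of endomorphisms\<close>

text \<open>Inside \<open>D r0\<close> each multiplication by \<open>q\<close> deviates from
  addition by at most |q| / 2, because \<open>C * r0 \<le> 1 / 2\<close>. Hence the k-th power has
  size at least k |q| / 2, while it still lies in \<open>D r0\<close>.\<close>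

lemma power_root_bound:
  fixes k :: nat
  assumes q: "q \<in> carrier N" and p: "\<And>j::nat. j \<le> k \<Longrightarrow> q [^] j \<in> D r0"
  shows "k * norm (lg q) \<le> 2 * r0"
proof (cases "k = 0")
  case True then show ?thesis using r0_pos by simp
next
  case False
  then have qD: "q \<in> D r0" using p[of "Suc 0"] q by simp
  have "norm (lg (q [^] j) - j *\<^sub>R lg q) \<le> j * (1/2 * norm (lg q))" if "j \<le> k" for j :: nat
    using that
  proof (induction j)
    case 0 then show ?case by (simp add: lg_one)
  next
    case (Suc j)
    have qj: "q [^] j \<in> D r0" using Suc p by simp
    have "norm (lg (q [^] j \<otimes> q) - lg (q [^] j) - lg q) \<le> C * norm (lg (q [^] j)) * norm (lg q)"
      using qj qD D_r0_R by (intro D_lg_mult) auto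
    also have "\<dots> \<le> C * r0 * norm (lg q)"
      using D_norm[OF qj] C_pos by (intro mult_right_mono mult_left_mono) auto
    also have "\<dots> \<le> 1/2 * norm (lg q)" using r0_C by (intro mult_right_mono) auto
    finally have 1: "norm (lg (q [^] j \<otimes> q) - lg (q [^] j) - lg q) \<le> 1/2 * norm (lg q)" .
    have "lg (q [^] Suc j) - Suc j *\<^sub>R lg q = (lg (q [^] j \<otimes> q) - lg (q [^] j) - lg q) + (lg (q [^] j) - j *\<^sub>R lg q)"
      by (simp add: algebra_simps)
    then have "norm (lg (q [^] Suc j) - Suc j *\<^sub>R lg q) \<le> 1/2 * norm (lg q) + j * (1/2 * norm (lg q))"
      using 1 Suc norm_triangle_ineq by (smt (verit) Suc_leD)
    then show ?case by (simp add: algebra_simps)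
  qed
  from this[of k] have "norm (lg (q [^] k) - k *\<^sub>R lg q) \<le> k * (1/2 * norm (lg q))" by simp
  moreover have "norm (k *\<^sub>R lg q) \<le> norm (lg (q [^] k)) + norm (lg (q [^] k) - k *\<^sub>R lg q)"
    by (metis norm_minus_commute norm_triangle_sub add.commute)
  moreover have "norm (lg (q [^] k)) < r0" using p D_norm by blast
  ultimately show ?thesis by simp
qed

lemma pow_est:
  assumes "p \<in> dom" "k * norm (lg p) \<le> \<sigma>" "2 * C * \<sigma> \<le> 1" "2 * \<sigma> < R"
  shows "p [^] (k::nat) \<in> dom \<and> norm (lg (p [^] k)) \<le> 2 * \<sigma> \<and> norm (lg (p [^] k) - k *\<^sub>R lg p) \<le> 2 * C * \<sigma>\<^sup>2"
  using gprod_est[of k "\<lambda>_. p" "norm (lg p)" \<sigma>] assms by (simp add: gprod_const sum_constant_scaleR)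

text \<open>Equicontinuity at the identity, asked for one target neighbourhood only. For
  homomorphisms this is enough: \<open>equicont_bound\<close> improves it to a common Lipschitz
  bound.\<close>

definition equicont :: "('n \<Rightarrow> 'n) set \<Rightarrow> bool" where
  "equicont A \<longleftrightarrow> A \<subseteq> hom N N \<and> (\<exists>\<delta>>0. \<forall>f\<in>A. \<forall>p\<in>D \<delta>. f p \<in> D r0)"

text \<open>If \<open>p\<close> has about \<open>c / \<bar>p\<bar>\<close> powers near \<open>\<one>\<close>, then so has \<open>f p\<close>, which forces \<open>f p\<close> to be of
  size \<open>O(\<bar>p\<bar>)\<close>.\<close>

lemma equicont_bound:
  assumes "equicont A"
  shows "\<exists>K \<delta>. 0 < K \<and> 0 < \<delta> \<and> \<delta> \<le> R \<and> (\<forall>f\<in>A. \<forall>p\<in>D \<delta>. f p \<in> D R \<and> norm (lg (f p)) \<le> K * norm (lg p))"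
proof -
  obtain \<delta>' where d': "0 < \<delta>'" "\<And>f p. f \<in> A \<Longrightarrow> p \<in> D \<delta>' \<Longrightarrow> f p \<in> D r0"
    using assms unfolding equicont_def by blast
  define \<delta>1 where "\<delta>1 = min \<delta>' R"
  have d1: "0 < \<delta>1" "\<delta>1 \<le> R" "\<And>f p. f \<in> A \<Longrightarrow> p \<in> D \<delta>1 \<Longrightarrow> f p \<in> D r0"
    using d' R_pos by (auto simp: \<delta>1_def D_def)
  \<comment> \<open>Powers with j |p| \<le> c have size at most 2 c < \<delta>1 by
    \<open>pow_est\<close>, so \<open>f\<close> maps them into \<open>D r0\<close>.\<close>
  define c where "c = min (\<delta>1 / 3) (1 / (2 * C))"
  have c: "0 < c" "2 * c < \<delta>1" "2 * C * c \<le> 1" "c \<le> 1 / (2 * C)" "2 * c < R"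
  proof -
    show "0 < c" "c \<le> 1 / (2 * C)" using d1 C_pos by (auto simp: c_def)
    have "c \<le> \<delta>1 / 3" by (simp add: c_def)
    then show "2 * c < \<delta>1" using d1 by simp
    then show "2 * c < R" using d1 by simp
    show "2 * C * c \<le> 1" using \<open>c \<le> 1 / (2 * C)\<close> C_pos by (simp add: field_simps)
  qed
  \<comment> \<open>The number \<open>k\<close> of usable powers is at least c / (2 |p|) because |p|
    < c / 2, and \<open>power_root_bound\<close> gives k |f p| \<le> 2 r0. Dividing yields this
    constant.\<close>
  define K where "K = 4 * r0 / c"
  have "f p \<in> D R \<and> norm (lg (f p)) \<le> K * norm (lg p)" if fA: "f \<in> A" and p: "p \<in> D (c/2)" for f p
  proof
    have hom: "group_hom N N f" using fA assms group_axioms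
      by (auto simp: equicont_def group_hom_def group_hom_axioms_def)
    have pc: "p \<in> carrier N" using p D_carrier by blast
    have pd1: "p \<in> D \<delta>1" using p c by (auto simp: D_def)
    show fpR: "f p \<in> D R" using d1(3)[OF fA pd1] D_r0_R by blast
    show "norm (lg (f p)) \<le> K * norm (lg p)"
    proof (cases "lg p = 0")
      case True
      then have "p = \<one>" using ex_lg[OF D_dom[OF p]] ex_0 by simp
      then show ?thesis using group_hom.hom_one[OF hom] by (simp add: lg_one)
    next
      case False
      define k where "k = nat \<lfloor>c / norm (lg p)\<rfloor>"
      have x: "c / norm (lg p) \<ge> 0" using c by simp
      have "real k = of_int \<lfloor>c / norm (lg p)\<rfloor>" unfolding k_def using x by simp
      then have k1: "real k \<le> c / norm (lg p)" "c / norm (lg p) - 1 < real k" by linarith+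
      have kp: "k * norm (lg p) \<le> c" using k1 False by (simp add: field_simps)
      have "1 \<le> c / 2 / norm (lg p)" using D_norm[OF p] False by (simp add: field_simps)
      then have k2: "c / 2 / norm (lg p) \<le> k" using k1 by (simp add: field_simps)
      have "f p [^] j \<in> D r0" if "j \<le> k" for j :: nat
      proof -
        have "j * norm (lg p) \<le> c" using that kp
          by (meson mult_right_mono norm_ge_zero of_nat_le_iff order_trans)
        then have "p [^] j \<in> D \<delta>1"
          using pow_est[of p j c] D_dom[OF p] c by (auto simp: D_def)
        then have "f (p [^] j) \<in> D r0" using d1(3) fA by blast
        then show ?thesis using group_hom.hom_nat_pow[OF hom pc] by simp
      qed
      then have "k * norm (lg (f p)) \<le> 2 * r0"
        using D_carrier fpR by (intro power_root_bound) auto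
      moreover have "c / 2 / norm (lg p) * norm (lg (f p)) \<le> k * norm (lg (f p))"
        using k2 by (intro mult_right_mono) auto
      ultimately have "c / 2 / norm (lg p) * norm (lg (f p)) \<le> 2 * r0" by simp
      then show ?thesis using False c by (simp add: K_def field_simps)
    qed
  qed
  moreover have "0 < K" using c r0_pos by (simp add: K_def)
  ultimately show ?thesis using c by (intro exI[of _ K] exI[of _ "c/2"]) auto
qed

section \<open>Uniform differentiability of equicontinuous families\<close>

text \<open>The k-th power of \<open>ex (v /\<^sub>R real k)\<close> and its image under
  \<open>f\<close> both fall under \<open>pow_est\<close>, with total sizes |v| and K1 |v| that do
  not involve \<open>k\<close>. All errors are therefore O(|v|^2), uniformly in \<open>k\<close> and
  \<open>f\<close>.\<close>

lemma equicont_homogeneous: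
  assumes "equicont A"
  obtains K \<delta> where "0 < K" "0 < \<delta>" "\<delta> \<le> R"
    "\<And>f v. f \<in> A \<Longrightarrow> norm v < \<delta> \<Longrightarrow> f (ex v) \<in> D R"
    "\<And>f v. f \<in> A \<Longrightarrow> norm v < \<delta> \<Longrightarrow> norm (lg (f (ex v))) \<le> K * norm v"
    "\<And>f v (k::nat). f \<in> A \<Longrightarrow> norm v < \<delta> \<Longrightarrow> k \<noteq> 0 \<Longrightarrow>
       norm (lg (f (ex v)) - real k *\<^sub>R lg (f (ex (v /\<^sub>R real k)))) \<le> K * (norm v)\<^sup>2"
proof -
  obtain K1 \<delta>1 where K1: "0 < K1" "0 < \<delta>1" "\<delta>1 \<le> R"
    "\<And>f p. f \<in> A \<Longrightarrow> p \<in> D \<delta>1 \<Longrightarrow> f p \<in> D R"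
    "\<And>f p. f \<in> A \<Longrightarrow> p \<in> D \<delta>1 \<Longrightarrow> norm (lg (f p)) \<le> K1 * norm (lg p)"
    using equicont_bound[OF assms] by metis
  define s where "s = Min {R / 4, 1 / (2 * C)}"
  have s: "0 < s" "2 * C * s \<le> 1" "2 * s < R"
  proof -
    show "0 < s" using R_pos C_pos by (auto simp: s_def)
    have "s \<le> 1 / (2 * C)" "s \<le> R / 4" by (auto simp: s_def)
    then show "2 * C * s \<le> 1" "2 * s < R" using C_pos R_pos by (auto simp: field_simps)
  qed
  obtain \<rho>1 where r1: "0 < \<rho>1" "\<rho>1 \<le> R" "\<And>p q. p \<in> D \<rho>1 \<Longrightarrow> q \<in> D \<rho>1 \<Longrightarrow> p \<otimes> q \<in> D (min \<delta>1 r0)"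
    using nbhd_mult[OF open_D one_D[of "min \<delta>1 r0"]] K1(2) r0_pos by auto
  obtain \<rho>2 where r2: "0 < \<rho>2" "\<rho>2 \<le> R" "\<And>p. p \<in> D \<rho>2 \<Longrightarrow> inv p \<in> D \<rho>1"
    using nbhd_inv[OF open_D one_D[OF r1(1)]] by blast
  define \<delta> where "\<delta> = Min {\<rho>1 / 3, \<rho>2, s, s / K1, r0, \<delta>1}"
  have d: "0 < \<delta>" "2 * \<delta> < \<rho>1" "\<delta> \<le> \<rho>2" "\<delta> \<le> s" "\<delta> \<le> s / K1" "\<delta> \<le> r0" "\<delta> \<le> \<delta>1"
  proof -
    show "0 < \<delta>" "\<delta> \<le> \<rho>2" "\<delta> \<le> s" "\<delta> \<le> s / K1" "\<delta> \<le> r0" "\<delta> \<le> \<delta>1"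
      using r1 r2 s K1 r0_pos by (auto simp: \<delta>_def)
    have "\<delta> \<le> \<rho>1 / 3" unfolding \<delta>_def by (rule Min_le) auto
    then show "2 * \<delta> < \<rho>1" using r1 by simp
  qed
  have dR: "\<delta> \<le> R" using d K1 by simp
  \<comment> \<open>One summand for each source: the Lipschitz bound for \<open>f\<close>, the error
    of the k-th power of \<open>f (ex u)\<close>, and the difference between \<open>f q\<close> and
    \<open>f (ex v)\<close>.\<close>
  define K where "K = K1 + 2 * C * K1\<^sup>2 + 8 * C * K1"
  have *: "f (ex v) \<in> D R \<and> norm (lg (f (ex v))) \<le> K * norm v \<and>
     (\<forall>k::nat. k \<noteq> 0 \<longrightarrow> norm (lg (f (ex v)) - real k *\<^sub>R lg (f (ex (v /\<^sub>R real k)))) \<le> K * (norm v)\<^sup>2)"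
    if fA: "f \<in> A" and v: "norm v < \<delta>" for f v
  proof (intro conjI allI impI)
    have hom: "group_hom N N f" using fA assms group_axioms
      by (auto simp: equicont_def group_hom_def group_hom_axioms_def)
    have vD: "ex v \<in> D \<delta>" "lg (ex v) = v" using v dR by (auto intro: ex_D lg_ex)
    have vd1: "ex v \<in> D \<delta>1" using vD d D_mono by blast
    show fvR: "f (ex v) \<in> D R" using K1 fA vd1 by blast
    have fv: "norm (lg (f (ex v))) \<le> K1 * norm v" using K1(5)[OF fA vd1] vD by simp
    also have "\<dots> \<le> K * norm v" using C_pos K1 by (intro mult_right_mono) (auto simp: K_def)
    finally show "norm (lg (f (ex v))) \<le> K * norm v" .
    fix k :: nat assume "k \<noteq> 0"
    then have k: "0 < k" by simp
    define u where "u = v /\<^sub>R k"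
    have nu: "k * norm u = norm v" using k by (simp add: u_def)
    have "norm u \<le> norm v" using k mult_right_mono[of 1 "real k" "norm u"] unfolding nu[symmetric] by simp
    then have u: "norm u < \<delta>" using v by simp
    have uD: "ex u \<in> D \<delta>" "lg (ex u) = u" using u dR by (auto intro: ex_D lg_ex)
    have ud1: "ex u \<in> D \<delta>1" using uD d D_mono by blast
    have car: "ex u \<in> carrier N" "ex v \<in> carrier N" using uD vD D_carrier by auto
    have nv: "2 * C * norm v \<le> 1" "2 * norm v < R"
    proof -
      have "2 * C * norm v \<le> 2 * C * s" using v d C_pos by (intro mult_left_mono) auto
      then show "2 * C * norm v \<le> 1" using s by simp
      show "2 * norm v < R" using v d s by simp
    qed
    define q where "q = ex u [^] k"
    have q: "q \<in> dom" "norm (lg q) \<le> 2 * norm v" "norm (lg q - v) \<le> 2 * C * (norm v)\<^sup>2"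
    proof -
      have "k *\<^sub>R u = v" using k by (simp add: u_def)
      then show "q \<in> dom" "norm (lg q) \<le> 2 * norm v" "norm (lg q - v) \<le> 2 * C * (norm v)\<^sup>2"
        using pow_est[of "ex u" k "norm v"] D_dom[OF uD(1)] nu nv unfolding uD(2) q_def by auto
    qed
    have "norm v < \<rho>2" using v d by simp
    then have "ex v \<in> D \<rho>2" using v dR by (intro ex_D) auto
    then have iv: "inv (ex v) \<in> D \<rho>1" using r2 by blast
    have "q \<in> D \<rho>1" using q v d by (auto simp: D_def)
    \<comment> \<open>The power \<open>q\<close> differs from \<open>ex v\<close> by a right factor
      of size O(|v|^2). Applying the homomorphism \<open>f\<close> and its Lipschitz bound
      transports this to \<open>f q\<close> and \<open>f (ex v)\<close>.\<close>
    define w where "w = inv (ex v) \<otimes> q"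
    have wD: "w \<in> D \<delta>1" "w \<in> D r0" using r1(3)[OF iv \<open>q \<in> D \<rho>1\<close>] by (auto simp: w_def D_def)
    have qc: "q \<in> carrier N" using q dom_carrier by blast
    have qw: "q = ex v \<otimes> w" using car qc by (simp add: w_def m_assoc[symmetric])
    have wc: "w \<in> carrier N" using wD D_carrier by blast
    have vR: "ex v \<in> D R" using vD dR D_mono by blast
    have "norm (lg q - v - lg w) \<le> C * norm v * norm (lg w)"
      using D_lg_mult[of "ex v" w] wD D_r0_R vR vD(2) by (simp add: qw)
    also have "\<dots> \<le> 1/2 * norm (lg w)" using nv by (intro mult_right_mono) auto
    finally have "norm (lg q - v - lg w) \<le> 1/2 * norm (lg w)" .
    moreover have "norm (lg w) \<le> norm (lg q - v) + norm (lg q - v - lg w)"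
      by (metis norm_triangle_sub norm_minus_commute)
    ultimately have nw: "norm (lg w) \<le> 4 * C * (norm v)\<^sup>2" using q(3) by simp
    have fq: "f q = f (ex v) \<otimes> f w" unfolding qw
      using hom car wc by (simp add: group_hom.hom_mult)
    have fw: "f w \<in> D R" "norm (lg (f w)) \<le> K1 * (4 * C * (norm v)\<^sup>2)"
    proof -
      show "f w \<in> D R" using K1 fA wD by blast
      have "norm (lg (f w)) \<le> K1 * norm (lg w)" using K1 fA wD by blast
      also have "\<dots> \<le> K1 * (4 * C * (norm v)\<^sup>2)" using nw K1 by (intro mult_left_mono) auto
      finally show "norm (lg (f w)) \<le> K1 * (4 * C * (norm v)\<^sup>2)" .
    qed
    have "norm v \<le> s / K1" using v d by simp
    then have kv: "K1 * norm v \<le> s" using K1 by (simp add: field_simps)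
    have kvC: "C * (K1 * norm v) \<le> 1" using mult_left_mono[OF kv, of C] C_pos s mult_pos_pos[of C s] by linarith
    have "norm (lg (f q) - lg (f (ex v)) - lg (f w)) \<le> C * norm (lg (f (ex v))) * norm (lg (f w))"
      unfolding fq using fvR fw by (intro D_lg_mult)
    also have "\<dots> \<le> 1 * norm (lg (f w))"
      using order_trans[OF mult_left_mono[OF fv, of C] kvC] C_pos by (intro mult_right_mono) auto
    finally have "norm (lg (f q) - lg (f (ex v)) - lg (f w)) \<le> norm (lg (f w))" by simp
    then have "norm (lg (f q) - lg (f (ex v))) \<le> 2 * norm (lg (f w))"
      using norm_triangle_sub[of "lg (f q) - lg (f (ex v))" "lg (f w)"] by simp
    then have e1: "norm (lg (f q) - lg (f (ex v))) \<le> 8 * C * K1 * (norm v)\<^sup>2" using fw by (simp add: mult_ac)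
    have fq2: "f q = f (ex u) [^] k" unfolding q_def using group_hom.hom_nat_pow[OF hom car(1)] by simp
    have "norm (lg (f (ex u))) \<le> K1 * norm u" using K1(5)[OF fA ud1] uD by simp
    then have "k * norm (lg (f (ex u))) \<le> k * (K1 * norm u)" by (intro mult_left_mono) auto
    also have "\<dots> = K1 * norm v" using nu by (simp add: mult.left_commute)
    finally have kf: "k * norm (lg (f (ex u))) \<le> K1 * norm v" .
    have "norm (lg (f q) - k *\<^sub>R lg (f (ex u))) \<le> 2 * C * (K1 * norm v)\<^sup>2"
    proof -
      have "2 * C * (K1 * norm v) \<le> 1" using mult_left_mono[OF kv, of C] C_pos s by linarith
      then show ?thesis unfolding fq2 using pow_est[of "f (ex u)" k "K1 * norm v"] kf kv s K1(4)[OF fA ud1] D_dom by auto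
    qed
    then have "norm (lg (f (ex v)) - k *\<^sub>R lg (f (ex u))) \<le> 2 * C * (K1 * norm v)\<^sup>2 + 8 * C * K1 * (norm v)\<^sup>2"
      using e1 norm_triangle_ineq[of "lg (f (ex v)) - lg (f q)" "lg (f q) - k *\<^sub>R lg (f (ex u))"]
      by (simp add: norm_minus_commute)
    also have "\<dots> = (2 * C * K1\<^sup>2 + 8 * C * K1) * (norm v)\<^sup>2" by (simp add: algebra_simps power_mult_distrib)
    also have "\<dots> \<le> K * (norm v)\<^sup>2" using K1 by (intro mult_right_mono) (auto simp: K_def)
    finally show "norm (lg (f (ex v)) - real k *\<^sub>R lg (f (ex (v /\<^sub>R real k)))) \<le> K * (norm v)\<^sup>2" unfolding u_def .
  qed
  have "0 < K" using K1 C_pos by (simp add: K_def add_pos_nonneg)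
  from that[OF this d(1) dR] * show thesis by auto
qed

text \<open>Let \<open>k\<close> tend to infinity in the last estimate of
  \<open>equicont_homogeneous\<close>: by differentiability at 0, k lg(f(ex(v/k))) tends to L f v.
  The quadratic remainder gets a common constant although no common bound on second derivatives is
  given.\<close>

lemma equicont_derivative:
  assumes A: "equicont A"
    and L: "\<And>f. f \<in> A \<Longrightarrow> ((\<lambda>v. lg (f (ex v))) has_derivative L f) (at 0)"
  obtains K \<delta> where "0 < K" "0 < \<delta>" "\<delta> \<le> R"
    "\<And>f v. f \<in> A \<Longrightarrow> norm v < \<delta> \<Longrightarrow> f (ex v) \<in> D R"
    "\<And>f v. f \<in> A \<Longrightarrow> norm v < \<delta> \<Longrightarrow> norm (lg (f (ex v)) - L f v) \<le> K * (norm v)\<^sup>2"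
    "\<And>f v. f \<in> A \<Longrightarrow> norm (L f v) \<le> K * norm v"
proof -
  obtain K \<delta> where K: "0 < K" "0 < \<delta>" "\<delta> \<le> R"
    "\<And>f v. f \<in> A \<Longrightarrow> norm v < \<delta> \<Longrightarrow> f (ex v) \<in> D R"
    "\<And>f v. f \<in> A \<Longrightarrow> norm v < \<delta> \<Longrightarrow> norm (lg (f (ex v))) \<le> K * norm v"
    "\<And>f v (k::nat). f \<in> A \<Longrightarrow> norm v < \<delta> \<Longrightarrow> k \<noteq> 0 \<Longrightarrow>
       norm (lg (f (ex v)) - real k *\<^sub>R lg (f (ex (v /\<^sub>R real k)))) \<le> K * (norm v)\<^sup>2"
    by (rule equicont_homogeneous[OF A]) (rule that; blast)
  have lim: "(\<lambda>k. real k *\<^sub>R lg (f (ex (v /\<^sub>R real k)))) \<longlonglongrightarrow> L f v" if f: "f \<in> A" for f v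
  proof -
    have "f \<in> hom N N" using f A by (auto simp: equicont_def)
    then have "f (ex 0) = \<one>" using hom_one[OF _ is_group is_group] by (simp add: ex_0)
    then have f0: "lg (f (ex 0)) = 0" by (simp add: lg_one)
    have lin: "linear (L f)" using L[OF f] has_derivative_linear by blast
    have "((\<lambda>s. lg (f (ex (s *\<^sub>R v)))) has_derivative (\<lambda>s. L f (s *\<^sub>R v))) (at (0::real))"
      by (rule has_derivative_compose[where f = "\<lambda>s. s *\<^sub>R v", simplified])
         (auto intro!: derivative_eq_intros L[OF f])
    then have "((\<lambda>s. lg (f (ex (s *\<^sub>R v)))) has_vector_derivative L f v) (at 0)"
      by (simp add: has_vector_derivative_def linear_scale[OF lin])
    then have 1: "((\<lambda>s. (1 / norm s) *\<^sub>R (lg (f (ex (s *\<^sub>R v))) - s *\<^sub>R L f v)) \<longlongrightarrow> 0) (at 0)"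
      using f0 by (simp add: has_vector_derivative_def has_derivative_within)
    have "filterlim (\<lambda>k. inverse (real k)) (at 0) sequentially"
      unfolding filterlim_at using eventually_gt_at_top[of 0]
      by (auto intro: lim_inverse_n elim!: eventually_mono)
    from filterlim_compose[OF 1 this]
    have "(\<lambda>k. real k *\<^sub>R (lg (f (ex (v /\<^sub>R real k))) - L f v /\<^sub>R real k)) \<longlonglongrightarrow> 0"
      by (simp add: divide_inverse)
    then have "(\<lambda>k. real k *\<^sub>R (lg (f (ex (v /\<^sub>R real k))) - L f v /\<^sub>R real k) + L f v) \<longlonglongrightarrow> 0 + L f v"
      by (intro tendsto_intros)
    moreover have "\<forall>\<^sub>F k in sequentially. real k *\<^sub>R (lg (f (ex (v /\<^sub>R real k))) - L f v /\<^sub>R real k) + L f v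
        = real k *\<^sub>R lg (f (ex (v /\<^sub>R real k)))"
      using eventually_gt_at_top[of 0] by eventually_elim (simp add: scaleR_diff_right)
    ultimately show ?thesis using Lim_transform_eventually by force
  qed
  have main: "norm (lg (f (ex v)) - L f v) \<le> K * (norm v)\<^sup>2" if f: "f \<in> A" and v: "norm v < \<delta>" for f v
  proof (rule tendsto_upperbound)
    show "(\<lambda>k. norm (lg (f (ex v)) - real k *\<^sub>R lg (f (ex (v /\<^sub>R real k))))) \<longlonglongrightarrow> norm (lg (f (ex v)) - L f v)"
      using lim[OF f] by (intro tendsto_intros)
    show "\<forall>\<^sub>F k in sequentially. norm (lg (f (ex v)) - real k *\<^sub>R lg (f (ex (v /\<^sub>R real k)))) \<le> K * (norm v)\<^sup>2"
      using eventually_gt_at_top[of 0] by eventually_elim (use K(6) f v in auto)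
  qed simp
  have bnd: "norm (L f v) \<le> K * norm v" if f: "f \<in> A" for f v
  proof (rule tendsto_upperbound[OF tendsto_norm[OF lim[OF f]]])
    \<comment> \<open>The Lipschitz bound holds for short vectors only; v/k is eventually short, and
      the factor \<open>k\<close> cancels. So the bound on L f holds for every v.\<close>
    have "(\<lambda>k. norm v / real k) \<longlonglongrightarrow> 0" by (rule lim_const_over_n)
    then have "\<forall>\<^sub>F k in sequentially. norm v / real k < \<delta>" using K(2) order_tendstoD(2) by blast
    then show "\<forall>\<^sub>F k in sequentially. norm (real k *\<^sub>R lg (f (ex (v /\<^sub>R real k)))) \<le> K * norm v"
      using eventually_gt_at_top[of 0]
    proof eventually_elim
      case (elim k)
      have "norm (lg (f (ex (v /\<^sub>R real k)))) \<le> K * (norm v / k)"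
        using K(5)[OF f, of "v /\<^sub>R real k"] elim by (simp add: divide_inverse mult_ac)
      then show ?case using elim by (simp add: field_simps)
    qed
  qed simp
  show thesis by (rule that[OF K(1-3)]) (use K(4) main bnd in blast)+
qed


section \<open>Curves with prescribed logarithmic derivative\<close>

text \<open>The left logarithmic derivative of \<open>\<nu>\<close> is \<open>x\<close>, with a rate
  that is uniform in the base point \<open>s\<close>. Uniformity is what a comparison along a grid
  consumes. Only forward increments are asked for; backward ones follow in
  \<open>solves_expansion\<close>.\<close>

definition solves :: "(real \<Rightarrow> 'e) \<Rightarrow> (real \<Rightarrow> 'n) \<Rightarrow> bool" where
  "solves x \<nu> \<longleftrightarrow> \<nu> 0 = \<one> \<and> (\<forall>t\<ge>0. \<nu> t \<in> carrier N) \<and>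
     (\<forall>\<epsilon>>0. \<exists>\<delta>>0. \<forall>s t. 0 \<le> s \<and> s \<le> t \<and> t - s < \<delta> \<longrightarrow>
        inv (\<nu> s) \<otimes> \<nu> t \<in> dom \<and> norm (lg (inv (\<nu> s) \<otimes> \<nu> t) - (t - s) *\<^sub>R x s) \<le> \<epsilon> * (t - s))"

text \<open>By telescoping, \<open>\<nu> (k * h)\<close> is the product of its increments, and each
  of them is also h x(ih) up to \<epsilon> h. So the two sequences of factors differ by at most 2
  \<epsilon> h, and \<open>gronwall\<close> applies with bounds depending on \<open>n\<close> only
  through n h \<le> Tm.\<close>

lemma solves_trotter:
  assumes sol: "solves x \<nu>" and M: "\<And>t. norm (x t) \<le> M" and \<rho>: "0 < \<rho>" and Tm: "0 \<le> Tm"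
  shows "\<exists>\<epsilon>>0. \<exists>h0>0. \<forall>(h::real) (n::nat) w. 0 \<le> h \<and> h < h0 \<and> n * h \<le> Tm \<and>
     (\<forall>k<n. w k \<in> dom \<and> norm (lg (w k) - h *\<^sub>R x (k * h)) \<le> \<epsilon> * h) \<longrightarrow>
     (\<forall>k\<le>n. inv (\<nu> (k * h)) \<otimes> gprod w k \<in> D \<rho>)"
proof -
  have M0: "0 \<le> M" using M[of 0] norm_ge_zero order_trans by blast
  define B where "B = (M + 1) * Tm"
  define E where "E = exp (4 * C * B)"
  define \<rho>' where "\<rho>' = min \<rho> r0"
  have \<rho>': "0 < \<rho>'" "\<rho>' \<le> r0" "\<rho>' \<le> \<rho>" using \<rho> r0_pos by (auto simp: \<rho>'_def)
  have E: "0 < E" by (simp add: E_def)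
  \<comment> \<open>Chosen for the smallness condition
    \<open>2 * (2 * \<epsilon> * Tm) * E < \<rho>'\<close> of \<open>gronwall\<close>;
    \<open>Tm + 1\<close> covers the case \<open>Tm = 0\<close>.\<close>
  define \<epsilon> where "\<epsilon> = min 1 (\<rho>' / (8 * (Tm + 1) * E))"
  have eps: "0 < \<epsilon>" "\<epsilon> \<le> 1" using \<rho>' Tm E by (auto simp: \<epsilon>_def)
  have "\<epsilon> \<le> \<rho>' / (8 * (Tm + 1) * E)" by (simp add: \<epsilon>_def)
  then have "8 * \<epsilon> * (Tm + 1) * E \<le> \<rho>'" using Tm E by (subst (asm) pos_le_divide_eq) (auto simp: mult_ac)
  moreover have "4 * \<epsilon> * Tm * E < 8 * \<epsilon> * (Tm + 1) * E"
    using Tm E eps by (intro mult_strict_right_mono) (auto simp: algebra_simps add_pos_nonneg)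
  ultimately have epsE: "4 * \<epsilon> * Tm * E < \<rho>'" by linarith
  obtain \<delta> where \<delta>: "0 < \<delta>" "\<And>s t. 0 \<le> s \<Longrightarrow> s \<le> t \<Longrightarrow> t - s < \<delta> \<Longrightarrow>
     inv (\<nu> s) \<otimes> \<nu> t \<in> dom \<and> norm (lg (inv (\<nu> s) \<otimes> \<nu> t) - (t - s) *\<^sub>R x s) \<le> \<epsilon> * (t - s)"
    using sol eps unfolding solves_def by meson
  define h0 where "h0 = min \<delta> (r0 / (M + 1))"
  have h0: "0 < h0" using \<delta> r0_pos M0 by (simp add: h0_def)
  have "inv (\<nu> (k * h)) \<otimes> gprod w k \<in> D \<rho>"
    if h: "0 \<le> h" "h < h0" "n * h \<le> Tm" and w: "\<And>k. k < n \<Longrightarrow> w k \<in> dom"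
      "\<And>k. k < n \<Longrightarrow> norm (lg (w k) - h *\<^sub>R x (k * h)) \<le> \<epsilon> * h" and k: "k \<le> n" for h :: real and n :: nat and w and k :: nat
  proof -
    define w' where "w' i = inv (\<nu> (i * h)) \<otimes> \<nu> (Suc i * h)" for i :: nat
    have "h < \<delta>" using h by (simp add: h0_def)
    then have w': "w' i \<in> dom" "norm (lg (w' i) - h *\<^sub>R x (i * h)) \<le> \<epsilon> * h" for i
      using \<delta>(2)[of "i * h" "Suc i * h"] h unfolding w'_def by (auto simp: algebra_simps)
    have bd: "norm y \<le> (M + 1) * h" if "norm (y - h *\<^sub>R x t) \<le> \<epsilon> * h" for y t
    proof -
      have "norm y \<le> norm (h *\<^sub>R x t) + norm (y - h *\<^sub>R x t)" by (rule norm_triangle_sub)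
      also have "\<dots> \<le> h * M + 1 * h"
        using that eps h mult_left_mono[OF M h(1), of t] mult_right_mono[OF eps(2) h(1)] by (intro add_mono) auto
      finally show ?thesis by (simp add: algebra_simps)
    qed
    have "inv (gprod w' k) \<otimes> gprod w k \<in> D \<rho>'"
    proof (rule gronwall[where n = n and \<kappa> = "(M + 1) * h" and \<delta> = "2 * \<epsilon> * h" and B = B and \<epsilon> = "2 * \<epsilon> * Tm"])
      show "(M + 1) * h < r0" using h M0 by (auto simp: h0_def field_simps)
      show "n * ((M + 1) * h) \<le> B"
        using mult_left_mono[OF h(3), of "M + 1"] M0 by (simp add: B_def mult_ac)
      show "n * (2 * \<epsilon> * h) \<le> 2 * \<epsilon> * Tm"
        using mult_left_mono[OF h(3), of "2 * \<epsilon>"] eps by (simp add: mult_ac)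
      show "2 * (2 * \<epsilon> * Tm) * exp (4 * C * B) < \<rho>'" using epsE by (simp add: E_def mult_ac)
      show "norm (lg (w' i) - lg (w i)) \<le> 2 * \<epsilon> * h" if "i < n" for i
        using w'(2)[of i] w(2)[OF that] norm_triangle_ineq4[of "lg (w' i) - h *\<^sub>R x (i * h)" "lg (w i) - h *\<^sub>R x (i * h)"]
        by simp
      show "norm (lg (w' i)) \<le> (M + 1) * h" if "i < n" for i using bd[OF w'(2)] .
      show "norm (lg (w i)) \<le> (M + 1) * h" if "i < n" for i using bd[OF w(2)[OF that]] .
    qed (use w w' h M0 eps \<rho>' k in auto)
    moreover have "gprod w' k = \<nu> (k * h)"
      unfolding w'_def using sol h(1) by (intro gprod_telescope) (auto simp: solves_def)
    ultimately show ?thesis using D_mono \<rho>' by auto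
  qed
  then show ?thesis using eps h0 by blast
qed

section \<open>Limits in the group and in the chart\<close>

text \<open>Translation by \<open>inv (p J)\<close> brings the tail into the chart. There the
  bilinear bound makes differences of coordinates at most twice the size of the group increments, so
  the coordinates converge in the Banach space. The limit is \<open>p J\<close> times the point with
  the limiting coordinates.\<close>

lemma cauchy_limit:
  assumes p: "\<And>j. p j \<in> carrier N"
    and cau: "\<And>\<rho>. 0 < \<rho> \<Longrightarrow> \<exists>J::nat. \<forall>j\<ge>J. \<forall>m. inv (p j) \<otimes> p (j + m) \<in> D \<rho>"
  shows "\<exists>l\<in>carrier N. \<forall>\<rho>>0. \<forall>\<^sub>F j in sequentially. inv l \<otimes> p j \<in> D \<rho>"
proof -
  have "0 < r0 / 2" using r0_pos by simp
  then obtain J where J: "\<And>m. inv (p J) \<otimes> p (J + m) \<in> D (r0 / 2)" using cau by blast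
  define q where "q m = inv (p J) \<otimes> p (J + m)" for m
  define z where "z m = lg (q m)" for m
  have q: "q m \<in> D (r0 / 2)" "q m \<in> D R" "norm (z m) < r0 / 2" for m
  proof -
    show "q m \<in> D (r0 / 2)" using J by (simp add: q_def)
    then show "norm (z m) < r0 / 2" by (simp add: z_def D_def)
    show "q m \<in> D R" using \<open>q m \<in> D (r0 / 2)\<close> r0_le r0_pos by (auto simp: D_def)
  qed
  have step: "norm (z (j + m) - z j) \<le> 2 * norm (lg (inv (p (J + j)) \<otimes> p (J + j + m)))"
    if e: "inv (p (J + j)) \<otimes> p (J + j + m) \<in> D R" for j m
  proof -
    define e where "e = inv (p (J + j)) \<otimes> p (J + j + m)"
    have "p (J + j + m) = p (J + j) \<otimes> e" "e \<in> carrier N"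
      using p by (simp_all add: e_def m_assoc[symmetric])
    then have "q (j + m) = q j \<otimes> e"
      using p by (simp add: q_def m_assoc add.assoc)
    then have "norm (z (j + m) - z j - lg e) \<le> C * norm (z j) * norm (lg e)"
      using D_lg_mult[of "q j" e] q e by (simp add: z_def e_def)
    also have "\<dots> \<le> 1 * norm (lg e)"
    proof (rule mult_right_mono)
      have "C * norm (z j) \<le> C * r0" using q(3)[of j] C_pos r0_pos by (intro mult_left_mono) auto
      then show "C * norm (z j) \<le> 1" using r0_C by simp
    qed simp
    finally show ?thesis using norm_triangle_sub[of "z (j + m) - z j" "lg e"] by (simp add: e_def)
  qed
  have "Cauchy z"
  proof (rule CauchyI')
    fix \<epsilon> :: real assume "0 < \<epsilon>"
    then have "0 < min R (\<epsilon> / 2)" using R_pos by simp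
    then obtain J' where J': "\<And>j m. j \<ge> J' \<Longrightarrow> inv (p j) \<otimes> p (j + m) \<in> D (min R (\<epsilon> / 2))"
      using cau by metis
    show "\<exists>M. \<forall>m\<ge>M. \<forall>n>m. dist (z m) (z n) < \<epsilon>"
    proof (intro exI allI impI)
      fix m n assume mn: "m \<ge> J'" "m < n"
      then have D: "inv (p (J + m)) \<otimes> p (J + m + (n - m)) \<in> D (min R (\<epsilon> / 2))"
        by (intro J') simp
      then have "norm (z (m + (n - m)) - z m) \<le> 2 * norm (lg (inv (p (J + m)) \<otimes> p (J + m + (n - m))))"
        using D_mono by (intro step) auto
      also have "\<dots> < \<epsilon>" using D_norm[OF D] by simp
      finally show "dist (z m) (z n) < \<epsilon>" using mn by (simp add: dist_norm norm_minus_commute)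
    qed
  qed
  then obtain z' where z': "z \<longlonglongrightarrow> z'" using Cauchy_convergent convergent_def by blast
  have "norm z' \<le> r0 / 2"
    using z' q(3) by (intro tendsto_upperbound[OF tendsto_norm[OF z']]) (auto intro: always_eventually less_imp_le)
  then have nz: "norm z' < R" using r0_le r0_pos by simp
  have exz: "ex z' \<in> carrier N" using nz ex_dom dom_carrier by blast
  have "\<forall>\<^sub>F j in sequentially. inv (p J \<otimes> ex z') \<otimes> p j \<in> D \<rho>" if \<rho>: "0 < \<rho>" for \<rho>
  proof -
    have "continuous_map (top_of_set (ball 0 R)) T (\<lambda>u. (\<lambda>(x, y). x \<otimes> y) (inv (ex z'), ex u))"
      using ex_cont exz topspace
      by (intro continuous_map_compose[OF _ cont_mult, unfolded o_def] continuous_map_pairedI) auto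
    then have "openin (top_of_set (ball 0 R)) {u \<in> topspace (top_of_set (ball 0 R)). (\<lambda>(x, y). x \<otimes> y) (inv (ex z'), ex u) \<in> D \<rho>}"
      using open_D by (rule openin_continuous_map_preimage)
    then have op: "open {u \<in> ball 0 R. inv (ex z') \<otimes> ex u \<in> D \<rho>}" by (simp add: openin_open_eq)
    have "z' \<in> {u \<in> ball 0 R. inv (ex z') \<otimes> ex u \<in> D \<rho>}" using nz exz \<rho> one_D by simp
    then have "\<forall>\<^sub>F j in sequentially. z j \<in> {u \<in> ball 0 R. inv (ex z') \<otimes> ex u \<in> D \<rho>}"
      using z' op topological_tendstoD by blast
    then have "\<forall>\<^sub>F j in sequentially. inv (p J \<otimes> ex z') \<otimes> p (j + J) \<in> D \<rho>"
    proof eventually_elim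
      case (elim j)
      then have "inv (ex z') \<otimes> q j \<in> D \<rho>" using ex_lg[OF D_dom[OF q(2)]] by (simp add: z_def)
      then show ?case using p exz by (simp add: q_def inv_mult_group m_assoc add.commute)
    qed
    then show ?thesis by (subst (asm) eventually_sequentially_seg)
  qed
  then show ?thesis using p exz by (intro bexI[of _ "p J \<otimes> ex z'"]) auto
qed

lemma mult_near:
  assumes "p \<in> D r0" "q \<in> D R"
  shows "norm (lg (p \<otimes> q) - lg p) \<le> 2 * norm (lg q)" "norm (lg (q \<otimes> p) - lg p) \<le> 2 * norm (lg q)"
proof -
  have "C * norm (lg p) \<le> C * r0" using D_norm[OF assms(1)] C_pos by (intro mult_left_mono) auto
  then have C1: "C * norm (lg p) \<le> 1" using r0_C by simp
  have pR: "p \<in> D R" using assms(1) by (rule D_r0_R)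
  have "norm (lg (p \<otimes> q) - lg p - lg q) \<le> C * norm (lg p) * norm (lg q)"
    using pR assms(2) by (rule D_lg_mult)
  also have "\<dots> \<le> 1 * norm (lg q)" using C1 by (intro mult_right_mono) auto
  finally show "norm (lg (p \<otimes> q) - lg p) \<le> 2 * norm (lg q)"
    using norm_triangle_sub[of "lg (p \<otimes> q) - lg p" "lg q"] by simp
  have "norm (lg (q \<otimes> p) - lg q - lg p) \<le> C * norm (lg q) * norm (lg p)"
    using assms(2) pR by (rule D_lg_mult)
  also have "\<dots> \<le> 1 * norm (lg q)"
    using mult_right_mono[OF C1, of "norm (lg q)"] by (simp add: mult_ac)
  finally have "norm (lg (q \<otimes> p) - lg p - lg q) \<le> norm (lg q)" by (simp add: algebra_simps)
  then show "norm (lg (q \<otimes> p) - lg p) \<le> 2 * norm (lg q)"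
    using norm_triangle_sub[of "lg (q \<otimes> p) - lg p" "lg q"] by simp
qed

text \<open>For passing to the limit in the chart when \<open>g\<close> is not known to lie in it: g
  = a S b^-1 where a and b tend to the identity. The radius \<open>r0 / 2\<close> for
  \<open>S\<close> leaves room for these two small factors.\<close>

lemma limit_lg:
  assumes g: "g \<in> carrier N" and S: "\<forall>\<^sub>F j in sequentially. S j \<in> D (r0 / 2)"
    and a: "\<And>\<rho>. 0 < \<rho> \<Longrightarrow> \<forall>\<^sub>F j in sequentially. a j \<in> D \<rho>"
    and b: "\<And>\<rho>. 0 < \<rho> \<Longrightarrow> \<forall>\<^sub>F j in sequentially. b j \<in> D \<rho>"
    and eq: "\<And>j. g \<otimes> b j = a j \<otimes> S j"
  shows "g \<in> dom \<and> (\<lambda>j. lg (S j)) \<longlonglongrightarrow> lg g"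
proof -
  have close: "\<forall>\<^sub>F j in sequentially. g \<in> dom \<and> norm (lg g - lg (S j)) \<le> 4 * \<rho>" if \<rho>: "0 < \<rho>" "\<rho> \<le> r0 / 8" for \<rho>
  proof -
    obtain \<rho>' where \<rho>': "0 < \<rho>'" "\<rho>' \<le> R" "\<And>p. p \<in> D \<rho>' \<Longrightarrow> inv p \<in> D \<rho>"
      using nbhd_inv[OF open_D one_D[OF \<rho>(1)]] by blast
    show ?thesis using S a[OF \<rho>(1)] b[OF \<rho>'(1)]
    proof eventually_elim
      case (elim j)
      have R: "\<rho> \<le> R" using \<rho> r0_le r0_pos by simp
      have ib: "inv (b j) \<in> D \<rho>" using elim \<rho>' by blast
      have car: "b j \<in> carrier N" "a j \<in> carrier N" "S j \<in> carrier N" using elim D_carrier by auto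
      define y where "y = a j \<otimes> S j"
      have y1: "norm (lg y - lg (S j)) \<le> 2 * norm (lg (a j))" unfolding y_def
        using elim r0_pos R D_mono by (intro mult_near(2)) auto
      have "y \<in> dom" unfolding y_def using elim r0_pos r0_le R by (intro D_mult_dom) (auto simp: D_def)
      have "norm (lg y) \<le> norm (lg (S j)) + norm (lg y - lg (S j))" by (rule norm_triangle_sub)
      also have "\<dots> < r0" using y1 elim(1,2)[THEN D_norm] \<rho> by linarith
      finally have y: "y \<in> D r0" using \<open>y \<in> dom\<close> by (simp add: D_def)
      have gy: "g = y \<otimes> inv (b j)" using eq[of j] g car by (simp add: y_def inv_solve_right)
      have "norm (lg g - lg y) \<le> 2 * norm (lg (inv (b j)))" unfolding gy
        using y ib R D_mono by (intro mult_near(1)) auto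
      then have "norm (lg g - lg (S j)) \<le> 2 * norm (lg (inv (b j))) + 2 * norm (lg (a j))"
        using y1 norm_triangle_ineq[of "lg g - lg y" "lg y - lg (S j)"] by simp
      moreover have "g \<in> dom" unfolding gy using y ib R D_r0_R D_mono by (intro D_mult_dom) auto
      ultimately show ?case using D_norm[OF ib] D_norm[OF elim(2)] by simp
    qed
  qed
  have "g \<in> dom" using close[of "r0 / 8"] r0_pos eventually_happens'[OF sequentially_bot] by fastforce
  moreover have "(\<lambda>j. lg (S j)) \<longlonglongrightarrow> lg g"
  proof (rule tendstoI)
    fix e :: real assume e: "0 < e"
    define \<rho> where "\<rho> = min (e / 8) (r0 / 8)"
    have \<rho>: "0 < \<rho>" "\<rho> \<le> r0 / 8" "8 * \<rho> \<le> e" using e r0_pos by (auto simp: \<rho>_def)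
    show "\<forall>\<^sub>F j in sequentially. dist (lg (S j)) (lg g) < e"
      using close[OF \<rho>(1,2)] by eventually_elim (use \<rho> in \<open>auto simp: dist_norm norm_minus_commute\<close>)
  qed
  ultimately show ?thesis by blast
qed

end

section \<open>Dyadic Euler products\<close>

lemma riemann_sum_near:
  fixes y :: "nat \<Rightarrow> 'e::real_normed_vector"
  assumes "\<And>i. i < n \<Longrightarrow> norm (y i - z) \<le> \<eta>" "0 \<le> h"
  shows "norm ((\<Sum>i<n. h *\<^sub>R y i) - (real n * h) *\<^sub>R z) \<le> real n * h * \<eta>"
proof -
  have "(\<Sum>i<n. h *\<^sub>R y i) - (real n * h) *\<^sub>R z = (\<Sum>i<n. h *\<^sub>R (y i - z))"
    by (simp add: scaleR_diff_right sum_subtractf sum_constant_scaleR)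
  also have "norm \<dots> \<le> (\<Sum>i<n. h * \<eta>)"
    using assms by (intro sum_norm_le) (auto intro: mult_left_mono)
  finally show ?thesis by simp
qed

context chart_group
begin

context
  fixes x :: "real \<Rightarrow> 'e" and M :: real and J0 :: nat
  assumes M: "\<And>t. norm (x t) \<le> M" and M_pos: "0 < M"
    and uc: "uniformly_continuous_on UNIV x"
    and J0: "M * (1 / 2 ^ J0) < r0 / 8"
begin

text \<open>Halving makes the grids nested. The offset \<open>J0\<close> keeps every single
  increment below \<open>r0 / 8\<close> from the first grid on.\<close>

definition step :: "nat \<Rightarrow> real" where "step j = 1 / 2 ^ (J0 + j)"

definition increment :: "nat \<Rightarrow> nat \<Rightarrow> 'n" where "increment j i = ex (step j *\<^sub>R x (real i * step j))"

definition euler :: "nat \<Rightarrow> real \<Rightarrow> 'n" where "euler j t = gprod (increment j) (nat \<lfloor>t / step j\<rfloor>)"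

lemma step_pos: "0 < step j"
  by (simp add: step_def)

lemma step_add: "2 ^ m * step (j + m) = step j"
  by (simp add: step_def power_add)

lemma step_bound: "M * step j < r0 / 8"
proof -
  have "M * step j \<le> M * (1 / 2 ^ J0)"
    using M_pos by (intro mult_left_mono) (auto simp: step_def field_simps power_add)
  then show ?thesis using J0 by linarith
qed

lemma step_small: "0 < \<delta> \<Longrightarrow> \<forall>\<^sub>F j in sequentially. step j < \<delta>"
proof -
  assume "0 < \<delta>"
  have "(\<lambda>j. (1 / 2) ^ j * (1 / 2) ^ J0 :: real) \<longlonglongrightarrow> 0 * (1 / 2) ^ J0"
    by (intro tendsto_intros LIMSEQ_power_zero) auto
  moreover have "step = (\<lambda>j. (1 / 2) ^ j * (1 / 2) ^ J0)"
    by (auto simp: step_def power_add power_divide)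
  ultimately have "step \<longlonglongrightarrow> 0" by simp
  then show ?thesis using \<open>0 < \<delta>\<close> order_tendstoD(2) by blast
qed

lemma increment: "increment j i \<in> dom" "lg (increment j i) = step j *\<^sub>R x (real i * step j)"
  "norm (lg (increment j i)) \<le> M * step j" "increment j i \<in> carrier N"
proof -
  have le: "norm (step j *\<^sub>R x (real i * step j)) \<le> M * step j"
    using M[of "real i * step j"] step_pos[of j] by simp
  then have "norm (step j *\<^sub>R x (real i * step j)) < R" using step_bound[of j] r0_le r0_pos by linarith
  then show "increment j i \<in> dom" "lg (increment j i) = step j *\<^sub>R x (real i * step j)"
    unfolding increment_def by (fact ex_dom, fact lg_ex)
  then show "increment j i \<in> carrier N" "norm (lg (increment j i)) \<le> M * step j" using dom_carrier le by auto
qed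

lemma segment:
  assumes "real n * (M * step j) \<le> \<sigma>" "\<sigma> \<le> r0 / 8"
  shows "gprod (\<lambda>i. increment j (a + i)) n \<in> dom \<and> norm (lg (gprod (\<lambda>i. increment j (a + i)) n)) \<le> 2 * \<sigma> \<and>
     norm (lg (gprod (\<lambda>i. increment j (a + i)) n) - (\<Sum>i<n. step j *\<^sub>R x (real (a + i) * step j))) \<le> 2 * C * \<sigma>\<^sup>2"
proof -
  have "2 * C * \<sigma> \<le> 2 * C * (r0 / 8)" using assms C_pos by (intro mult_left_mono) auto
  then have "2 * C * \<sigma> \<le> 1" using r0_C by simp
  moreover have "2 * \<sigma> < R" using assms r0_le r0_pos by simp
  ultimately show ?thesis
    using gprod_est[of n "\<lambda>i. increment j (a + i)" "M * step j" \<sigma>] increment(1,3) assms(1)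
    unfolding increment(2) by blast
qed

lemma modulus:
  assumes "0 < \<eta>"
  obtains \<delta> where "0 < \<delta>" "\<And>s t. \<bar>s - t\<bar> < \<delta> \<Longrightarrow> norm (x s - x t) \<le> \<eta>"
  using uc assms unfolding uniformly_continuous_on_def dist_norm
  by (metis UNIV_I less_imp_le real_norm_def)

text \<open>The fine product is regrouped into one block \<open>w' i\<close> for each coarse step.
  By \<open>segment\<close> a block is a Riemann sum up to a quadratic error, and by uniform
  continuity of \<open>x\<close> the Riemann sum is close to the coarse increment. The factors
  differ by 2 e step(j) whatever \<open>m\<close> is, so \<open>gronwall\<close> gives a bound
  uniform in \<open>m\<close> and \<open>k\<close>.\<close>

lemma refine:
  assumes \<rho>: "0 < \<rho>" and Tm: "0 \<le> Tm"
  shows "\<forall>\<^sub>F j in sequentially. \<forall>m k. real k * step j \<le> Tm \<longrightarrow>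
     inv (gprod (increment j) k) \<otimes> gprod (increment (j + m)) (2 ^ m * k) \<in> D \<rho>"
proof -
  define B where "B = 2 * M * Tm"
  define E where "E = exp (4 * C * B)"
  define \<rho>' where "\<rho>' = min \<rho> r0"
  have \<rho>': "0 < \<rho>'" "\<rho>' \<le> r0" "\<rho>' \<le> \<rho>" using \<rho> r0_pos by (auto simp: \<rho>'_def)
  have E: "0 < E" by (simp add: E_def)
  define e where "e = \<rho>' / (8 * (Tm + 1) * E)"
  have e: "0 < e" using \<rho>' Tm E by (simp add: e_def)
  have "e * (8 * (Tm + 1) * E) = \<rho>'" using Tm E by (simp add: e_def)
  moreover have "4 * e * Tm * E < e * (8 * (Tm + 1) * E)"
    using Tm E e by (simp add: algebra_simps add_pos_nonneg)
  ultimately have eE: "4 * e * Tm * E < \<rho>'" by linarith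
  obtain \<delta> where \<delta>: "0 < \<delta>" "\<And>s t. \<bar>s - t\<bar> < \<delta> \<Longrightarrow> norm (x s - x t) \<le> e"
    using modulus[OF e] by blast
  \<comment> \<open>Below this step size the quadratic error
    \<open>2 * C * (M * step j)\<^sup>2\<close> of a block is at most
    \<open>e * step j\<close>.\<close>
  have "0 < e / (2 * C * M\<^sup>2)" using e C_pos M_pos by simp
  from step_small[OF this] step_small[OF \<delta>(1)] show ?thesis
  proof eventually_elim
    case (elim j)
    show ?case
    proof (intro allI impI)
      fix m k assume k: "real k * step j \<le> Tm"
      define w' where "w' i = gprod (\<lambda>l. increment (j + m) (2 ^ m * i + l)) (2 ^ m)" for i
      have seg: "real (2 ^ m) * (M * step (j + m)) \<le> M * step j" "M * step j \<le> r0 / 8"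
        using step_add[of m j] step_bound[of j] by (auto simp: mult_ac)
      have hCM: "2 * C * (M * step j)\<^sup>2 \<le> e * step j"
      proof -
        have "2 * C * M\<^sup>2 * step j \<le> e" using elim(1) C_pos M_pos by (simp add: field_simps)
        from mult_right_mono[OF this less_imp_le[OF step_pos[of j]]]
        show ?thesis by (simp add: power2_eq_square mult_ac)
      qed
      have w': "w' i \<in> dom" "norm (lg (w' i)) \<le> 2 * M * step j"
        "norm (lg (increment j i) - lg (w' i)) \<le> 2 * e * step j" for i
      proof -
        note s = segment[OF seg, of "2 ^ m * i"]
        show "w' i \<in> dom" "norm (lg (w' i)) \<le> 2 * M * step j" using s by (auto simp: w'_def)
        have "norm (x (real (2 ^ m * i + l) * step (j + m)) - x (real i * step j)) \<le> e" if "l < 2 ^ m" for l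
        proof (rule \<delta>)
          have "real (2 ^ m * i + l) * step (j + m) - real i * step j = real l * step (j + m)"
            using step_add[of m j, symmetric] by (simp add: algebra_simps)
          moreover have "real l * step (j + m) \<le> 2 ^ m * step (j + m)"
          proof (rule mult_right_mono)
            show "real l \<le> 2 ^ m" using that by (metis less_imp_le of_nat_le_iff of_nat_numeral of_nat_power)
          qed (use step_pos less_imp_le in auto)
          moreover have "0 \<le> real l * step (j + m)" using step_pos[of "j + m"] by simp
          ultimately show "\<bar>real (2 ^ m * i + l) * step (j + m) - real i * step j\<bar> < \<delta>"
            using step_add[of m j] elim(2) by simp
        qed
        from riemann_sum_near[OF this, of "2 ^ m" "\<lambda>l. l" "step (j + m)"] step_pos[of "j + m"]
        have "norm ((\<Sum>l<2 ^ m. step (j + m) *\<^sub>R x (real (2 ^ m * i + l) * step (j + m))) - step j *\<^sub>R x (real i * step j))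
          \<le> step j * e" by (simp add: step_add)
        moreover have "norm (lg (w' i) - (\<Sum>l<2 ^ m. step (j + m) *\<^sub>R x (real (2 ^ m * i + l) * step (j + m)))) \<le> e * step j"
          using s hCM unfolding w'_def by linarith
        ultimately have "norm (lg (w' i) - step j *\<^sub>R x (real i * step j)) \<le> e * step j + step j * e"
          using norm_triangle_ineq by (smt (verit) diff_add_cancel add_diff_eq)
        then show "norm (lg (increment j i) - lg (w' i)) \<le> 2 * e * step j"
          by (simp add: increment(2) norm_minus_commute mult_ac)
      qed
      have "inv (gprod (increment j) k) \<otimes> gprod w' k \<in> D \<rho>'"
      proof (rule gronwall[where n = k and \<kappa> = "2 * M * step j" and \<delta> = "2 * e * step j" and B = B and \<epsilon> = "2 * e * Tm"])
        show "2 * M * step j < r0" using step_bound[of j] r0_pos by simp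
        show "real k * (2 * M * step j) \<le> B"
          using mult_left_mono[OF k, of "2 * M"] M_pos by (simp add: B_def mult_ac)
        show "real k * (2 * e * step j) \<le> 2 * e * Tm"
          using mult_left_mono[OF k, of "2 * e"] e by (simp add: mult_ac)
        show "2 * (2 * e * Tm) * exp (4 * C * B) < \<rho>'" using eE by (simp add: E_def mult_ac)
        show "norm (lg (increment j i)) \<le> 2 * M * step j" if "i < k" for i
          using increment(3)[of j i] mult_pos_pos[OF M_pos step_pos[of j]] by linarith
      qed (use w' increment(1) \<rho>' e M_pos step_pos[of j] in auto)
      moreover have "gprod w' k = gprod (increment (j + m)) (2 ^ m * k)"
        unfolding w'_def using increment by (intro gprod_blocks) auto
      ultimately show "inv (gprod (increment j) k) \<otimes> gprod (increment (j + m)) (2 ^ m * k) \<in> D \<rho>"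
        using D_mono \<rho>' by auto
    qed
  qed
qed

lemma floor_step:
  assumes "0 \<le> t"
  shows "real (nat \<lfloor>t / step j\<rfloor>) * step j \<le> t" "t < real (nat \<lfloor>t / step j\<rfloor>) * step j + step j"
proof -
  have "0 \<le> t / step j" using assms step_pos[of j] by simp
  then have "real (nat \<lfloor>t / step j\<rfloor>) = of_int \<lfloor>t / step j\<rfloor>" by simp
  then have 1: "real (nat \<lfloor>t / step j\<rfloor>) \<le> t / step j" "t / step j < real (nat \<lfloor>t / step j\<rfloor>) + 1" by linarith+
  then show "real (nat \<lfloor>t / step j\<rfloor>) * step j \<le> t" using step_pos[of j] by (simp add: field_simps)
  have "t < (real (nat \<lfloor>t / step j\<rfloor>) + 1) * step j" using 1(2) step_pos[of j] by (simp add: pos_divide_less_eq)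
  then show "t < real (nat \<lfloor>t / step j\<rfloor>) * step j + step j" by (simp add: algebra_simps)
qed

lemma euler_carrier: "euler j t \<in> carrier N"
  unfolding euler_def using increment by (intro gprod_closed) auto

text \<open>The last grid point before \<open>t\<close> may move when the grid is refined. The
  surplus factors of the finer product cover at most one coarse step, so they form a small right
  factor; the rest is \<open>refine\<close>.\<close>

lemma euler_cauchy:
  assumes \<rho>: "0 < \<rho>" and t: "0 \<le> t"
  shows "\<exists>J. \<forall>j\<ge>J. \<forall>m. inv (euler j t) \<otimes> euler (j + m) t \<in> D \<rho>"
proof -
  obtain \<rho>1 where \<rho>1: "0 < \<rho>1" "\<rho>1 \<le> R" "\<And>p q. p \<in> D \<rho>1 \<Longrightarrow> q \<in> D \<rho>1 \<Longrightarrow> p \<otimes> q \<in> D \<rho>"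
    using nbhd_mult[OF open_D one_D[OF \<rho>]] by blast
  have "0 < \<rho>1 / (2 * M)" using \<rho>1 M_pos by simp
  from refine[OF \<rho>1(1) t] step_small[OF this]
  have "\<forall>\<^sub>F j in sequentially. \<forall>m. inv (euler j t) \<otimes> euler (j + m) t \<in> D \<rho>"
  proof eventually_elim
    case (elim j)
    show ?case
    proof
      fix m
      define k where "k = nat \<lfloor>t / step j\<rfloor>"
      define n where "n = nat \<lfloor>t / step (j + m)\<rfloor>"
      have k: "real k * step j \<le> t" "t < real k * step j + step j"
        using floor_step[OF t] by (auto simp: k_def)
      have n: "real n * step (j + m) \<le> t" using floor_step[OF t] by (auto simp: n_def)
      have "2 ^ m * real k * step (j + m) \<le> t" using k(1) step_add[of m j] by (simp add: mult_ac)
      then have "real (2 ^ m * k) \<le> t / step (j + m)" using step_pos[of "j + m"] by (simp add: field_simps)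
      then have "2 ^ m * k \<le> n" unfolding n_def by (simp add: le_nat_floor)
      define l where "l = n - 2 ^ m * k"
      have nl: "n = 2 ^ m * k + l" using \<open>2 ^ m * k \<le> n\<close> by (simp add: l_def)
      have "real n * step (j + m) = real k * step j + real l * step (j + m)"
        unfolding nl using step_add[of m j, symmetric] by (simp add: algebra_simps)
      then have "real l * step (j + m) \<le> step j" using k n by linarith
      then have "real l * (M * step (j + m)) \<le> M * step j" using M_pos by simp
      from segment[OF this, of "2 ^ m * k"] step_bound[of j]
      have 1: "gprod (\<lambda>i. increment (j + m) (2 ^ m * k + i)) l \<in> dom"
        "norm (lg (gprod (\<lambda>i. increment (j + m) (2 ^ m * k + i)) l)) \<le> 2 * (M * step j)" by auto
      have "2 * (M * step j) < \<rho>1" using elim(2) M_pos by (simp add: field_simps)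
      then have "gprod (\<lambda>i. increment (j + m) (2 ^ m * k + i)) l \<in> D \<rho>1" using 1 by (simp add: D_def)
      moreover have "inv (gprod (increment j) k) \<otimes> gprod (increment (j + m)) (2 ^ m * k) \<in> D \<rho>1"
        using elim(1) k by blast
      ultimately have "inv (gprod (increment j) k) \<otimes> gprod (increment (j + m)) (2 ^ m * k) \<otimes>
          gprod (\<lambda>i. increment (j + m) (2 ^ m * k + i)) l \<in> D \<rho>" using \<rho>1 by blast
      moreover have "gprod (increment (j + m)) n = gprod (increment (j + m)) (2 ^ m * k) \<otimes>
          gprod (\<lambda>i. increment (j + m) (2 ^ m * k + i)) l"
        unfolding nl using increment by (intro gprod_add) auto
      ultimately show "inv (euler j t) \<otimes> euler (j + m) t \<in> D \<rho>"
        using increment by (simp add: euler_def k_def[symmetric] n_def[symmetric] m_assoc gprod_closed)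
    qed
  qed
  then show ?thesis by (simp add: eventually_sequentially)
qed

text \<open>Take the limit of the Euler products at each time. For s \<le> t the increment
  \<open>g\<close> is the limit of the products \<open>S j\<close> over the grid steps between s and
  t. These are estimated by \<open>segment\<close> and a Riemann sum, and \<open>limit_lg\<close>
  transfers the estimate to \<open>g\<close>.\<close>

lemma product_integral_bounded: "\<exists>\<nu>. solves x \<nu>"
proof -
  have "\<forall>t. \<exists>l. 0 \<le> t \<longrightarrow> l \<in> carrier N \<and> (\<forall>\<rho>>0. \<forall>\<^sub>F j in sequentially. inv l \<otimes> euler j t \<in> D \<rho>)"
    using cauchy_limit[of "\<lambda>j. euler j t" for t] euler_carrier euler_cauchy by metis
  then obtain \<nu> where \<nu>: "\<And>t. 0 \<le> t \<Longrightarrow> \<nu> t \<in> carrier N"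
    "\<And>t \<rho>. 0 \<le> t \<Longrightarrow> 0 < \<rho> \<Longrightarrow> \<forall>\<^sub>F j in sequentially. inv (\<nu> t) \<otimes> euler j t \<in> D \<rho>"
    by metis
  have "\<nu> 0 = \<one>"
  proof -
    \<comment> \<open>The limit is known only through the neighbourhoods \<open>D \<rho>\<close>. As
      \<open>euler j 0\<close> is the identity, \<open>inv (\<nu> 0)\<close> lies in all of them, so
      its coordinate is 0.\<close>
    have D: "inv (\<nu> 0) \<in> D \<rho>" if "0 < \<rho>" for \<rho>
      using eventually_happens'[OF sequentially_bot \<nu>(2)[OF order_refl that]] \<nu>(1)
      by (auto simp: euler_def)
    then have "norm (lg (inv (\<nu> 0))) \<le> 0" using D_norm by (meson field_le_epsilon less_imp_le add_0 dense_ge)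
    then have "inv (\<nu> 0) = \<one>" using ex_lg[OF D_dom[OF D[OF r0_pos]]] ex_0 by simp
    then show ?thesis using \<nu>(1)[of 0] by (metis inv_inv inv_one order_refl)
  qed
  moreover have "\<exists>\<delta>>0. \<forall>s t. 0 \<le> s \<and> s \<le> t \<and> t - s < \<delta> \<longrightarrow>
        inv (\<nu> s) \<otimes> \<nu> t \<in> dom \<and> norm (lg (inv (\<nu> s) \<otimes> \<nu> t) - (t - s) *\<^sub>R x s) \<le> \<epsilon> * (t - s)"
    if \<epsilon>: "0 < \<epsilon>" for \<epsilon>
  proof -
    have "0 < \<epsilon> / 2" using \<epsilon> by simp
    then obtain \<delta>1 where \<delta>1: "0 < \<delta>1" "\<And>s t. \<bar>s - t\<bar> < \<delta>1 \<Longrightarrow> norm (x s - x t) \<le> \<epsilon> / 2"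
      using modulus by blast
    \<comment> \<open>The first bound controls the oscillation of \<open>x\<close>, the second makes
      the quadratic error at most (\<epsilon>/2)(t - s), and the third keeps \<open>S j\<close>
      within reach of \<open>segment\<close>.\<close>
    define \<delta> where "\<delta> = Min {\<delta>1, \<epsilon> / (4 * C * M\<^sup>2), r0 / (16 * M)}"
    have \<delta>: "0 < \<delta>" "\<delta> \<le> \<delta>1" "\<delta> \<le> \<epsilon> / (4 * C * M\<^sup>2)" "\<delta> \<le> r0 / (16 * M)"
      using \<delta>1 \<epsilon> C_pos M_pos r0_pos by (auto simp: \<delta>_def)
    have "inv (\<nu> s) \<otimes> \<nu> t \<in> dom \<and> norm (lg (inv (\<nu> s) \<otimes> \<nu> t) - (t - s) *\<^sub>R x s) \<le> \<epsilon> * (t - s)"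
      if s: "0 \<le> s" and st: "s \<le> t" and d: "t - s < \<delta>" for s t
    proof -
      define g where "g = inv (\<nu> s) \<otimes> \<nu> t"
      define a where "a j = nat \<lfloor>s / step j\<rfloor>" for j
      define n where "n j = nat \<lfloor>t / step j\<rfloor> - a j" for j
      define c where "c j = real (n j) * step j" for j
      define S where "S j = gprod (\<lambda>i. increment j (a j + i)) (n j)" for j
      have t: "0 \<le> t" using s st by simp
      have gc: "g \<in> carrier N" using \<nu> s t by (simp add: g_def)
      have an: "nat \<lfloor>t / step j\<rfloor> = a j + n j" for j
      proof -
        have "a j \<le> nat \<lfloor>t / step j\<rfloor>" unfolding a_def
          using st step_pos[of j] by (intro nat_mono floor_mono divide_right_mono) auto
        then show ?thesis by (simp add: n_def)
      qed
      have aj: "real (a j) * step j \<le> s" "s < real (a j) * step j + step j" for j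
        using floor_step[OF s] by (auto simp: a_def)
      have tj: "real (a j) * step j + c j \<le> t" "t < real (a j) * step j + c j + step j" for j
        using floor_step[OF t, of j] unfolding an by (auto simp: c_def algebra_simps)
      have cd: "\<bar>c j - (t - s)\<bar> \<le> step j" for j using aj[of j] tj[of j] by auto
      have clim: "c \<longlonglongrightarrow> t - s"
      proof (rule tendstoI)
        fix e :: real assume "0 < e"
        from step_small[OF this] show "\<forall>\<^sub>F j in sequentially. dist (c j) (t - s) < e"
          by eventually_elim (use cd in \<open>auto simp: dist_real_def intro: le_less_trans\<close>)
      qed
      have c0: "0 \<le> c j" for j using step_pos[of j] by (simp add: c_def)
      have "0 < r0 / (16 * M)" using r0_pos M_pos by simp
      from step_small[OF this] have Sev: "\<forall>\<^sub>F j in sequentially. S j \<in> D (r0 / 2) \<and>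
          norm (lg (S j) - (\<Sum>i<n j. step j *\<^sub>R x (real (a j + i) * step j))) \<le> 2 * C * (M * c j)\<^sup>2"
      proof eventually_elim
        case (elim j)
        have "c j < r0 / (16 * M) + r0 / (16 * M)" using cd[of j] d \<delta>(4) elim by linarith
        then have "M * c j < r0 / 8" using M_pos by (simp add: field_simps)
        moreover have "real (n j) * (M * step j) \<le> M * c j" by (simp add: c_def)
        ultimately show ?case using segment[of "n j" j "M * c j" "a j"] r0_pos by (auto simp: S_def D_def)
      qed
      have eq: "g \<otimes> (inv (\<nu> t) \<otimes> euler j t) = (inv (\<nu> s) \<otimes> euler j s) \<otimes> S j" for j
      proof -
        have "euler j t = euler j s \<otimes> S j"
          unfolding euler_def S_def an a_def[symmetric] using increment by (intro gprod_add) auto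
        moreover have "S j \<in> carrier N" unfolding S_def using increment by (intro gprod_closed) auto
        moreover have "\<nu> t \<otimes> (inv (\<nu> t) \<otimes> euler j t) = euler j t"
          using \<nu>(1)[OF t] euler_carrier by (simp add: m_assoc[symmetric])
        ultimately show ?thesis
          using \<nu>(1)[OF s] \<nu>(1)[OF t] euler_carrier by (simp add: g_def m_assoc)
      qed
      have lim: "g \<in> dom" "(\<lambda>j. lg (S j)) \<longlonglongrightarrow> lg g"
        using limit_lg[OF gc eventually_mono[OF Sev conjunct1] \<nu>(2)[OF s] \<nu>(2)[OF t] eq] by auto
      \<comment> \<open>Everything is moved to the left because the error terms depend on
        \<open>j\<close> too, through the grid length \<open>c j\<close>, which tends to t -
        s.\<close>
      have "norm (lg g - (t - s) *\<^sub>R x s) - 2 * C * (M * (t - s))\<^sup>2 - (t - s) * (\<epsilon> / 2) \<le> 0"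
      proof (rule tendsto_upperbound)
        show "(\<lambda>j. norm (lg (S j) - c j *\<^sub>R x s) - 2 * C * (M * c j)\<^sup>2 - c j * (\<epsilon> / 2)) \<longlonglongrightarrow>
          norm (lg g - (t - s) *\<^sub>R x s) - 2 * C * (M * (t - s))\<^sup>2 - (t - s) * (\<epsilon> / 2)"
          by (intro tendsto_intros lim clim)
        show "\<forall>\<^sub>F j in sequentially. norm (lg (S j) - c j *\<^sub>R x s) - 2 * C * (M * c j)\<^sup>2 - c j * (\<epsilon> / 2) \<le> 0"
          using Sev step_small[OF \<delta>1(1)]
        proof eventually_elim
          case (elim j)
          have "norm (x (real (a j + i) * step j) - x s) \<le> \<epsilon> / 2" if i: "i < n j" for i
          proof (rule \<delta>1)
            have "real (a j + i) * step j = real (a j) * step j + real i * step j" by (simp add: algebra_simps)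
            moreover have "real i * step j \<le> c j" unfolding c_def
              using i step_pos[of j] by (intro mult_right_mono) auto
            moreover have "0 \<le> real i * step j" using step_pos[of j] by simp
            ultimately show "\<bar>real (a j + i) * step j - s\<bar> < \<delta>1"
              using aj[of j] tj[of j] elim(2) d \<delta>(2) unfolding abs_less_iff by linarith
          qed
          from riemann_sum_near[OF this, of "n j" "\<lambda>i. i" "step j"] step_pos[of j]
          have "norm ((\<Sum>i<n j. step j *\<^sub>R x (real (a j + i) * step j)) - c j *\<^sub>R x s) \<le> c j * (\<epsilon> / 2)"
            by (simp add: c_def)
          then have "norm (lg (S j) - c j *\<^sub>R x s) \<le> 2 * C * (M * c j)\<^sup>2 + c j * (\<epsilon> / 2)"
            using elim(1) norm_triangle_ineq[of "lg (S j) - (\<Sum>i<n j. step j *\<^sub>R x (real (a j + i) * step j))"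
               "(\<Sum>i<n j. step j *\<^sub>R x (real (a j + i) * step j)) - c j *\<^sub>R x s"] by simp
          then show ?case by simp
        qed
      qed simp
      moreover have "2 * C * (M * (t - s))\<^sup>2 \<le> (\<epsilon> / 2) * (t - s)"
      proof -
        have "t - s \<le> \<epsilon> / (4 * C * M\<^sup>2)" using d \<delta>(3) by simp
        then have "2 * C * M\<^sup>2 * (t - s) \<le> \<epsilon> / 2" using C_pos M_pos by (simp add: field_simps)
        from mult_right_mono[OF this, of "t - s"] st show ?thesis
          by (simp add: power2_eq_square mult_ac)
      qed
      moreover have "(\<epsilon> / 2) * (t - s) + (t - s) * (\<epsilon> / 2) = \<epsilon> * (t - s)" by (simp add: algebra_simps)
      ultimately have "norm (lg g - (t - s) *\<^sub>R x s) \<le> \<epsilon> * (t - s)" by linarith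
      then show ?thesis using lim by (simp add: g_def)
    qed
    then show ?thesis using \<delta>(1) by blast
  qed
  ultimately show ?thesis using \<nu>(1) unfolding solves_def by blast
qed

end

lemma product_integral:
  fixes x :: "real \<Rightarrow> 'e"
  assumes M: "\<And>t. norm (x t) \<le> M" and uc: "uniformly_continuous_on UNIV x"
  obtains \<nu> where "solves x \<nu>"
proof -
  define M' where "M' = max M 1"
  have M': "\<And>t. norm (x t) \<le> M'" "0 < M'" using M by (auto simp: M'_def le_max_iff_disj)
  have "0 < r0 / 8 / M'" using M' r0_pos by simp
  then obtain J0 where "(1 / 2) ^ J0 < r0 / 8 / M'" using real_arch_pow_inv[of "r0 / 8 / M'" "1 / 2"] by auto
  then have "M' * (1 / 2 ^ J0) < r0 / 8" using M' by (simp add: field_simps power_divide)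
  from product_integral_bounded[OF M' uc this] show thesis using that by blast
qed


section \<open>Continuity and differentiability of solutions\<close>

lemma continuous_left: "g \<in> carrier N \<Longrightarrow> continuous_map T T (\<lambda>p. g \<otimes> p)"
proof -
  assume "g \<in> carrier N"
  then have "continuous_map T T (\<lambda>p. (\<lambda>(x, y). x \<otimes> y) (g, p))"
    using topspace by (intro continuous_map_compose[OF _ cont_mult, unfolded o_def] continuous_map_pairedI) auto
  then show ?thesis by simp
qed

lemma continuous_map_nbhd:
  fixes \<nu> :: "'x::t2_space \<Rightarrow> 'n"
  assumes "continuous_map (top_of_set I) T \<nu>" "t \<in> I" "0 < \<rho>"
  shows "\<forall>\<^sub>F s in at t within I. inv (\<nu> t) \<otimes> \<nu> s \<in> D \<rho>"
proof -
  have c: "\<nu> t \<in> carrier N"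
    using assms topspace continuous_map_image_subset_topspace by fastforce
  have "continuous_map (top_of_set I) T (\<lambda>s. inv (\<nu> t) \<otimes> \<nu> s)"
    using continuous_map_compose[OF assms(1) continuous_left[of "inv (\<nu> t)"]] c by (simp add: o_def)
  then have "openin (top_of_set I) {s \<in> topspace (top_of_set I). inv (\<nu> t) \<otimes> \<nu> s \<in> D \<rho>}"
    using open_D by (rule openin_continuous_map_preimage)
  then obtain V where V: "open V" "{s \<in> I. inv (\<nu> t) \<otimes> \<nu> s \<in> D \<rho>} = I \<inter> V"
    by (auto simp: openin_open)
  have "t \<in> V" using V(2) assms(2,3) c one_D by auto
  then show ?thesis unfolding eventually_at_topological using V by blast
qed

lemma continuous_map_of_nbhd:
  fixes \<nu> :: "'x::t2_space \<Rightarrow> 'n"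
  assumes "\<And>t. t \<in> I \<Longrightarrow> \<nu> t \<in> carrier N"
    and "\<And>t \<rho>. t \<in> I \<Longrightarrow> 0 < \<rho> \<Longrightarrow> \<forall>\<^sub>F s in at t within I. inv (\<nu> t) \<otimes> \<nu> s \<in> D \<rho>"
  shows "continuous_map (top_of_set I) T \<nu>"
proof -
  have "openin (top_of_set I) {s \<in> I. \<nu> s \<in> W}" if W: "openin T W" for W
  proof (subst openin_subopen, intro ballI)
    fix t assume t: "t \<in> {s \<in> I. \<nu> s \<in> W}"
    have c: "\<nu> t \<in> carrier N" using t assms by blast
    have "openin T {p \<in> topspace T. \<nu> t \<otimes> p \<in> W}"
      using continuous_left[OF c] W by (rule openin_continuous_map_preimage)
    moreover have "\<one> \<in> {p \<in> topspace T. \<nu> t \<otimes> p \<in> W}" using t c topspace by simp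
    ultimately obtain \<rho> where \<rho>: "0 < \<rho>" "D \<rho> \<subseteq> {p \<in> topspace T. \<nu> t \<otimes> p \<in> W}"
      using nbhd_D by metis
    have "\<forall>\<^sub>F s in at t within I. inv (\<nu> t) \<otimes> \<nu> s \<in> D \<rho>" using assms(2) t \<rho>(1) by blast
    then obtain V where V: "open V" "t \<in> V" "\<And>s. s \<in> V \<Longrightarrow> s \<noteq> t \<Longrightarrow> s \<in> I \<Longrightarrow> inv (\<nu> t) \<otimes> \<nu> s \<in> D \<rho>"
      unfolding eventually_at_topological by blast
    have "I \<inter> V \<subseteq> {s \<in> I. \<nu> s \<in> W}"
    proof
      fix s assume s: "s \<in> I \<inter> V"
      show "s \<in> {s \<in> I. \<nu> s \<in> W}"
      proof (cases "s = t")
        case False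
        then have "\<nu> t \<otimes> (inv (\<nu> t) \<otimes> \<nu> s) \<in> W" using V(3)[of s] s \<rho>(2) by blast
        then show ?thesis using s c assms(1) by (simp add: m_assoc[symmetric])
      qed (use t in auto)
    qed
    moreover have "openin (top_of_set I) (I \<inter> V)" using V(1) by (rule openin_open_Int)
    ultimately show "\<exists>S. openin (top_of_set I) S \<and> t \<in> S \<and> S \<subseteq> {s \<in> I. \<nu> s \<in> W}"
      using t V(2) by blast
  qed
  moreover have "\<nu> \<in> I \<rightarrow> topspace T" using assms(1) topspace by auto
  ultimately show ?thesis by (simp add: continuous_map_def)
qed

text \<open>For s < t the increment from t to s is the inverse of a forward increment e. Applying
  the product bound to e e^-1 = 1 gives lg(e^-1) = -lg e + O(|e|^2) without differentiating the
  inversion. This error, the forward error and the replacement of x(s) by x(t) each get a third of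
  \<epsilon>.\<close>

lemma solves_expansion:
  assumes sol: "solves x \<nu>" and M: "\<And>t. norm (x t) \<le> M" and cont: "continuous_on UNIV x"
    and t: "0 \<le> t" and \<epsilon>: "0 < \<epsilon>"
  shows "\<exists>\<delta>>0. \<forall>s. 0 \<le> s \<and> \<bar>s - t\<bar> < \<delta> \<longrightarrow> inv (\<nu> t) \<otimes> \<nu> s \<in> dom \<and>
     norm (lg (inv (\<nu> t) \<otimes> \<nu> s) - (s - t) *\<^sub>R x t) \<le> \<epsilon> * \<bar>s - t\<bar>"
proof -
  have M0: "0 \<le> M" using M[of 0] norm_ge_zero order_trans by blast
  define \<epsilon>1 where "\<epsilon>1 = min 1 (\<epsilon> / 3)"
  have e1: "0 < \<epsilon>1" "\<epsilon>1 \<le> 1" "\<epsilon>1 \<le> \<epsilon> / 3" "\<epsilon>1 \<le> \<epsilon>" using \<epsilon> by (auto simp: \<epsilon>1_def)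
  obtain \<delta>1 where \<delta>1: "0 < \<delta>1" "\<And>s t. 0 \<le> s \<Longrightarrow> s \<le> t \<Longrightarrow> t - s < \<delta>1 \<Longrightarrow>
     inv (\<nu> s) \<otimes> \<nu> t \<in> dom \<and> norm (lg (inv (\<nu> s) \<otimes> \<nu> t) - (t - s) *\<^sub>R x s) \<le> \<epsilon>1 * (t - s)"
    using sol e1 unfolding solves_def by meson
  obtain \<delta>2 where \<delta>2: "0 < \<delta>2" "\<And>s. \<bar>s - t\<bar> < \<delta>2 \<Longrightarrow> norm (x s - x t) < \<epsilon> / 3"
  proof -
    have "0 < \<epsilon> / 3" using \<epsilon> by simp
    then obtain \<delta>2 where "0 < \<delta>2" "\<forall>s\<in>UNIV. dist s t < \<delta>2 \<longrightarrow> dist (x s) (x t) < \<epsilon> / 3"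
      using cont unfolding continuous_on_iff by (meson UNIV_I)
    then show thesis using that[of \<delta>2] by (auto simp: dist_norm)
  qed
  obtain \<rho> where \<rho>: "0 < \<rho>" "\<rho> \<le> R" "\<And>p. p \<in> D \<rho> \<Longrightarrow> inv p \<in> D r0"
    using nbhd_inv[OF open_D one_D[OF r0_pos]] by blast
  define \<delta> where "\<delta> = Min {\<delta>1, \<delta>2, \<rho> / (M + 1), r0 / (M + 1), \<epsilon> / (6 * C * (M + 1)\<^sup>2)}"
  have \<delta>: "0 < \<delta>" "\<delta> \<le> \<delta>1" "\<delta> \<le> \<delta>2" "\<delta> \<le> \<rho> / (M + 1)" "\<delta> \<le> r0 / (M + 1)" "\<delta> \<le> \<epsilon> / (6 * C * (M + 1)\<^sup>2)"
    using \<delta>1 \<delta>2 \<rho> M0 r0_pos C_pos \<epsilon> by (auto simp: \<delta>_def)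
  have "inv (\<nu> t) \<otimes> \<nu> s \<in> dom \<and> norm (lg (inv (\<nu> t) \<otimes> \<nu> s) - (s - t) *\<^sub>R x t) \<le> \<epsilon> * \<bar>s - t\<bar>"
    if s: "0 \<le> s" and d: "\<bar>s - t\<bar> < \<delta>" for s
  proof (cases "t \<le> s")
    case True
    have "norm (lg (inv (\<nu> t) \<otimes> \<nu> s) - (s - t) *\<^sub>R x t) \<le> \<epsilon>1 * (s - t)" "inv (\<nu> t) \<otimes> \<nu> s \<in> dom"
      using \<delta>1(2)[OF t True] d \<delta> by auto
    moreover have "\<epsilon>1 * (s - t) \<le> \<epsilon> * (s - t)" using e1 True by (intro mult_right_mono) auto
    ultimately show ?thesis using True by auto
  next
    case False
    define h where "h = t - s"
    have h: "0 < h" "h < \<delta>" using False d by (auto simp: h_def)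
    define e where "e = inv (\<nu> s) \<otimes> \<nu> t"
    have e: "e \<in> dom" "norm (lg e - h *\<^sub>R x s) \<le> \<epsilon>1 * h"
      using \<delta>1(2)[OF s, of t] False d \<delta> by (auto simp: e_def h_def)
    have car: "\<nu> s \<in> carrier N" "\<nu> t \<in> carrier N" using sol s t by (auto simp: solves_def)
    have f: "inv (\<nu> t) \<otimes> \<nu> s = inv e" using car by (simp add: e_def inv_mult_group)
    have "norm (lg e) \<le> norm (h *\<^sub>R x s) + norm (lg e - h *\<^sub>R x s)" by (rule norm_triangle_sub)
    also have "\<dots> \<le> h * M + 1 * h"
      using order_trans[OF e(2) mult_right_mono[OF e1(2), of h]] h mult_left_mono[OF M[of s], of h]
      by (intro add_mono) auto
    finally have ne: "norm (lg e) \<le> (M + 1) * h" by (simp add: algebra_simps)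
    have "(M + 1) * h < \<rho>" "(M + 1) * h < r0"
      using mult_strict_left_mono[OF h(2), of "M + 1"] \<delta>(4,5) M0 by (auto simp: field_simps)
    then have eD: "e \<in> D \<rho>" "e \<in> D r0" using ne e(1) by (auto simp: D_def)
    then have fD: "inv e \<in> D r0" using \<rho> by blast
    have "norm (lg (e \<otimes> inv e) - lg e - lg (inv e)) \<le> C * norm (lg e) * norm (lg (inv e))"
      using eD fD D_r0_R by (intro D_lg_mult) auto
    then have 1: "norm (lg e + lg (inv e)) \<le> C * norm (lg e) * norm (lg (inv e))"
      using D_carrier[OF eD(1)] by (simp add: lg_one norm_minus_commute add.commute)
        (metis add.commute minus_add_distrib norm_minus_cancel uminus_add_conv_diff)
    have "C * norm (lg e) \<le> C * r0" using D_norm[OF eD(2)] C_pos by (intro mult_left_mono) auto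
    then have "C * norm (lg e) \<le> 1/2" using r0_C by linarith
    then have "C * norm (lg e) * norm (lg (inv e)) \<le> 1/2 * norm (lg (inv e))" by (intro mult_right_mono) auto
    moreover have "norm (lg (inv e)) \<le> norm (lg e + lg (inv e)) + norm (lg e)"
      by (metis add.commute add_diff_cancel_left' norm_triangle_ineq4)
    ultimately have nf: "norm (lg (inv e)) \<le> 2 * norm (lg e)" using 1 by linarith
    have "C * norm (lg e) * norm (lg (inv e)) \<le> C * norm (lg e) * (2 * norm (lg e))"
      using nf C_pos by (intro mult_left_mono) auto
    also have "\<dots> = 2 * C * (norm (lg e))\<^sup>2" by (simp add: power2_eq_square)
    also have "\<dots> \<le> 2 * C * ((M + 1) * h)\<^sup>2"
      using ne C_pos by (intro mult_left_mono power_mono) auto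
    also have "\<dots> \<le> (\<epsilon> / 3) * h"
    proof -
      have "h \<le> \<epsilon> / (6 * C * (M + 1)\<^sup>2)" using h(2) \<delta>(6) by simp
      then have "h * (6 * C * (M + 1)\<^sup>2) \<le> \<epsilon>" using C_pos M0 by (subst (asm) pos_le_divide_eq) auto
      then have "2 * C * (M + 1)\<^sup>2 * h \<le> \<epsilon> / 3" by (simp add: mult_ac)
      from mult_right_mono[OF this less_imp_le[OF h(1)]] show ?thesis
        by (simp add: power2_eq_square mult_ac)
    qed
    finally have A: "norm (lg e + lg (inv e)) \<le> (\<epsilon> / 3) * h" using 1 by simp
    have B: "norm (lg e - h *\<^sub>R x s) \<le> (\<epsilon> / 3) * h"
      using order_trans[OF e(2) mult_right_mono[OF e1(3), of h]] h by simp
    have "norm (x s - x t) \<le> \<epsilon> / 3" using less_imp_le[OF \<delta>2(2)[of s]] d \<delta> by simp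
    then have H: "norm (h *\<^sub>R (x s - x t)) \<le> (\<epsilon> / 3) * h"
      using h mult_left_mono[of "norm (x s - x t)" "\<epsilon> / 3" h] by (simp add: mult.commute)
    have E: "lg (inv e) - (s - t) *\<^sub>R x t = (lg e + lg (inv e)) - (lg e - h *\<^sub>R x s) - h *\<^sub>R (x s - x t)"
      by (simp add: h_def algebra_simps)
    have "norm (lg (inv e) - (s - t) *\<^sub>R x t) \<le> (\<epsilon> / 3) * h + (\<epsilon> / 3) * h + (\<epsilon> / 3) * h"
      unfolding E using H A B norm_triangle_ineq4[of "(lg e + lg (inv e)) - (lg e - h *\<^sub>R x s)" "h *\<^sub>R (x s - x t)"]
        norm_triangle_ineq4[of "lg e + lg (inv e)" "lg e - h *\<^sub>R x s"] by linarith
    also have "\<dots> = \<epsilon> * \<bar>s - t\<bar>" using False by (simp add: h_def)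
    finally show ?thesis using D_dom[OF fD] by (simp add: f)
  qed
  then show ?thesis using \<delta>(1) by blast
qed

lemma solves_derivative:
  assumes "solves x \<nu>" "\<And>t. norm (x t) \<le> M" "continuous_on UNIV x" "0 \<le> t"
  shows "((\<lambda>s. lg (inv (\<nu> t) \<otimes> \<nu> s)) has_vector_derivative x t) (at t within {0..})"
  unfolding has_vector_derivative_def has_derivative_within_alt
proof (intro conjI allI impI)
  fix e :: real assume "0 < e"
  from solves_expansion[OF assms this]
  obtain \<delta> where \<delta>: "0 < \<delta>" "\<And>s. 0 \<le> s \<Longrightarrow> \<bar>s - t\<bar> < \<delta> \<Longrightarrow>
     norm (lg (inv (\<nu> t) \<otimes> \<nu> s) - (s - t) *\<^sub>R x t) \<le> e * \<bar>s - t\<bar>" by blast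
  have "\<nu> t \<in> carrier N" using assms by (simp add: solves_def)
  then show "\<exists>d>0. \<forall>y\<in>{0..}. norm (y - t) < d \<longrightarrow>
    norm (lg (inv (\<nu> t) \<otimes> \<nu> y) - lg (inv (\<nu> t) \<otimes> \<nu> t) - (y - t) *\<^sub>R x t) \<le> e * norm (y - t)"
    using \<delta> by (auto simp: lg_one)
qed (rule bounded_linear_scaleR_left)

lemma solves_continuous:
  assumes "solves x \<nu>" "\<And>t. norm (x t) \<le> M" "continuous_on UNIV x"
  shows "continuous_map (top_of_set {0..}) T \<nu>"
proof (rule continuous_map_of_nbhd)
  show "\<nu> t \<in> carrier N" if "t \<in> {0..}" for t using assms(1) that by (simp add: solves_def)
  fix t \<rho> :: real assume t: "t \<in> {0..}" and \<rho>: "0 < \<rho>"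
  then have t0: "0 \<le> t" by simp
  obtain \<delta> where \<delta>: "0 < \<delta>" "\<And>s. 0 \<le> s \<Longrightarrow> \<bar>s - t\<bar> < \<delta> \<Longrightarrow> inv (\<nu> t) \<otimes> \<nu> s \<in> dom \<and>
     norm (lg (inv (\<nu> t) \<otimes> \<nu> s) - (s - t) *\<^sub>R x t) \<le> 1 * \<bar>s - t\<bar>"
    using solves_expansion[OF assms t0 zero_less_one] by blast
  have M0: "0 \<le> M" using assms(2)[of 0] norm_ge_zero order_trans by blast
  define d where "d = min \<delta> (\<rho> / (M + 1))"
  have d: "0 < d" "d \<le> \<delta>" "d \<le> \<rho> / (M + 1)" using \<delta> \<rho> M0 by (auto simp: d_def)
  have "inv (\<nu> t) \<otimes> \<nu> s \<in> D \<rho>" if s: "0 \<le> s" "\<bar>s - t\<bar> < d" for s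
  proof -
    have "norm (lg (inv (\<nu> t) \<otimes> \<nu> s)) \<le> norm ((s - t) *\<^sub>R x t) + norm (lg (inv (\<nu> t) \<otimes> \<nu> s) - (s - t) *\<^sub>R x t)"
      by (rule norm_triangle_sub)
    also have "\<dots> \<le> \<bar>s - t\<bar> * M + 1 * \<bar>s - t\<bar>"
      using \<delta>(2)[of s] s d assms(2) by (intro add_mono) (auto intro: mult_left_mono)
    also have "\<dots> = (M + 1) * \<bar>s - t\<bar>" by (simp add: algebra_simps)
    also have "\<dots> < (M + 1) * d" using s M0 by (intro mult_strict_left_mono) auto
    also have "\<dots> \<le> \<rho>" using d M0 by (simp add: field_simps)
    finally show ?thesis using \<delta>(2)[of s] s d by (simp add: D_def)
  qed
  then show "\<forall>\<^sub>F s in at t within {0..}. inv (\<nu> t) \<otimes> \<nu> s \<in> D \<rho>"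
    unfolding eventually_at using d(1) by (intro exI[of _ d]) (auto simp: dist_real_def)
qed

section \<open>Uniqueness for a given logarithmic derivative\<close>

text \<open>The derivatives exist at each point without a common rate, so a grid comparison is not
  possible. Instead the quotient d = \<mu>^-1 \<nu> is kept below the barrier \<epsilon> exp(a t):
  at the first time the barrier is reached, one small step back shows that |d| grows more slowly
  than the barrier does. Then \<epsilon> tends to 0.\<close>

lemma log_derivative_unique:
  assumes cont: "continuous_map (top_of_set {0..1}) T \<mu>" "continuous_map (top_of_set {0..1}) T \<nu>"
    and init: "\<mu> 0 = \<nu> 0" and M: "\<And>t. norm (x t) \<le> M"
    and der: "\<And>t. t \<in> {0..1::real} \<Longrightarrow> ((\<lambda>s. lg (inv (\<mu> t) \<otimes> \<mu> s)) has_vector_derivative x t) (at t within {0..1})"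
       "\<And>t. t \<in> {0..1} \<Longrightarrow> ((\<lambda>s. lg (inv (\<nu> t) \<otimes> \<nu> s)) has_vector_derivative x t) (at t within {0..1})"
    and t: "t \<in> {0..1}"
  shows "\<mu> t = \<nu> t"
proof -
  have M0: "0 \<le> M" using M[of 0] norm_ge_zero order_trans by blast
  have car: "\<mu> t \<in> carrier N" "\<nu> t \<in> carrier N" if "t \<in> {0..1}" for t
    using cont that topspace by (auto simp: continuous_map_def Pi_iff)
  define d where "d t = inv (\<mu> t) \<otimes> \<nu> t" for t
  have dcar: "d t \<in> carrier N" if "t \<in> {0..1}" for t using car[OF that] by (simp add: d_def)
  define A where "A = C * (M + 1)"
  \<comment> \<open>The final inequality reads (a - 2 A - 1) h \<le> a (A + 1) h^2. This choice
    makes the left side h, which fails for h < 1 / (a (A + 1)).\<close>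
  define a where "a = 2 * A + 2"
  have A: "0 < A" using C_pos M0 by (simp add: A_def)
  then have "0 < a" by (simp add: a_def)
  note A = A this
  have claim: "d t \<in> D (\<epsilon> * exp (a * t))" if \<epsilon>: "0 < \<epsilon>" "\<epsilon> * exp a \<le> r0 / 4" and t: "t \<in> {0..1}" for \<epsilon> t
  proof (rule ccontr)
    define b where "b t = \<epsilon> * exp (a * t)" for t
    have b0: "0 < b t" for t using \<epsilon> by (simp add: b_def)
    have bmono: "b s \<le> b t" if "s \<le> t" for s t using that \<epsilon> A by (simp add: b_def)
    have br0: "b t \<le> r0 / 4" if "t \<le> 1" for t using order_trans[OF bmono[OF that], of "r0 / 4"] \<epsilon> unfolding b_def by simp
    define Bd where "Bd = {t \<in> {0..1}. d t \<notin> D (b t)}"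
    assume "d t \<notin> D (\<epsilon> * exp (a * t))"
    then have ne: "Bd \<noteq> {}" using t by (auto simp: Bd_def b_def)
    have bdd: "bdd_below Bd" by (auto simp: Bd_def bdd_below_def)
    define u where "u = Inf Bd"
    have "0 \<le> u" unfolding u_def by (rule cInf_greatest[OF ne]) (simp add: Bd_def)
    moreover obtain t1 where "t1 \<in> Bd" using ne by blast
    then have "u \<le> 1" using cInf_lower[OF _ bdd, of t1] by (simp add: u_def Bd_def)
    ultimately have u01: "0 \<le> u" "u \<le> 1" by auto
    have good: "d s \<in> D (b s)" if "0 \<le> s" "s < u" for s
    proof (rule ccontr)
      assume "d s \<notin> D (b s)"
      then have "s \<in> Bd" using that u01 by (auto simp: Bd_def)
      then show False using cInf_lower[OF _ bdd, of s] that by (simp add: u_def)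
    qed
    \<comment> \<open>The infimum of the bad times is itself bad: if d(u) were in the open set
      \<open>D (b u)\<close>, so would be d(s) for s slightly larger, and the barrier
      increases.\<close>
    have ubad: "d u \<notin> D (b u)"
    proof
      assume du: "d u \<in> D (b u)"
      have "continuous_map (top_of_set {0..1}) T (\<lambda>t. (\<lambda>(x, y). x \<otimes> y) (inv (\<mu> t), \<nu> t))"
        using continuous_map_compose[OF cont(1) cont_inv] cont(2)
        by (intro continuous_map_compose[OF _ cont_mult, unfolded o_def] continuous_map_pairedI) (auto simp: o_def)
      then have "openin (top_of_set {0..1}) {s \<in> topspace (top_of_set {0..1}). (\<lambda>(x, y). x \<otimes> y) (inv (\<mu> s), \<nu> s) \<in> D (b u)}"
        using open_D by (rule openin_continuous_map_preimage)
      then have "openin (top_of_set {0..1}) {s \<in> {0..1}. d s \<in> D (b u)}" by (simp add: d_def)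
      then obtain V where V: "open V" "{s \<in> {0..1}. d s \<in> D (b u)} = {0..1} \<inter> V"
        unfolding openin_open by (elim exE conjE)
      have "u \<in> V" using V(2) du u01 by auto
      then obtain e where e: "0 < e" "ball u e \<subseteq> V" using V(1) unfolding open_contains_ball by blast
      have "u + e \<le> s" if "s \<in> Bd" for s
      proof (rule ccontr)
        assume "\<not> u + e \<le> s"
        moreover have us: "u \<le> s" using cInf_lower[OF that bdd] by (simp add: u_def)
        ultimately have "s \<in> V" using e by (auto simp: dist_real_def subset_iff)
        moreover have "s \<in> {0..1}" using that by (simp add: Bd_def)
        ultimately have "s \<in> {s \<in> {0..1}. d s \<in> D (b u)}" unfolding V(2) by simp
        then have "d s \<in> D (b s)" using D_mono[OF _ bmono[OF us]] by simp
        then show False using that by (simp add: Bd_def)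
      qed
      then have "u + e \<le> Inf Bd" by (rule cInf_greatest[OF ne])
      then have "u + e \<le> u" by (simp add: u_def)
      then show False using e by simp
    qed
    have "d 0 \<in> D (b 0)" using init car[of 0] b0 by (simp add: d_def one_D)
    then have u_pos: "0 < u" using ubad u01 by (cases "u = 0") auto
    have uI: "u \<in> {0..1}" using u01 by simp
    define W where "W s = inv (\<mu> u) \<otimes> \<mu> s" for s
    define W' where "W' s = inv (\<nu> u) \<otimes> \<nu> s" for s
    \<comment> \<open>Both sides are \<mu>(u)^-1 \<nu>(s). The equation relates d(u) to d(s) through
      two increments with the same derivative, which cancel to first order.\<close>
    have eq: "d u \<otimes> W' s = W s \<otimes> d s" if "s \<in> {0..1}" for s
    proof -
      have c: "\<mu> u \<in> carrier N" "\<nu> u \<in> carrier N" "\<mu> s \<in> carrier N" "\<nu> s \<in> carrier N"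
        using car uI that by auto
      have "d u \<otimes> W' s = inv (\<mu> u) \<otimes> (\<nu> u \<otimes> (inv (\<nu> u) \<otimes> \<nu> s))"
        using c by (simp add: d_def W'_def m_assoc)
      also have "\<dots> = inv (\<mu> u) \<otimes> \<nu> s" using c by (simp add: m_assoc[symmetric])
      also have "\<dots> = inv (\<mu> u) \<otimes> (\<mu> s \<otimes> (inv (\<mu> s) \<otimes> \<nu> s))" using c by (simp add: m_assoc[symmetric])
      also have "\<dots> = W s \<otimes> d s" using c by (simp add: d_def W_def m_assoc)
      finally show ?thesis .
    qed
    \<comment> \<open>A sequence from the left, where the barrier still holds. Its limit also shows
      that d(u) lies in the chart domain, which its failure to be in \<open>D (b u)\<close> leaves
      open.\<close>
    define s where "s j = u - u / real (j + 2)" for j :: nat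
    have s: "0 \<le> s j" "s j < u" "s j \<in> {0..1}" for j
    proof -
      have "u / real (j + 2) \<le> u" using u_pos by (simp add: field_simps)
      moreover have "0 < u / real (j + 2)" using u_pos by simp
      ultimately show "0 \<le> s j" "s j < u" "s j \<in> {0..1}" using u01 by (auto simp: s_def)
    qed
    have "(\<lambda>j. u - u / real (j + 2)) \<longlonglongrightarrow> u - 0"
      by (intro tendsto_diff tendsto_const LIMSEQ_ignore_initial_segment lim_const_over_n)
    then have slim: "s \<longlonglongrightarrow> u" by (simp add: s_def[abs_def])
    have sfil: "filterlim s (at u within {0..1}) sequentially"
      unfolding filterlim_at using slim s(2,3) by (auto intro!: always_eventually simp: less_imp_neq)
    have lim: "d u \<in> dom \<and> (\<lambda>j. lg (d (s j))) \<longlonglongrightarrow> lg (d u)"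
    proof (rule limit_lg)
      show "d u \<in> carrier N" using dcar uI by blast
      show "\<forall>\<^sub>F j in sequentially. d (s j) \<in> D (r0 / 2)"
      proof (intro always_eventually allI)
        fix j
        have "b (s j) \<le> r0 / 2" using br0[of "s j"] s(3)[of j] r0_pos by simp
        then show "d (s j) \<in> D (r0 / 2)" using good[OF s(1,2)] D_mono by blast
      qed
      show "\<forall>\<^sub>F j in sequentially. W (s j) \<in> D \<rho>" if "0 < \<rho>" for \<rho>
        using filterlim_iff[THEN iffD1, OF sfil] continuous_map_nbhd[OF cont(1) uI that] by (auto simp: W_def)
      show "\<forall>\<^sub>F j in sequentially. W' (s j) \<in> D \<rho>" if "0 < \<rho>" for \<rho>
        using filterlim_iff[THEN iffD1, OF sfil] continuous_map_nbhd[OF cont(2) uI that] by (auto simp: W'_def)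
      show "d u \<otimes> W' (s j) = W (s j) \<otimes> d (s j)" for j using eq s(3) by blast
    qed
    have "norm (lg (d u)) \<le> b u"
    proof (rule tendsto_upperbound[OF tendsto_norm[OF conjunct2[OF lim]]])
      show "\<forall>\<^sub>F j in sequentially. norm (lg (d (s j))) \<le> b u"
        using less_le_trans[OF D_norm[OF good[OF s(1,2)]] bmono[OF less_imp_le[OF s(2)]]]
        by (intro always_eventually allI less_imp_le)
    qed simp
    \<comment> \<open>At the first bad time the barrier is met exactly: the limit from the left
      gives one inequality, badness the other.\<close>
    then have zb: "norm (lg (d u)) = b u" using ubad lim by (auto simp: D_def)
    have duD: "d u \<in> D r0" using zb lim br0[OF u01(2)] r0_pos by (simp add: D_def)
    define \<epsilon>1 where "\<epsilon>1 = min 1 (\<epsilon> / 2)"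
    have e1: "0 < \<epsilon>1" "\<epsilon>1 \<le> 1" "2 * \<epsilon>1 \<le> \<epsilon>" using \<epsilon> by (auto simp: \<epsilon>1_def)
    have W1: "W u = \<one>" "W' u = \<one>" using car uI by (auto simp: W_def W'_def)
    obtain h1 where h1: "0 < h1" "\<And>y. y \<in> {0..1} \<Longrightarrow> norm (y - u) < h1 \<Longrightarrow>
        norm (lg (W y) - (y - u) *\<^sub>R x u) \<le> \<epsilon>1 * norm (y - u)"
      using der(1)[OF uI] e1(1) W1 unfolding has_vector_derivative_def has_derivative_within_alt W_def[symmetric]
      by (auto simp: lg_one)
    obtain h2 where h2: "0 < h2" "\<And>y. y \<in> {0..1} \<Longrightarrow> norm (y - u) < h2 \<Longrightarrow>
        norm (lg (W' y) - (y - u) *\<^sub>R x u) \<le> \<epsilon>1 * norm (y - u)"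
      using der(2)[OF uI] e1(1) W1 unfolding has_vector_derivative_def has_derivative_within_alt W'_def[symmetric]
      by (auto simp: lg_one)
    define h0 where "h0 = Min {h1, h2, 1 / (a * (A + 1))}"
    have h0: "0 < h0" "h0 \<le> h1" "h0 \<le> h2" "h0 \<le> 1 / (a * (A + 1))" using h1 h2 A by (auto simp: h0_def)
    have "\<forall>\<^sub>F j in sequentially. dist (s j) u < h0" using slim h0(1) tendstoD by blast
    moreover have "\<forall>\<^sub>F j in sequentially. W (s j) \<in> D r0"
        using filterlim_iff[THEN iffD1, OF sfil] continuous_map_nbhd[OF cont(1) uI r0_pos] by (auto simp: W_def)
    moreover have "\<forall>\<^sub>F j in sequentially. W' (s j) \<in> D r0"
        using filterlim_iff[THEN iffD1, OF sfil] continuous_map_nbhd[OF cont(2) uI r0_pos] by (auto simp: W'_def)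
    ultimately have "\<forall>\<^sub>F j in sequentially. dist (s j) u < h0 \<and> W (s j) \<in> D r0 \<and> W' (s j) \<in> D r0"
      by eventually_elim auto
    then obtain j where j: "dist (s j) u < h0" "W (s j) \<in> D r0" "W' (s j) \<in> D r0"
      using eventually_happens'[OF sequentially_bot] by blast
    define h where "h = u - s j"
    have h: "0 < h" "h < h0" using s(2)[of j] j(1) by (auto simp: h_def dist_real_def)
    have su: "s j - u = - h" by (simp add: h_def)
    have w: "norm (lg (W (s j)) + h *\<^sub>R x u) \<le> \<epsilon>1 * h" "norm (lg (W' (s j)) + h *\<^sub>R x u) \<le> \<epsilon>1 * h"
      using h1(2)[OF s(3)[of j]] h2(2)[OF s(3)[of j]] h h0 unfolding su by auto
    have bd: "norm y \<le> (M + 1) * h" if "norm (y + h *\<^sub>R x u) \<le> \<epsilon>1 * h" for y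
    proof -
      have "norm y \<le> norm (y + h *\<^sub>R x u) + norm (h *\<^sub>R x u)"
        by (metis add_diff_cancel norm_triangle_ineq4)
      also have "\<dots> \<le> 1 * h + h * M"
        using order_trans[OF that mult_right_mono[OF e1(2), of h]] h mult_left_mono[OF M[of u], of h]
        by (intro add_mono) auto
      finally show ?thesis by (simp add: algebra_simps)
    qed
    have ww: "norm (lg (W (s j)) - lg (W' (s j))) \<le> \<epsilon> * h"
    proof -
      have "norm (lg (W (s j)) - lg (W' (s j))) \<le> \<epsilon>1 * h + \<epsilon>1 * h"
        using w norm_triangle_ineq4[of "lg (W (s j)) + h *\<^sub>R x u" "lg (W' (s j)) + h *\<^sub>R x u"] by simp
      also have "\<dots> = (2 * \<epsilon>1) * h" by simp
      also have "\<dots> \<le> \<epsilon> * h" using e1 h by (intro mult_right_mono) auto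
      finally show ?thesis .
    qed
    define z where "z = norm (lg (d (s j)))"
    have dsD: "d (s j) \<in> D (b (s j))" using good s by blast
    then have dsR: "d (s j) \<in> D R" using br0[of "s j"] s(3)[of j] r0_le r0_pos D_mono by (auto simp: D_def)
    have zlt: "z < b (s j)" using D_norm[OF dsD] by (simp add: z_def)
    have "norm (lg (W (s j) \<otimes> d (s j)) - lg (W (s j)) - lg (d (s j))) \<le> C * norm (lg (W (s j))) * z"
      unfolding z_def using j dsR D_r0_R by (intro D_lg_mult) auto
    also have "\<dots> \<le> C * ((M + 1) * h) * z"
      using bd[OF w(1)] C_pos by (intro mult_right_mono mult_left_mono) (auto simp: z_def)
    finally have p1: "norm (lg (W (s j) \<otimes> d (s j)) - lg (W (s j)) - lg (d (s j))) \<le> A * h * z"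
      by (simp add: A_def mult_ac)
    have "norm (lg (d u \<otimes> W' (s j)) - lg (d u) - lg (W' (s j))) \<le> C * norm (lg (d u)) * norm (lg (W' (s j)))"
      using j duD D_r0_R by (intro D_lg_mult) auto
    also have "\<dots> \<le> C * b u * ((M + 1) * h)"
      using bd[OF w(2)] C_pos b0[of u] by (intro mult_mono) (auto simp: zb)
    finally have p2: "norm (lg (d u \<otimes> W' (s j)) - lg (d u) - lg (W' (s j))) \<le> A * h * b u"
      by (simp add: A_def mult_ac)
    have "lg (d u) = lg (d (s j)) + (lg (W (s j)) - lg (W' (s j)))
       + (lg (W (s j) \<otimes> d (s j)) - lg (W (s j)) - lg (d (s j))) - (lg (d u \<otimes> W' (s j)) - lg (d u) - lg (W' (s j)))"
      using eq[OF s(3)[of j]] by simp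
    then have "b u \<le> z + \<epsilon> * h + A * h * z + A * h * b u"
      using ww p1 p2 norm_triangle_ineq norm_triangle_ineq4 unfolding zb[symmetric] z_def
      by (smt (verit))
    \<comment> \<open>Since \<epsilon> \<le> b(u), the derivative error \<epsilon> h is absorbed
      into b(u) h.\<close>
    moreover have "b u = \<epsilon> * exp (a * u)" "\<epsilon> \<le> b u"
      using \<epsilon> A u01 by (auto simp: b_def)
    ultimately have "b u \<le> z * (1 + A * h) + b u * h + A * h * b u"
      using mult_right_mono[of \<epsilon> "b u" h] h by (simp add: algebra_simps)
    also have "z * (1 + A * h) \<le> b (s j) * (1 + A * h)"
      using zlt h A by (intro mult_right_mono) auto
    finally have k1: "b u * (1 - (A + 1) * h) \<le> b (s j) * (1 + A * h)"
      by (simp add: algebra_simps)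
    have "b (s j) * (1 + a * h) \<le> b (s j) * exp (a * h)"
      using b0[of "s j"] exp_ge_add_one_self[of "a * h"] by (intro mult_left_mono) auto
    also have "\<dots> = b u" by (simp add: b_def h_def mult_exp_exp[symmetric] algebra_simps exp_add[symmetric])
    finally have k2: "b (s j) * (1 + a * h) \<le> b u" .
    have "b u * (1 - (A + 1) * h) * (1 + a * h) \<le> b (s j) * (1 + A * h) * (1 + a * h)"
      using k1 h A by (intro mult_right_mono) auto
    also have "\<dots> = b (s j) * (1 + a * h) * (1 + A * h)" by simp
    also have "\<dots> \<le> b u * (1 + A * h)" using k2 h A by (intro mult_right_mono) auto
    finally have "b u * ((1 - (A + 1) * h) * (1 + a * h)) \<le> b u * (1 + A * h)" by (simp add: mult_ac)
    then have "(1 - (A + 1) * h) * (1 + a * h) \<le> 1 + A * h" using b0[of u] by simp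
    then have "h * 1 \<le> h * (a * (A + 1) * h)" by (simp add: algebra_simps a_def)
    then have "1 \<le> a * (A + 1) * h" using h by simp
    moreover have "h < 1 / (a * (A + 1))" using h h0(4) by simp
    then have "h * (a * (A + 1)) < 1" using A by (subst (asm) pos_less_divide_eq) auto
    then have "a * (A + 1) * h < 1" by (simp add: mult.commute)
    ultimately show False by simp
  qed
  have small: "d t \<in> D \<rho>" if \<rho>: "0 < \<rho>" for \<rho>
  proof -
    define \<epsilon> where "\<epsilon> = min \<rho> (r0 / 4) / exp a"
    have e: "0 < \<epsilon>" "\<epsilon> * exp a \<le> r0 / 4" "\<epsilon> * exp a \<le> \<rho>" using \<rho> r0_pos by (auto simp: \<epsilon>_def)
    have "\<epsilon> * exp (a * t) \<le> \<epsilon> * exp a" using e t A by simp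
    then show ?thesis using claim[OF e(1,2) t] e D_mono by (meson order_trans)
  qed
  have "norm (lg (d t)) \<le> 0" using small D_norm by (meson dense_ge less_imp_le)
  then have "d t = \<one>" using ex_lg[OF D_dom[OF small[OF r0_pos]]] ex_0 by simp
  then show ?thesis using car[OF t] by (simp add: d_def) (metis inv_equality inv_inv inv_closed)
qed

end

section \<open>Smooth maps and charts\<close>

text \<open>The part of smoothness used in the sequel. The operator norm Lipschitz condition is
  spelled out on vectors, so that \<open>f'\<close> can be a plain function.\<close>

definition C11_derivative :: "'a::real_normed_vector set \<Rightarrow> ('a \<Rightarrow> 'b::real_normed_vector) \<Rightarrow> ('a \<Rightarrow> 'a \<Rightarrow> 'b) \<Rightarrow> bool" where
  "C11_derivative S f f' \<longleftrightarrow> (\<forall>x\<in>S. (f has_derivative f' x) (at x) \<and> (\<exists>r>0. \<exists>K. ball x r \<subseteq> S \<and>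
     (\<forall>y\<in>ball x r. \<forall>z\<in>ball x r. \<forall>v. norm (f' y v - f' z v) \<le> K * norm (y - z) * norm v)))"

lemma C11_derivativeD:
  assumes "C11_derivative S f f'" "x \<in> S"
  shows "(f has_derivative f' x) (at x)"
    "\<exists>r>0. \<exists>K. ball x r \<subseteq> S \<and>
     (\<forall>y\<in>ball x r. \<forall>z\<in>ball x r. \<forall>v. norm (f' y v - f' z v) \<le> K * norm (y - z) * norm v)"
  using assms by (auto simp: C11_derivative_def)

text \<open>\<open>D 1\<close> is the derivative, and the mean value inequality makes it Lipschitz
  once \<open>D 2\<close> is bounded near \<open>x\<close>. That bound comes from differentiability
  of \<open>D 2\<close> at \<open>x\<close> alone: there \<open>D 2 y\<close> is
  \<open>D 2 x\<close> plus a term from \<open>D 3 x\<close>, up to an error of at most |y -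
  x|.\<close>

lemma frechet_smooth_derivative:
  fixes f :: "'a::real_normed_vector \<Rightarrow> 'b::real_normed_vector"
  assumes "frechet_smooth_on S f"
  obtains f' where "C11_derivative S f f'"
proof -
  obtain D :: "nat \<Rightarrow> 'a \<Rightarrow> 'a list \<Rightarrow> 'b" where S: "open S" and D0: "\<And>x. x \<in> S \<Longrightarrow> D 0 x [] = f x"
    and ml: "\<And>k x. x \<in> S \<Longrightarrow> bounded_multilinear k (D k x)"
    and ev: "\<And>k x \<epsilon>. x \<in> S \<Longrightarrow> \<epsilon> > 0 \<Longrightarrow> \<forall>\<^sub>F y in at x. \<forall>vs. length vs = k \<longrightarrow>
             norm (D k y vs - D k x vs - D (Suc k) x ((y - x) # vs))
               \<le> \<epsilon> * norm (y - x) * prod_list (map norm vs)"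
    using assms unfolding frechet_smooth_on_def by blast
  define f' where "f' x v = D 1 x [v]" for x v
  have lin1: "linear (f' x)" if "x \<in> S" for x
  proof -
    have "linear (\<lambda>v. D 1 x ([0][0 := v]))"
      using ml[OF that, of 1] unfolding bounded_multilinear_def by (metis length_Cons list.size(3) One_nat_def zero_less_one)
    then show ?thesis by (simp add: f'_def[abs_def])
  qed
  have bl1: "bounded_linear (f' x)" if x: "x \<in> S" for x
  proof -
    obtain c where c: "\<And>vs. length vs = 1 \<Longrightarrow> norm (D 1 x vs) \<le> c * prod_list (map norm vs)"
      using ml[OF x, of 1] unfolding bounded_multilinear_def by blast
    have "norm (f' x v) \<le> norm v * c" for v
      using c[of "[v]"] by (simp add: f'_def mult.commute)
    then show ?thesis using lin1[OF x]
      by (intro bounded_linear_intro[of _ c]) (auto simp: linear_add linear_scale)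
  qed
  have d: "(f has_derivative f' x) (at x)" if x: "x \<in> S" for x
    unfolding has_derivative_within_alt2
  proof (intro conjI allI impI bl1[OF x])
    fix e :: real assume "0 < e"
    from ev[OF x this, of 0] eventually_at_in_open'[OF S x]
    show "\<forall>\<^sub>F y in at x. norm (f y - f x - f' x (y - x)) \<le> e * norm (y - x)"
      by eventually_elim (use D0 x in \<open>auto simp: f'_def\<close>)
  qed
  have lin2: "linear (\<lambda>h. D 2 x [h, v])" if "x \<in> S" for x v
  proof -
    have "linear (\<lambda>h. D 2 x ([0, v][0 := h]))"
      using ml[OF that, of 2] unfolding bounded_multilinear_def
      by (metis length_Cons list.size(3) numeral_2_eq_2 zero_less_Suc)
    then show ?thesis by simp
  qed
  have d1: "((\<lambda>y. f' y v) has_derivative (\<lambda>h. D 2 x [h, v])) (at x)" if x: "x \<in> S" for x v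
    unfolding has_derivative_within_alt2
  proof (intro conjI allI impI)
    obtain c where c: "\<And>vs. length vs = 2 \<Longrightarrow> norm (D 2 x vs) \<le> c * prod_list (map norm vs)"
      using ml[OF x, of 2] unfolding bounded_multilinear_def by blast
    have "norm (D 2 x [h, v]) \<le> norm h * (c * norm v)" for h
      using c[of "[h, v]"] by (simp add: mult_ac)
    then show "bounded_linear (\<lambda>h. D 2 x [h, v])" using lin2[OF x, of v]
      by (intro bounded_linear_intro[of _ "c * norm v"] linear_add[OF lin2[OF x, of v]] linear_scale[OF lin2[OF x, of v]]) auto
    fix e :: real assume e: "0 < e"
    define e' where "e' = e / (norm v + 1)"
    have e': "0 < e'" "e' * norm v \<le> e"
    proof -
      have pos: "0 < norm v + 1" by (simp add: add_nonneg_pos)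
      then show "0 < e'" using e by (simp add: e'_def)
      have "e * norm v \<le> e * (norm v + 1)" using e by (intro mult_left_mono) auto
      then show "e' * norm v \<le> e" using pos by (simp add: e'_def pos_divide_le_eq)
    qed
    from ev[OF x e'(1), of 1]
    show "\<forall>\<^sub>F y in at x. norm (f' y v - f' x v - D 2 x [y - x, v]) \<le> e * norm (y - x)"
    proof eventually_elim
      case (elim y)
      have "norm (D 1 y [v] - D 1 x [v] - D (Suc 1) x ((y - x) # [v])) \<le> e' * norm (y - x) * prod_list (map norm [v])"
        using elim by (metis length_Cons list.size(3) One_nat_def)
      also have "\<dots> = (e' * norm v) * norm (y - x)" by simp
      also have "\<dots> \<le> e * norm (y - x)" using e' by (intro mult_right_mono) auto
      finally show ?case by (simp add: f'_def numeral_2_eq_2)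
    qed
  qed
  have lip: "\<exists>r>0. \<exists>K. ball x r \<subseteq> S \<and>
       (\<forall>y\<in>ball x r. \<forall>z\<in>ball x r. \<forall>v. norm (f' y v - f' z v) \<le> K * norm (y - z) * norm v)" if x: "x \<in> S" for x
  proof -
    obtain c2 where c2: "\<And>vs. length vs = 2 \<Longrightarrow> norm (D 2 x vs) \<le> c2 * prod_list (map norm vs)"
      using ml[OF x, of 2] unfolding bounded_multilinear_def by blast
    obtain c3 where c3: "\<And>vs. length vs = 3 \<Longrightarrow> norm (D 3 x vs) \<le> c3 * prod_list (map norm vs)"
      using ml[OF x, of 3] unfolding bounded_multilinear_def by blast
    \<comment> \<open>The summands bound the value of \<open>D 2\<close> at \<open>x\<close>, the
      linear term and the remainder, for |y - x| \<le> 1.\<close>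
    define K where "K = \<bar>c2\<bar> + \<bar>c3\<bar> + 1"
    obtain r1 where r1: "0 < r1" "\<And>y. y \<noteq> x \<Longrightarrow> dist y x < r1 \<Longrightarrow> \<forall>vs. length vs = 2 \<longrightarrow>
             norm (D 2 y vs - D 2 x vs - D (Suc 2) x ((y - x) # vs))
               \<le> 1 * norm (y - x) * prod_list (map norm vs)"
      using ev[OF x zero_less_one, of 2] unfolding eventually_at by auto
    obtain r2 where r2: "0 < r2" "ball x r2 \<subseteq> S" using S x unfolding open_contains_ball by blast
    define r where "r = Min {r1, r2, 1}"
    have r: "0 < r" "r \<le> r1" "r \<le> r2" "r \<le> 1" using r1 r2 by (auto simp: r_def)
    have rS: "ball x r \<subseteq> S" using r2 r by (meson ball_subset_ball_iff order_trans subset_ball)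
    have bd: "norm (D 2 y [h, v]) \<le> (K * norm v) * norm h" if y: "y \<in> ball x r" for y h v
    proof -
      have b2: "norm (D 2 x [h, v]) \<le> \<bar>c2\<bar> * (norm h * norm v)"
        using order_trans[OF c2[of "[h, v]"] mult_right_mono[OF abs_ge_self]] by simp
      show ?thesis
      proof (cases "y = x")
        case True
        have "\<bar>c2\<bar> * (norm h * norm v) \<le> K * (norm h * norm v)" by (intro mult_right_mono) (auto simp: K_def)
        then show ?thesis using b2 True by (simp add: mult_ac)
      next
        case False
        have ny: "norm (y - x) \<le> 1" using y r by (auto simp: dist_norm norm_minus_commute)
        have "dist y x < r1" using y r by (auto simp: dist_commute)
        then have "norm (D 2 y [h, v] - D 2 x [h, v] - D (Suc 2) x ((y - x) # [h, v]))
            \<le> 1 * norm (y - x) * prod_list (map norm [h, v])"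
          using r1(2)[OF False] by (metis length_Cons list.size(3) numeral_2_eq_2)
        also have "\<dots> \<le> 1 * (norm h * norm v)" using ny by (simp add: mult_left_le_one_le)
        finally have 1: "norm (D 2 y [h, v] - D 2 x [h, v] - D 3 x [y - x, h, v]) \<le> 1 * (norm h * norm v)"
          by (simp add: numeral_3_eq_3 numeral_2_eq_2)
        have "norm (D 3 x [y - x, h, v]) \<le> c3 * (norm (y - x) * (norm h * norm v))"
          using c3[of "[y - x, h, v]"] by simp
        also have "\<dots> \<le> \<bar>c3\<bar> * (1 * (norm h * norm v))"
          using ny by (intro mult_mono mult_right_mono) auto
        finally have 2: "norm (D 3 x [y - x, h, v]) \<le> \<bar>c3\<bar> * (norm h * norm v)" by simp
        have "norm (D 2 y [h, v]) \<le> norm (D 2 y [h, v] - D 2 x [h, v] - D 3 x [y - x, h, v]) + norm (D 2 x [h, v])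
           + norm (D 3 x [y - x, h, v])"
          using norm_triangle_ineq[of "D 2 y [h, v] - D 2 x [h, v] - D 3 x [y - x, h, v]" "D 2 x [h, v] + D 3 x [y - x, h, v]"]
            norm_triangle_ineq[of "D 2 x [h, v]" "D 3 x [y - x, h, v]"] by simp
        also have "\<dots> \<le> 1 * (norm h * norm v) + \<bar>c2\<bar> * (norm h * norm v) + \<bar>c3\<bar> * (norm h * norm v)"
          using 1 2 b2 by simp
        finally show ?thesis by (simp add: K_def algebra_simps)
      qed
    qed
    have "norm (f' y v - f' z v) \<le> K * norm (y - z) * norm v" if "y \<in> ball x r" "z \<in> ball x r" for y z v
    proof -
      have "norm (f' y v - f' z v) \<le> (K * norm v) * norm (y - z)"
      proof (rule differentiable_bound[OF convex_ball _ _ that])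
        fix w assume w: "w \<in> ball x r"
        then show "((\<lambda>y. f' y v) has_derivative (\<lambda>h. D 2 w [h, v])) (at w within ball x r)"
          using d1 rS has_derivative_at_withinI by blast
        show "onorm (\<lambda>h. D 2 w [h, v]) \<le> K * norm v"
          using bd[OF w] by (intro onorm_bound) (auto simp: K_def)
      qed
      then show ?thesis by (simp add: mult_ac)
    qed
    then show ?thesis using r(1) rS by blast
  qed
  show thesis using that[of f'] d lip unfolding C11_derivative_def by blast
qed

text \<open>With the derivative in the second argument equal to the identity along \<open>{a} \<times> UNIV\<close>, the mean
  value inequality applied to \<open>v \<mapsto> m (u, v) - v\<close> gives the bound.\<close>

lemma unital_product_estimate:
  fixes m :: "'e::real_normed_vector \<times> 'e \<Rightarrow> 'e"
  assumes sm: "frechet_smooth_on S m" and S: "(a, a) \<in> S"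
    and unit: "\<And>u. (u, a) \<in> S \<Longrightarrow> m (u, a) = u" "\<And>v. (a, v) \<in> S \<Longrightarrow> m (a, v) = v"
  obtains r K where "0 < r" "0 < K" "\<And>u v. norm u < r \<Longrightarrow> norm v < r \<Longrightarrow>
     (u + a, v + a) \<in> S \<and> norm (m (u + a, v + a) - a - u - v) \<le> K * norm u * norm v"
proof -
  obtain m' where m': "\<And>x. x \<in> S \<Longrightarrow> (m has_derivative m' x) (at x)"
    "\<And>x. x \<in> S \<Longrightarrow> \<exists>r>0. \<exists>K. ball x r \<subseteq> S \<and>
       (\<forall>y\<in>ball x r. \<forall>z\<in>ball x r. \<forall>v. norm (m' y v - m' z v) \<le> K * norm (y - z) * norm v)"
    using frechet_smooth_derivative[OF sm] unfolding C11_derivative_def by metis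
  obtain r K0 where r: "0 < r" "ball (a, a) r \<subseteq> S"
    and K0: "\<And>y z v. y \<in> ball (a, a) r \<Longrightarrow> z \<in> ball (a, a) r \<Longrightarrow> norm (m' y v - m' z v) \<le> K0 * norm (y - z) * norm v"
    using m'(2)[OF S] by blast
  define K where "K = \<bar>K0\<bar> + 1"
  have K: "norm (m' y v - m' z v) \<le> K * norm (y - z) * norm v" if "y \<in> ball (a, a) r" "z \<in> ball (a, a) r" for y z v
  proof -
    have "norm (m' y v - m' z v) \<le> K0 * norm (y - z) * norm v" using K0 that by blast
    also have "\<dots> \<le> K * norm (y - z) * norm v" by (intro mult_right_mono) (auto simp: K_def)
    finally show ?thesis .
  qed
  have inb: "(u, v) \<in> ball (a, a) r" if "u \<in> ball a (r / 2)" "v \<in> ball a (r / 2)" for u v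
  proof -
    have "dist (a, a) (u, v) \<le> dist a u + dist a v"
      unfolding dist_prod_def by (simp add: sqrt_sum_squares_le_sum)
    then show ?thesis using that by simp
  qed
  have der2: "((\<lambda>v. m (u, v)) has_derivative (\<lambda>w. m' (u, v) (0, w))) (at v)"
    if "(u, v) \<in> S" for u v
    by (rule has_derivative_compose[where f = "\<lambda>v. (u, v)" and g = m and f' = "\<lambda>w. (0, w)"])
      (auto intro!: derivative_eq_intros m' that)
  have a0: "a \<in> ball a (r / 2)" using r by simp
  have idd: "m' (a, v) (0, w) = w" if v: "v \<in> ball a (r / 2)" for v w
  proof -
    have "((\<lambda>v. m (a, v)) has_derivative (\<lambda>w. m' (a, v) (0, w))) (at v)"
      using der2 inb[OF a0 v] r by blast
    moreover have "((\<lambda>v. m (a, v)) has_derivative (\<lambda>w. w)) (at v)"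
    proof (rule has_derivative_transform_within_open[OF _ open_ball v])
      show "((\<lambda>v. v) has_derivative (\<lambda>w. w)) (at v)" by simp
      show "x = m (a, x)" if "x \<in> ball a (r / 2)" for x
        using unit(2) inb[OF a0 that] r by auto
    qed
    ultimately show ?thesis using has_derivative_unique by metis
  qed
  have "(u + a, v + a) \<in> S \<and> norm (m (u + a, v + a) - a - u - v) \<le> K * norm u * norm v"
    if u: "norm u < r / 2" and v: "norm v < r / 2" for u v
  proof -
    have ub: "u + a \<in> ball a (r / 2)" and vb: "v + a \<in> ball a (r / 2)"
      using u v by (auto simp: dist_norm)
    have "norm ((m (u + a, v + a) - (v + a)) - (m (u + a, a) - a)) \<le> K * norm u * norm (v + a - a)"
    proof (rule differentiable_bound[OF convex_ball _ _ vb a0])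
      fix x assume x: "x \<in> ball a (r / 2)"
      show "((\<lambda>v. m (u + a, v) - v) has_derivative (\<lambda>w. m' (u + a, x) (0, w) - w)) (at x within ball a (r / 2))"
      proof (rule has_derivative_at_withinI, rule has_derivative_diff[OF der2 has_derivative_ident])
        show "(u + a, x) \<in> S" using inb[OF ub x] r(2) by (rule subsetD[rotated])
      qed
      have "norm (m' (u + a, x) (0, w) - w) \<le> K * norm u * norm w" for w
      proof -
        have "norm (m' (u + a, x) (0, w) - m' (a, x) (0, w)) \<le> K * norm ((u + a, x) - (a, x)) * norm (0::'e, w)"
          by (rule K[OF inb[OF ub x] inb[OF a0 x]])
        then show ?thesis unfolding idd[OF x] by (simp add: norm_Pair)
      qed
      then show "onorm (\<lambda>w. m' (u + a, x) (0, w) - w) \<le> K * norm u"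
        by (intro onorm_bound) (auto simp: K_def)
    qed
    moreover have "m (u + a, a) = u + a" using unit(1) inb[OF ub a0] r by blast
    ultimately show ?thesis using inb[OF ub vb] r by (auto simp: algebra_simps)
  qed
  then show thesis using that[of "r / 2" K] r by (auto simp: K_def)
qed

section \<open>Charts and the multiplication in charts\<close>

lemma frechet_smooth_on_cong:
  fixes f g :: "'a::real_normed_vector \<Rightarrow> 'b::real_normed_vector"
  assumes "frechet_smooth_on S f" "\<And>x. x \<in> S \<Longrightarrow> f x = g x"
  shows "frechet_smooth_on S g"
proof -
  have "(\<forall>x\<in>S. D 0 x [] = f x) \<longleftrightarrow> (\<forall>x\<in>S. D 0 x [] = g x)" for D :: "nat \<Rightarrow> 'a \<Rightarrow> 'a list \<Rightarrow> 'b"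
    using assms(2) by auto
  then show ?thesis using assms(1) unfolding frechet_smooth_on_def by simp
qed

lemma banach_manifold_chart:
  assumes "banach_manifold M" "(U, \<phi>) \<in> atlas M"
  shows "openin (mtop M) U" "open (\<phi> ` U)" "inj_on \<phi> U"
    "continuous_map (subtopology (mtop M) U) euclidean \<phi>"
    "continuous_map (top_of_set (\<phi> ` U)) (mtop M) (inv_into U \<phi>)"
proof -
  have *: "openin (mtop M) U" "open (\<phi> ` U)" "homeomorphic_map (subtopology (mtop M) U) (top_of_set (\<phi> ` U)) \<phi>"
    using assms unfolding banach_manifold_def by fastforce+
  show "openin (mtop M) U" "open (\<phi> ` U)" by fact+
  have U: "topspace (subtopology (mtop M) U) = U" using * openin_subset by fastforce
  show inj: "inj_on \<phi> U" using homeomorphic_imp_injective_map[OF *(3)] U by simp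
  show "continuous_map (subtopology (mtop M) U) euclidean \<phi>"
    using homeomorphic_imp_continuous_map[OF *(3)] continuous_map_into_fulltopology by blast
  obtain g where g: "homeomorphic_maps (subtopology (mtop M) U) (top_of_set (\<phi> ` U)) \<phi> g"
    using *(3) homeomorphic_map_maps by blast
  have "continuous_map (top_of_set (\<phi> ` U)) (mtop M) g"
    using g continuous_map_into_fulltopology unfolding homeomorphic_maps_def by blast
  moreover have "g z = inv_into U \<phi> z" if "z \<in> topspace (top_of_set (\<phi> ` U))" for z
    using g that U inj by (auto simp: homeomorphic_maps_def)
  ultimately show "continuous_map (top_of_set (\<phi> ` U)) (mtop M) (inv_into U \<phi>)"
    by (rule continuous_map_eq)
qed

lemma inv_into_map_prod:
  assumes "inj_on f A" "inj_on g B" "a \<in> A" "b \<in> B"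
  shows "inv_into (A \<times> B) (map_prod f g) (f a, g b) = (a, b)"
  using inv_into_f_f[OF map_prod_inj_on[OF assms(1,2)], of "(a, b)"] assms by simp

lemma smooth_mapD:
  assumes "smooth_map M M' f" "(U, \<phi>) \<in> atlas M" "(V, \<psi>) \<in> atlas M'"
  shows "frechet_smooth_on (\<phi> ` {p \<in> U. f p \<in> V}) (\<psi> \<circ> f \<circ> inv_into U \<phi>)"
proof -
  have "\<forall>(U, \<phi>)\<in>atlas M. \<forall>(V, \<psi>)\<in>atlas M'. frechet_smooth_on (\<phi> ` {p \<in> U. f p \<in> V}) (\<psi> \<circ> f \<circ> inv_into U \<phi>)"
    using assms(1) unfolding smooth_map_def by (rule conjunct2)
  from bspec[OF this assms(2)]
  have "\<forall>(V, \<psi>)\<in>atlas M'. frechet_smooth_on (\<phi> ` {p \<in> U. f p \<in> V}) (\<psi> \<circ> f \<circ> inv_into U \<phi>)"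
    by (simp only: prod.case)
  from bspec[OF this assms(3)] show ?thesis by (simp only: prod.case)
qed

lemma lie_group_mult_smooth:
  assumes lie: "banach_lie_group N"
    and c: "(V1, \<psi>1) \<in> atlas (mfd N)" "(V2, \<psi>2) \<in> atlas (mfd N)" "(V3, \<psi>3) \<in> atlas (mfd N)"
  shows "frechet_smooth_on (map_prod \<psi>1 \<psi>2 ` {p \<in> V1 \<times> V2. fst p \<otimes>\<^bsub>N\<^esub> snd p \<in> V3})
    (\<lambda>z. \<psi>3 (inv_into V1 \<psi>1 (fst z) \<otimes>\<^bsub>N\<^esub> inv_into V2 \<psi>2 (snd z)))"
proof -
  have M: "banach_manifold (mfd N)" using lie by (simp add: banach_lie_group_def)
  have "smooth_map (prod_manifold (mfd N) (mfd N)) (mfd N) (\<lambda>(x, y). x \<otimes>\<^bsub>N\<^esub> y)"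
    using lie by (simp add: banach_lie_group_def)
  moreover have "(V1 \<times> V2, map_prod \<psi>1 \<psi>2) \<in> atlas (prod_manifold (mfd N) (mfd N))"
    unfolding prod_manifold_def using c(1,2) by (force intro!: image_eqI[of _ _ "((V1, \<psi>1), (V2, \<psi>2))"])
  ultimately have "frechet_smooth_on (map_prod \<psi>1 \<psi>2 ` {p \<in> V1 \<times> V2. (\<lambda>(x, y). x \<otimes>\<^bsub>N\<^esub> y) p \<in> V3})
      (\<psi>3 \<circ> (\<lambda>(x, y). x \<otimes>\<^bsub>N\<^esub> y) \<circ> inv_into (V1 \<times> V2) (map_prod \<psi>1 \<psi>2))"
    using c(3) by (rule smooth_mapD)
  moreover have "{p \<in> V1 \<times> V2. (\<lambda>(x, y). x \<otimes>\<^bsub>N\<^esub> y) p \<in> V3} = {p \<in> V1 \<times> V2. fst p \<otimes>\<^bsub>N\<^esub> snd p \<in> V3}" by auto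
  ultimately show ?thesis
    using banach_manifold_chart(3)[OF M c(1)] banach_manifold_chart(3)[OF M c(2)]
    by (auto elim!: frechet_smooth_on_cong simp: inv_into_map_prod)
qed

section \<open>Banach--Lie groups\<close>

locale lie_chart =
  fixes N :: "('n, 'e::banach) manifold_group" (structure) and U :: "'n set" and \<phi> :: "'n \<Rightarrow> 'e"
  assumes lie: "banach_lie_group N" and chart: "(U, \<phi>) \<in> atlas (mfd N)" and one_U: "\<one> \<in> U"
begin

definition lg :: "'n \<Rightarrow> 'e" where "lg p = \<phi> p - \<phi> \<one>"

definition ex :: "'e \<Rightarrow> 'n" where "ex u = inv_into U \<phi> (u + \<phi> \<one>)"

abbreviation T where "T \<equiv> mtop (mfd N)"

lemma manifold: "banach_manifold (mfd N)"
  using lie by (simp add: banach_lie_group_def)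

lemma topspace_T: "topspace T = carrier N"
  using lie by (simp add: banach_lie_group_def)

lemma atlas_cover: "p \<in> carrier N \<Longrightarrow> \<exists>V \<psi>. (V, \<psi>) \<in> atlas (mfd N) \<and> p \<in> V"
proof -
  assume "p \<in> carrier N"
  moreover have "(\<Union>(U, \<phi>)\<in>atlas (mfd N). U) = topspace T"
    using manifold unfolding banach_manifold_def by (elim conjE)
  ultimately have "p \<in> (\<Union>(U, \<phi>)\<in>atlas (mfd N). U)" using topspace_T by simp
  then show ?thesis by auto
qed

lemma atlas_carrier: "(V, \<psi>) \<in> atlas (mfd N) \<Longrightarrow> p \<in> V \<Longrightarrow> p \<in> carrier N"
  using banach_manifold_chart(1)[OF manifold] openin_subset topspace_T by blast

text \<open>In the chart the unit laws say that the multiplication is the identity in each argument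
  when the other one is at the base point, as \<open>unital_product_estimate\<close> requires. Its
  radius and constant become those of the locale.\<close>

lemma chart_group_exists: "\<exists>R C. chart_group N T lg ex U R C"
proof -
  interpret group N using lie by (simp add: banach_lie_group_def)
  note ch = banach_manifold_chart[OF manifold chart]
  define S where "S = map_prod \<phi> \<phi> ` {p \<in> U \<times> U. fst p \<otimes> snd p \<in> U}"
  define m where "m z = \<phi> (inv_into U \<phi> (fst z) \<otimes> inv_into U \<phi> (snd z))" for z
  have sm: "frechet_smooth_on S m"
    unfolding S_def m_def[abs_def] by (rule lie_group_mult_smooth[OF lie chart chart chart])
  have inv\<phi>: "inv_into U \<phi> (\<phi> p) = p" if "p \<in> U" for p using that ch(3) by simp
  have UN: "p \<in> carrier N" if "p \<in> U" for p using atlas_carrier[OF chart that] .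
  have SU: "(u, v) \<in> S \<longleftrightarrow> u \<in> \<phi> ` U \<and> v \<in> \<phi> ` U \<and> inv_into U \<phi> u \<otimes> inv_into U \<phi> v \<in> U" for u v
    unfolding S_def using inv\<phi> by (force simp: map_prod_def image_iff)
  have 1: "(\<phi> \<one>, \<phi> \<one>) \<in> S" unfolding SU using one_U by (simp add: inv\<phi>)
  have 2: "m (u, \<phi> \<one>) = u" if "(u, \<phi> \<one>) \<in> S" for u
    using that one_U UN by (auto simp: SU m_def inv\<phi>)
  have 3: "m (\<phi> \<one>, v) = v" if "(\<phi> \<one>, v) \<in> S" for v
    using that one_U UN by (auto simp: SU m_def inv\<phi>)
  obtain r K where r: "0 < r" "0 < K" "\<And>u v. norm u < r \<Longrightarrow> norm v < r \<Longrightarrow>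
     (u + \<phi> \<one>, v + \<phi> \<one>) \<in> S \<and> norm (m (u + \<phi> \<one>, v + \<phi> \<one>) - \<phi> \<one> - u - v) \<le> K * norm u * norm v"
    using unital_product_estimate[OF sm 1 2 3] by metis
  have im: "u + \<phi> \<one> \<in> \<phi> ` U" if "norm u < r" for u
    using r(3)[OF that, of 0] r(1) by (simp add: SU)
  have "chart_group N T lg ex U r K"
  proof unfold_locales
    show "topspace T = carrier N" by (rule topspace_T)
    show "continuous_map (prod_topology T T) T (\<lambda>(x, y). x \<otimes> y)" "continuous_map T T (\<lambda>x. inv x)"
      using lie by (auto simp: banach_lie_group_def smooth_map_def prod_manifold_def)
    show "openin T U" "\<one> \<in> U" by (fact ch one_U)+
    show "lg \<one> = 0" by (simp add: lg_def)
    show "continuous_map (subtopology T U) euclidean lg"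
      unfolding lg_def[abs_def] using ch(4) by (intro continuous_map_diff) auto
    show "0 < r" "0 < K" by (fact r)+
    show "ex u \<in> U" if "norm u < r" for u
      unfolding ex_def using im[OF that] by (rule inv_into_into)
    show "lg (ex u) = u" if "norm u < r" for u
      unfolding ex_def lg_def using im[OF that] by (simp add: f_inv_into_f)
    show "ex (lg p) = p" if "p \<in> U" for p using that by (simp add: ex_def lg_def inv\<phi>)
    have "continuous_map (top_of_set (ball 0 r)) (top_of_set (\<phi> ` U)) (\<lambda>u. u + \<phi> \<one>)"
      using im by (auto simp: continuous_map_in_subtopology intro!: continuous_intros)
    from continuous_map_compose[OF this ch(5)]
    show "continuous_map (top_of_set (ball 0 r)) T ex" by (simp add: ex_def[abs_def] o_def)
    fix p q assume pq: "p \<in> U" "q \<in> U" "norm (lg p) < r" "norm (lg q) < r"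
    have "lg p + \<phi> \<one> = \<phi> p" "lg q + \<phi> \<one> = \<phi> q" by (auto simp: lg_def)
    with r(3)[OF pq(3,4)] have *: "(\<phi> p, \<phi> q) \<in> S" "norm (m (\<phi> p, \<phi> q) - \<phi> \<one> - lg p - lg q) \<le> K * norm (lg p) * norm (lg q)"
      by auto
    then show "p \<otimes> q \<in> U" using pq by (simp add: SU inv\<phi>)
    show "norm (lg (p \<otimes> q) - lg p - lg q) \<le> K * norm (lg p) * norm (lg q)"
      using * pq by (simp add: m_def inv\<phi> lg_def)
  qed
  then show ?thesis by blast
qed

text \<open>A sublocale needs its parameters as terms, so radius and constant are chosen together
  once and for all.\<close>

definition RC :: "real \<times> real" where "RC = (SOME z. chart_group N T lg ex U (fst z) (snd z))"

sublocale chart_group N T lg ex U "fst RC" "snd RC"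
proof -
  obtain R C where "chart_group N T lg ex U R C" using chart_group_exists by (elim exE)
  then have "chart_group N T lg ex U (fst (R, C)) (snd (R, C))" by simp
  then show "chart_group N T lg ex U (fst RC) (snd RC)"
    unfolding RC_def by (rule someI[where P = "\<lambda>z. chart_group N T lg ex U (fst z) (snd z)"])
qed

section \<open>Left translation of tangent vectors\<close>

text \<open>The tangent map at the identity of left translation by \<open>g\<close>, read in the
  fixed chart \<open>\<phi>\<close> at the identity and a chart \<open>\<psi>\<close> around
  \<open>g\<close>.\<close>

definition tr :: "('n \<Rightarrow> 'e) \<Rightarrow> 'n \<Rightarrow> 'e \<Rightarrow> 'e" where
  "tr \<psi> g = frechet_derivative (\<lambda>u. \<psi> (g \<otimes> inv_into U \<phi> u)) (at (\<phi> \<one>))"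

lemma chart_product_open:
  assumes "(V1, \<psi>1) \<in> atlas (mfd N)" "(V2, \<psi>2) \<in> atlas (mfd N)"
    and "p \<in> V1" "q \<in> V2" "p \<otimes> q \<in> V3"
  shows "(\<psi>1 p, \<psi>2 q) \<in> map_prod \<psi>1 \<psi>2 ` {p \<in> V1 \<times> V2. fst p \<otimes> snd p \<in> V3}"
  using assms by (intro image_eqI[of _ _ "(p, q)"]) auto

lemma left_mult_differentiable:
  assumes g: "g \<in> carrier N" and V: "(V, \<psi>) \<in> atlas (mfd N)" "p \<in> V"
    and W: "(W, \<omega>) \<in> atlas (mfd N)" "g \<otimes> p \<in> W"
  shows "(\<lambda>z. \<omega> (g \<otimes> inv_into V \<psi> z)) differentiable (at (\<psi> p))"
proof -
  obtain V0 \<psi>0 where V0: "(V0, \<psi>0) \<in> atlas (mfd N)" "g \<in> V0" using atlas_cover[OF g] by blast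
  define F where "F z = \<omega> (inv_into V0 \<psi>0 (fst z) \<otimes> inv_into V \<psi> (snd z))" for z
  obtain F' where "C11_derivative (map_prod \<psi>0 \<psi> ` {p \<in> V0 \<times> V. fst p \<otimes> snd p \<in> W}) F F'"
    using frechet_smooth_derivative[OF lie_group_mult_smooth[OF lie V0(1) V(1) W(1)]]
    unfolding F_def[abs_def] by blast
  then have "(F has_derivative F' (\<psi>0 g, \<psi> p)) (at (\<psi>0 g, \<psi> p))"
    by (rule C11_derivativeD(1)) (rule chart_product_open[OF V0(1) V(1) V0(2) V(2) W(2)])
  then have "((\<lambda>z. F (\<psi>0 g, z)) has_derivative (\<lambda>w. F' (\<psi>0 g, \<psi> p) (0, w))) (at (\<psi> p))"
    by (intro has_derivative_compose[where f = "\<lambda>v. (\<psi>0 g, v)" and g = F and f' = "\<lambda>w. (0, w)"])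
      (auto intro!: derivative_eq_intros)
  moreover have "F (\<psi>0 g, z) = \<omega> (g \<otimes> inv_into V \<psi> z)" for z
    using V0 banach_manifold_chart(3)[OF manifold V0(1)] by (simp add: F_def)
  ultimately show ?thesis unfolding differentiable_def by auto
qed

lemma tr_derivative:
  assumes "(V, \<psi>) \<in> atlas (mfd N)" "g \<in> V"
  shows "((\<lambda>u. \<psi> (g \<otimes> inv_into U \<phi> u)) has_derivative tr \<psi> g) (at (\<phi> \<one>))"
proof -
  have "g \<in> carrier N" using atlas_carrier assms by blast
  then show ?thesis unfolding tr_def
    using left_mult_differentiable[OF _ chart one_U assms(1), of g] assms(2)
    by (simp add: frechet_derivative_works[symmetric])
qed

lemma tr_derivative_ex:
  assumes "(V, \<psi>) \<in> atlas (mfd N)" "g \<in> V"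
  shows "((\<lambda>u. \<psi> (g \<otimes> ex u)) has_derivative tr \<psi> g) (at 0)"
  unfolding ex_def
  by (rule has_derivative_compose[where f = "\<lambda>u. u + \<phi> \<one>" and f' = "\<lambda>u. u"])
    (use tr_derivative[OF assms] in \<open>auto intro!: derivative_eq_intros\<close>)

text \<open>Supplies the continuous derivative demanded by \<open>C1_curve\<close>. In charts,
  \<open>tr \<psi> g\<close> is a partial derivative of the jointly smooth multiplication, so it
  depends on \<open>g\<close> in a locally Lipschitz way.\<close>

lemma tr_continuous:
  assumes V: "(V, \<psi>) \<in> atlas (mfd N)" and \<nu>: "continuous_map (top_of_set I) T \<nu>"
    and x: "continuous_on I x"
  shows "continuous_on {t \<in> I. \<nu> t \<in> V} (\<lambda>t. tr \<psi> (\<nu> t) (x t))"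
  unfolding continuous_on_def
proof
  fix t assume t: "t \<in> {t \<in> I. \<nu> t \<in> V}"
  define J where "J = {t \<in> I. \<nu> t \<in> V}"
  define S where "S = map_prod \<psi> \<phi> ` {p \<in> V \<times> U. fst p \<otimes> snd p \<in> V}"
  define F where "F z = \<psi> (inv_into V \<psi> (fst z) \<otimes> inv_into U \<phi> (snd z))" for z
  obtain F' where F': "C11_derivative S F F'"
    using frechet_smooth_derivative[OF lie_group_mult_smooth[OF lie V chart V]]
    unfolding F_def[abs_def] S_def by blast
  have inS: "(\<psi> g, \<phi> \<one>) \<in> S" if "g \<in> V" for g
    unfolding S_def using that one_U atlas_carrier[OF V that] by (intro chart_product_open[OF V chart]) auto
  have tr: "tr \<psi> g w = F' (\<psi> g, \<phi> \<one>) (0, w)" if g: "g \<in> V" for g w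
  proof -
    have "(F has_derivative F' (\<psi> g, \<phi> \<one>)) (at (\<psi> g, \<phi> \<one>))"
      by (rule C11_derivativeD(1)[OF F' inS[OF g]])
    then have "((\<lambda>z. F (\<psi> g, z)) has_derivative (\<lambda>w. F' (\<psi> g, \<phi> \<one>) (0, w))) (at (\<phi> \<one>))"
      by (intro has_derivative_compose[where f = "\<lambda>v. (\<psi> g, v)" and g = F and f' = "\<lambda>w. (0, w)"])
        (auto intro!: derivative_eq_intros)
    moreover have "(\<lambda>z. F (\<psi> g, z)) = (\<lambda>z. \<psi> (g \<otimes> inv_into U \<phi> z))"
      using g banach_manifold_chart(3)[OF manifold V] by (simp add: F_def)
    ultimately show ?thesis using has_derivative_unique[OF tr_derivative[OF V g]] by metis
  qed
  have tV: "\<nu> t \<in> V" "t \<in> J" using t by (auto simp: J_def)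
  obtain r K where r: "0 < r" and K: "\<And>y z v. y \<in> ball (\<psi> (\<nu> t), \<phi> \<one>) r \<Longrightarrow> z \<in> ball (\<psi> (\<nu> t), \<phi> \<one>) r \<Longrightarrow>
     norm (F' y v - F' z v) \<le> K * norm (y - z) * norm v"
    using C11_derivativeD(2)[OF F' inS[OF tV(1)]] by blast
  have bl: "bounded_linear (F' (\<psi> (\<nu> t), \<phi> \<one>))"
    using C11_derivativeD(1)[OF F' inS[OF tV(1)]] by (rule has_derivative_bounded_linear)
  have "continuous_map (subtopology (top_of_set I) J) (subtopology T V) \<nu>"
    using \<nu> by (auto simp: continuous_map_in_subtopology continuous_map_from_subtopology J_def)
  from continuous_map_compose[OF this banach_manifold_chart(4)[OF manifold V]]
  have "continuous_map (subtopology (top_of_set I) J) euclidean (\<psi> \<circ> \<nu>)" .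
  moreover have "subtopology (top_of_set I) J = top_of_set J"
    by (simp add: subtopology_subtopology J_def Int_absorb1 Collect_restrict)
  ultimately have "continuous_on J (\<lambda>s. \<psi> (\<nu> s))" by (simp add: o_def)
  then have z: "((\<lambda>s. \<psi> (\<nu> s)) \<longlongrightarrow> \<psi> (\<nu> t)) (at t within J)" using tV by (simp add: continuous_on_def)
  have xl: "(x \<longlongrightarrow> x t) (at t within J)"
    using continuous_on_subset[OF x, of J] tV by (auto simp: J_def continuous_on_def)
  have zz: "((\<lambda>s. norm ((\<psi> (\<nu> s), \<phi> \<one>) - (\<psi> (\<nu> t), \<phi> \<one>))) \<longlongrightarrow> 0) (at t within J)"
    using tendsto_norm_zero[OF LIM_zero[OF z]] by (simp add: norm_Pair)
  have "((\<lambda>s. K * norm ((\<psi> (\<nu> s), \<phi> \<one>) - (\<psi> (\<nu> t), \<phi> \<one>)) * norm (0::'e, x s)) \<longlongrightarrow> K * 0 * norm (0::'e, x t)) (at t within J)"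
    by (intro tendsto_intros zz xl)
  then have lim0: "((\<lambda>s. K * norm ((\<psi> (\<nu> s), \<phi> \<one>) - (\<psi> (\<nu> t), \<phi> \<one>)) * norm (0::'e, x s)) \<longlongrightarrow> 0) (at t within J)"
    by simp
  have "((\<lambda>s. F' (\<psi> (\<nu> s), \<phi> \<one>) (0, x s) - F' (\<psi> (\<nu> t), \<phi> \<one>) (0, x s)) \<longlongrightarrow> 0) (at t within J)"
  proof (rule Lim_null_comparison[OF _ lim0])
    have "\<forall>\<^sub>F s in at t within J. norm ((\<psi> (\<nu> s), \<phi> \<one>) - (\<psi> (\<nu> t), \<phi> \<one>)) < r"
      using order_tendstoD(2)[OF zz r] .
    then show "\<forall>\<^sub>F s in at t within J. norm (F' (\<psi> (\<nu> s), \<phi> \<one>) (0, x s) - F' (\<psi> (\<nu> t), \<phi> \<one>) (0, x s))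
      \<le> K * norm ((\<psi> (\<nu> s), \<phi> \<one>) - (\<psi> (\<nu> t), \<phi> \<one>)) * norm (0::'e, x s)"
    proof eventually_elim
      case (elim s)
      show ?case using r elim by (intro K) (auto simp: dist_norm norm_minus_commute)
    qed
  qed
  moreover have "((\<lambda>s. F' (\<psi> (\<nu> t), \<phi> \<one>) (0, x s)) \<longlongrightarrow> F' (\<psi> (\<nu> t), \<phi> \<one>) (0, x t)) (at t within J)"
    by (intro bounded_linear.tendsto[OF bl] tendsto_intros xl)
  ultimately have "((\<lambda>s. (F' (\<psi> (\<nu> s), \<phi> \<one>) (0, x s) - F' (\<psi> (\<nu> t), \<phi> \<one>) (0, x s)) + F' (\<psi> (\<nu> t), \<phi> \<one>) (0, x s))
     \<longlongrightarrow> 0 + F' (\<psi> (\<nu> t), \<phi> \<one>) (0, x t)) (at t within J)"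
    by (rule tendsto_add)
  then have "((\<lambda>s. F' (\<psi> (\<nu> s), \<phi> \<one>) (0, x s)) \<longlongrightarrow> F' (\<psi> (\<nu> t), \<phi> \<one>) (0, x t)) (at t within J)" by simp
  then have "((\<lambda>s. tr \<psi> (\<nu> s) (x s)) \<longlongrightarrow> F' (\<psi> (\<nu> t), \<phi> \<one>) (0, x t)) (at t within J)"
    by (rule Lim_transform_eventually) (auto simp: tr J_def eventually_at_topological intro!: exI[of _ UNIV])
  then show "((\<lambda>s. tr \<psi> (\<nu> s) (x s)) \<longlongrightarrow> tr \<psi> (\<nu> t) (x t)) (at t within {t \<in> I. \<nu> t \<in> V})"
    using tV by (simp add: tr J_def)
qed

text \<open>The bridge between velocities in arbitrary charts and logarithmic derivatives in the
  chart at the identity. From right to left it is the chain rule for \<nu>(s) = n ex(lg(n^-1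
  \<nu>(s))) with n = \<nu>(t). For the converse, left translation by n^-1 provides a left inverse
  \<open>B\<close> of \<open>tr\<close>.\<close>

lemma chart_velocity_iff:
  assumes V: "(V, \<psi>) \<in> atlas (mfd N)" and \<nu>: "continuous_map (top_of_set I) T \<nu>"
    and t: "(t::real) \<in> I" "\<nu> t \<in> V"
  shows "((\<psi> \<circ> \<nu>) has_vector_derivative tr \<psi> (\<nu> t) v) (at t within I) \<longleftrightarrow>
     ((\<lambda>s. lg (inv (\<nu> t) \<otimes> \<nu> s)) has_vector_derivative v) (at t within I)"
proof
  have c: "\<nu> s \<in> carrier N" if "s \<in> I" for s
    using \<nu> that topspace by (auto simp: continuous_map_def Pi_iff)
  let ?n = "\<nu> t"
  have n: "?n \<in> carrier N" using c t by blast
  have linT: "linear (tr \<psi> ?n)" using tr_derivative[OF V t(2)] has_derivative_linear by blast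
  {
    assume d: "((\<lambda>s. lg (inv ?n \<otimes> \<nu> s)) has_vector_derivative v) (at t within I)"
    have "((\<lambda>s. \<psi> (?n \<otimes> ex (lg (inv ?n \<otimes> \<nu> s)))) has_derivative (\<lambda>h. tr \<psi> ?n (h *\<^sub>R v))) (at t within I)"
      using has_derivative_compose[OF d[unfolded has_vector_derivative_def], of "\<lambda>u. \<psi> (?n \<otimes> ex u)" "tr \<psi> ?n"]
        tr_derivative_ex[OF V t(2)] n by (simp add: lg_one)
    then have "((\<lambda>s. \<psi> (?n \<otimes> ex (lg (inv ?n \<otimes> \<nu> s)))) has_vector_derivative tr \<psi> ?n v) (at t within I)"
      by (simp add: has_vector_derivative_def linear_scale[OF linT])
    moreover have ev: "\<forall>\<^sub>F s in at t within I. \<psi> (?n \<otimes> ex (lg (inv ?n \<otimes> \<nu> s))) = (\<psi> \<circ> \<nu>) s"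
    proof -
      have "\<forall>\<^sub>F s in at t within I. s \<in> I" by (auto simp: eventually_at_topological intro!: exI[of _ UNIV])
      with continuous_map_nbhd[OF \<nu> t(1) R_pos] show ?thesis
      proof eventually_elim
        case (elim s)
        then have "ex (lg (inv ?n \<otimes> \<nu> s)) = inv ?n \<otimes> \<nu> s" using D_dom ex_lg by blast
        then show ?case using n c elim(2) by (simp add: m_assoc[symmetric])
      qed
    qed
    ultimately show "((\<psi> \<circ> \<nu>) has_vector_derivative tr \<psi> ?n v) (at t within I)"
      unfolding has_vector_derivative_def
      using n one_dom by (elim has_derivative_transform_eventually) (use t ex_lg[OF one_dom] in \<open>auto\<close>)
  }
  {
    assume d: "((\<psi> \<circ> \<nu>) has_vector_derivative tr \<psi> ?n v) (at t within I)"
    define B where "B = frechet_derivative (\<lambda>z. \<phi> (inv ?n \<otimes> inv_into V \<psi> z)) (at (\<psi> ?n))"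
    have B: "((\<lambda>z. \<phi> (inv ?n \<otimes> inv_into V \<psi> z)) has_derivative B) (at (\<psi> ?n))"
      unfolding B_def using left_mult_differentiable[OF inv_closed[OF n] V t(2) chart] n one_U
      by (simp add: frechet_derivative_works[symmetric])
    note injV = banach_manifold_chart(3)[OF manifold V]
    \<comment> \<open>Near 0 the composite u -> \<phi>(n^-1 (n ex(u))) is a mere shift, so its
      derivative is the identity.\<close>
    have BT: "B (tr \<psi> ?n w) = w" for w
    proof -
      have z0: "\<psi> (?n \<otimes> ex 0) = \<psi> ?n" using n by (simp add: ex_0)
      have "((\<lambda>u. \<phi> (inv ?n \<otimes> inv_into V \<psi> (\<psi> (?n \<otimes> ex u)))) has_derivative (\<lambda>w. B (tr \<psi> ?n w))) (at 0)"
        using has_derivative_compose[OF tr_derivative_ex[OF V t(2)], of "\<lambda>z. \<phi> (inv ?n \<otimes> inv_into V \<psi> z)" B] B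
        unfolding z0 by simp
      moreover have "((\<lambda>u. \<phi> (inv ?n \<otimes> inv_into V \<psi> (\<psi> (?n \<otimes> ex u)))) has_derivative (\<lambda>w. w)) (at 0)"
      proof -
        have "openin T {p \<in> topspace T. ?n \<otimes> p \<in> V}"
          using continuous_left[OF n] banach_manifold_chart(1)[OF manifold V] by (rule openin_continuous_map_preimage)
        then obtain \<rho> where \<rho>: "0 < \<rho>" "\<rho> \<le> fst RC" "D \<rho> \<subseteq> {p \<in> topspace T. ?n \<otimes> p \<in> V}"
          using nbhd_D[of "{p \<in> topspace T. ?n \<otimes> p \<in> V}"] t n topspace by auto
        show ?thesis
        proof (rule has_derivative_transform_within_open[OF _ open_ball])
          show "(0::'e) \<in> ball 0 \<rho>" using \<rho> by simp
          show "((\<lambda>u. u + \<phi> \<one>) has_derivative (\<lambda>w. w)) (at 0)" by (auto intro!: derivative_eq_intros)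
          fix u :: 'e assume "u \<in> ball 0 \<rho>"
          then have u: "norm u < \<rho>" "norm u < fst RC" using \<rho> by auto
          then have exD: "ex u \<in> D \<rho>" by (rule ex_D)
          then have "?n \<otimes> ex u \<in> V" using \<rho>(3) by blast
          then have "inv_into V \<psi> (\<psi> (?n \<otimes> ex u)) = ?n \<otimes> ex u" using injV by simp
          moreover have "inv ?n \<otimes> (?n \<otimes> ex u) = ex u" using n D_carrier[OF exD] by (simp add: m_assoc[symmetric])
          moreover have "\<phi> (ex u) = u + \<phi> \<one>" using lg_ex[OF u(2)] by (simp add: lg_def algebra_simps)
          ultimately show "u + \<phi> \<one> = \<phi> (inv ?n \<otimes> inv_into V \<psi> (\<psi> (?n \<otimes> ex u)))" by simp
        qed
      qed
      ultimately show ?thesis using has_derivative_unique by metis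
    qed
    have linB: "linear B" using B has_derivative_linear by blast
    have "((\<lambda>s. \<phi> (inv ?n \<otimes> inv_into V \<psi> ((\<psi> \<circ> \<nu>) s))) has_derivative (\<lambda>h. B (h *\<^sub>R tr \<psi> ?n v))) (at t within I)"
      using has_derivative_compose[OF d[unfolded has_vector_derivative_def], of "\<lambda>z. \<phi> (inv ?n \<otimes> inv_into V \<psi> z)" B] B
      by simp
    then have "((\<lambda>s. \<phi> (inv ?n \<otimes> inv_into V \<psi> ((\<psi> \<circ> \<nu>) s)) - \<phi> \<one>) has_derivative (\<lambda>h. h *\<^sub>R v)) (at t within I)"
      by (auto intro!: derivative_eq_intros simp: linear_scale[OF linB] BT)
    moreover have "\<forall>\<^sub>F s in at t within I. \<phi> (inv ?n \<otimes> inv_into V \<psi> ((\<psi> \<circ> \<nu>) s)) - \<phi> \<one> = lg (inv ?n \<otimes> \<nu> s)"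
    proof -
      have "openin (top_of_set I) {s \<in> topspace (top_of_set I). \<nu> s \<in> V}"
        using \<nu> banach_manifold_chart(1)[OF manifold V] by (rule openin_continuous_map_preimage)
      then obtain O' where O': "open O'" "{s \<in> I. \<nu> s \<in> V} = I \<inter> O'" by (auto simp: openin_open)
      have "t \<in> O'" using O' t by auto
      then have "\<forall>\<^sub>F s in at t within I. \<nu> s \<in> V"
        unfolding eventually_at_topological using O' by blast
      then show ?thesis by eventually_elim (use injV in \<open>simp add: lg_def\<close>)
    qed
    ultimately show "((\<lambda>s. lg (inv ?n \<otimes> \<nu> s)) has_vector_derivative v) (at t within I)"
      unfolding has_vector_derivative_def
      by (elim has_derivative_transform_eventually) (use t injV in \<open>auto simp: lg_def\<close>)
  }
qed

end

section \<open>The semidirect product\<close>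

text \<open>The chart at the identity is the one selected by \<open>tangent_map\<close> in \<open>left_translate\<close>, so that a tangent
  vector \<open>x\<close> enters only through its value at this chart.\<close>

locale semidirect =
  NN: lie_chart N U \<phi> + GG: lie_chart G V \<psi>
  for N :: "('n, 'e::banach) manifold_group" and U :: "'n set" and \<phi> :: "'n \<Rightarrow> 'e"
    and G :: "('g, 'f::banach) manifold_group" and V :: "'g set" and \<psi> :: "'g \<Rightarrow> 'f" +
  fixes \<pi> :: "'g \<Rightarrow> 'n \<Rightarrow> 'n"
  assumes \<pi>_hom: "\<pi> \<in> hom G (lie_Aut N)"
    and \<pi>_cont: "continuous_map (prod_topology (mtop (mfd G)) (mtop (mfd N))) (mtop (mfd N)) (\<lambda>(g, n). \<pi> g n)"
    and base: "(SOME c. c \<in> charts_at (prod_manifold (mfd N) (mfd G)) (\<one>\<^bsub>N\<^esub>, \<one>\<^bsub>G\<^esub>)) = (U \<times> V, map_prod \<phi> \<psi>)"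
begin

section \<open>Group structure of the semidirect product\<close>

abbreviation H where "H \<equiv> semidirect_product N G \<pi>"

abbreviation c0 where "c0 \<equiv> (U \<times> V, map_prod \<phi> \<psi>)"

lemma H_simps [simp]: "carrier H = carrier N \<times> carrier G"
  "(n, g) \<otimes>\<^bsub>H\<^esub> (n', g') = (n \<otimes>\<^bsub>N\<^esub> \<pi> g n', g \<otimes>\<^bsub>G\<^esub> g')"
  "\<one>\<^bsub>H\<^esub> = (\<one>\<^bsub>N\<^esub>, \<one>\<^bsub>G\<^esub>)" "mfd H = prod_manifold (mfd N) (mfd G)"
  by (simp_all add: semidirect_product_def)

lemma \<pi>_auto: "g \<in> carrier G \<Longrightarrow> \<pi> g \<in> hom N N \<inter> Bij (carrier N)"
  and \<pi>_smooth: "g \<in> carrier G \<Longrightarrow> smooth_map (mfd N) (mfd N) (\<pi> g)"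
proof -
  assume "g \<in> carrier G"
  then have "\<pi> g \<in> carrier (lie_Aut N)" using \<pi>_hom by (auto simp: hom_def)
  then show "\<pi> g \<in> hom N N \<inter> Bij (carrier N)" "smooth_map (mfd N) (mfd N) (\<pi> g)"
    by (auto simp: lie_Aut_def auto_def)
qed

lemma \<pi>_closed [simp]: "g \<in> carrier G \<Longrightarrow> n \<in> carrier N \<Longrightarrow> \<pi> g n \<in> carrier N"
  using \<pi>_auto by (auto simp: hom_def)

lemma \<pi>_mult: "g \<in> carrier G \<Longrightarrow> n \<in> carrier N \<Longrightarrow> n' \<in> carrier N \<Longrightarrow> \<pi> g (n \<otimes>\<^bsub>N\<^esub> n') = \<pi> g n \<otimes>\<^bsub>N\<^esub> \<pi> g n'"
  using \<pi>_auto by (auto simp: hom_def)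

lemma \<pi>_one [simp]: "g \<in> carrier G \<Longrightarrow> \<pi> g \<one>\<^bsub>N\<^esub> = \<one>\<^bsub>N\<^esub>"
  using hom_one[OF _ NN.is_group NN.is_group] \<pi>_auto by blast

lemma \<pi>_comp: "g \<in> carrier G \<Longrightarrow> g' \<in> carrier G \<Longrightarrow> n \<in> carrier N \<Longrightarrow> \<pi> (g \<otimes>\<^bsub>G\<^esub> g') n = \<pi> g (\<pi> g' n)"
proof -
  assume *: "g \<in> carrier G" "g' \<in> carrier G" "n \<in> carrier N"
  then have "\<pi> (g \<otimes>\<^bsub>G\<^esub> g') = \<pi> g \<otimes>\<^bsub>lie_Aut N\<^esub> \<pi> g'" using \<pi>_hom by (simp add: hom_def)
  then show ?thesis using * \<pi>_auto by (simp add: lie_Aut_def BijGroup_def compose_def)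
qed

text \<open>By multiplicativity the map is idempotent, and it is injective on the carrier. This
  spares a proof that \<open>lie_Aut N\<close> is a group.\<close>

lemma \<pi>_id [simp]: "n \<in> carrier N \<Longrightarrow> \<pi> \<one>\<^bsub>G\<^esub> n = n"
proof -
  assume n: "n \<in> carrier N"
  have "inj_on (\<pi> \<one>\<^bsub>G\<^esub>) (carrier N)" using \<pi>_auto[of "\<one>\<^bsub>G\<^esub>"] by (auto simp: Bij_def bij_betw_def)
  moreover have "\<pi> \<one>\<^bsub>G\<^esub> (\<pi> \<one>\<^bsub>G\<^esub> n) = \<pi> \<one>\<^bsub>G\<^esub> n" using \<pi>_comp[of "\<one>\<^bsub>G\<^esub>" "\<one>\<^bsub>G\<^esub>" n] n by simp
  ultimately show ?thesis using n by (simp add: inj_on_def)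
qed

lemma \<pi>_inverse [simp]:
  "g \<in> carrier G \<Longrightarrow> n \<in> carrier N \<Longrightarrow> \<pi> (inv\<^bsub>G\<^esub> g) (\<pi> g n) = n"
  "g \<in> carrier G \<Longrightarrow> n \<in> carrier N \<Longrightarrow> \<pi> g (\<pi> (inv\<^bsub>G\<^esub> g) n) = n"
  using \<pi>_comp[of "inv\<^bsub>G\<^esub> g" g n] \<pi>_comp[of g "inv\<^bsub>G\<^esub> g" n] by simp_all

lemma H_group: "group H"
proof (rule groupI)
  fix x y z assume "x \<in> carrier H" "y \<in> carrier H" "z \<in> carrier H"
  then show "x \<otimes>\<^bsub>H\<^esub> y \<otimes>\<^bsub>H\<^esub> z = x \<otimes>\<^bsub>H\<^esub> (y \<otimes>\<^bsub>H\<^esub> z)"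
    by (auto simp: NN.m_assoc GG.m_assoc \<pi>_mult \<pi>_comp)
next
  fix x assume "x \<in> carrier H"
  then show "\<exists>y\<in>carrier H. y \<otimes>\<^bsub>H\<^esub> x = \<one>\<^bsub>H\<^esub>"
    by (intro bexI[of _ "(\<pi> (inv\<^bsub>G\<^esub> (snd x)) (inv\<^bsub>N\<^esub> (fst x)), inv\<^bsub>G\<^esub> (snd x))"]) (auto simp: \<pi>_mult[symmetric])
qed auto

sublocale HH: group H
  by (rule H_group)

lemma H_inv:
  assumes "n \<in> carrier N" "g \<in> carrier G"
  shows "inv\<^bsub>H\<^esub> (n, g) = (\<pi> (inv\<^bsub>G\<^esub> g) (inv\<^bsub>N\<^esub> n), inv\<^bsub>G\<^esub> g)"
  by (rule HH.inv_equality) (use assms in \<open>auto simp: \<pi>_mult[symmetric]\<close>)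

lemma H_diff:
  assumes "n \<in> carrier N" "g \<in> carrier G" "n' \<in> carrier N" "g' \<in> carrier G"
  shows "inv\<^bsub>H\<^esub> (n, g) \<otimes>\<^bsub>H\<^esub> (n', g') = (\<pi> (inv\<^bsub>G\<^esub> g) (inv\<^bsub>N\<^esub> n \<otimes>\<^bsub>N\<^esub> n'), inv\<^bsub>G\<^esub> g \<otimes>\<^bsub>G\<^esub> g')"
  using assms by (simp add: H_inv \<pi>_mult)

lemma H_pow:
  assumes "a \<in> carrier N" "b \<in> carrier G"
  shows "(a, b) [^]\<^bsub>H\<^esub> (k::nat) = (NN.gprod (\<lambda>i. \<pi> (b [^]\<^bsub>G\<^esub> i) a) k, b [^]\<^bsub>G\<^esub> k)"
  by (induction k) auto

section \<open>Derivatives of the automorphisms\<close>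

definition L :: "('n \<Rightarrow> 'n) \<Rightarrow> 'e \<Rightarrow> 'e" where
  "L f = frechet_derivative (\<lambda>v. NN.lg (f (NN.ex v))) (at 0)"

lemma L_derivative:
  assumes g: "g \<in> carrier G"
  shows "((\<lambda>v. NN.lg (\<pi> g (NN.ex v))) has_derivative L (\<pi> g)) (at 0)"
proof -
  have "frechet_smooth_on (\<phi> ` {p \<in> U. \<pi> g p \<in> U}) (\<phi> \<circ> \<pi> g \<circ> inv_into U \<phi>)"
    by (rule smooth_mapD[OF \<pi>_smooth[OF g] NN.chart NN.chart])
  from frechet_smooth_derivative[OF this] obtain f' where f': "C11_derivative (\<phi> ` {p \<in> U. \<pi> g p \<in> U}) (\<phi> \<circ> \<pi> g \<circ> inv_into U \<phi>) f'"
    by metis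
  have "\<phi> \<one>\<^bsub>N\<^esub> \<in> \<phi> ` {p \<in> U. \<pi> g p \<in> U}" using NN.one_U g by (intro image_eqI[of _ _ "\<one>\<^bsub>N\<^esub>"]) simp_all
  from C11_derivativeD(1)[OF f' this]
  have d: "((\<phi> \<circ> \<pi> g \<circ> inv_into U \<phi>) has_derivative f' (\<phi> \<one>\<^bsub>N\<^esub>)) (at (0 + \<phi> \<one>\<^bsub>N\<^esub>))" by simp
  have "((\<lambda>u. u + \<phi> \<one>\<^bsub>N\<^esub>) has_derivative (\<lambda>u. u)) (at 0)" by (auto intro!: derivative_eq_intros)
  from has_derivative_diff[OF has_derivative_compose[OF this d] has_derivative_const[of "\<phi> \<one>\<^bsub>N\<^esub>"]]
  have "((\<lambda>v. (\<phi> \<circ> \<pi> g \<circ> inv_into U \<phi>) (v + \<phi> \<one>\<^bsub>N\<^esub>) - \<phi> \<one>\<^bsub>N\<^esub>) has_derivative f' (\<phi> \<one>\<^bsub>N\<^esub>)) (at 0)"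
    by simp
  then have "(\<lambda>v. NN.lg (\<pi> g (NN.ex v))) differentiable (at 0)"
    unfolding differentiable_def NN.lg_def NN.ex_def by (auto simp: o_def)
  then show ?thesis by (simp add: L_def frechet_derivative_works[symmetric])
qed

lemma L_linear: "g \<in> carrier G \<Longrightarrow> linear (L (\<pi> g))"
  using L_derivative has_derivative_linear by blast

lemma \<pi>_cont_left: "n \<in> carrier N \<Longrightarrow> continuous_map GG.T NN.T (\<lambda>g. \<pi> g n)"
proof -
  assume n: "n \<in> carrier N"
  have "continuous_map GG.T NN.T (\<lambda>g. (\<lambda>(g, n). \<pi> g n) (g, n))"
    using n NN.topspace by (intro continuous_map_compose[OF _ \<pi>_cont, unfolded o_def] continuous_map_pairedI) auto
  then show ?thesis by simp
qed

text \<open>The preimage of \<open>D r0\<close> under the action is an open set containing Q times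
  the identity, so by the tube lemma it contains a product neighbourhood. That \<open>P\<close> is
  open, not just a superset of \<open>Q\<close>, matters in \<open>L_near_one\<close>, where a chart
  ball has to fit into it.\<close>

lemma equicont_compact:
  assumes Q: "compactin GG.T Q"
  obtains P where "openin GG.T P" "Q \<subseteq> P" "NN.equicont (\<pi> ` P)"
proof -
  define W where "W = {z \<in> topspace (prod_topology GG.T NN.T). (\<lambda>(g, n). \<pi> g n) z \<in> NN.D NN.r0}"
  have "openin (prod_topology GG.T NN.T) W"
    unfolding W_def using \<pi>_cont NN.open_D by (rule openin_continuous_map_preimage)
  moreover have "Q \<times> {\<one>\<^bsub>N\<^esub>} \<subseteq> W"
    using compactin_subset_topspace[OF Q] GG.topspace NN.topspace NN.one_D[OF NN.r0_pos] by (auto simp: W_def)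
  moreover have "\<one>\<^bsub>N\<^esub> \<in> topspace NN.T" using NN.topspace by simp
  ultimately obtain P Z where PZ: "openin GG.T P" "openin NN.T Z" "Q \<subseteq> P" "\<one>\<^bsub>N\<^esub> \<in> Z" "P \<times> Z \<subseteq> W"
    using tube_lemma_left[OF _ Q] by metis
  obtain \<delta> where \<delta>: "0 < \<delta>" "NN.D \<delta> \<subseteq> Z" using NN.nbhd_D[OF PZ(2,4)] by metis
  have P: "P \<subseteq> carrier G" using openin_subset[OF PZ(1)] GG.topspace by simp
  have "NN.equicont (\<pi> ` P)" unfolding NN.equicont_def
  proof (intro conjI exI[of _ \<delta>] \<delta>(1))
    show "\<pi> ` P \<subseteq> hom N N" using \<pi>_auto P by blast
    show "\<forall>f\<in>\<pi> ` P. \<forall>p\<in>NN.D \<delta>. f p \<in> NN.D NN.r0"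
    proof (intro ballI, elim imageE)
      fix f p g assume p: "p \<in> NN.D \<delta>" and f: "f = \<pi> g" "g \<in> P"
      then have "(g, p) \<in> W" using PZ(5) \<delta>(2) by blast
      then show "f p \<in> NN.D NN.r0" by (simp add: W_def f)
    qed
  qed
  then show thesis using that PZ by blast
qed

section \<open>Left translation in the semidirect product\<close>

lemma charts_at_prod:
  assumes "d \<in> charts_at (prod_manifold (mfd N) (mfd G)) (n, g)"
  obtains W \<omega> Z \<zeta> where "d = (W \<times> Z, map_prod \<omega> \<zeta>)" "(W, \<omega>) \<in> atlas (mfd N)" "(Z, \<zeta>) \<in> atlas (mfd G)" "n \<in> W" "g \<in> Z"
  using assms unfolding charts_at_def prod_manifold_def by auto

text \<open>Left multiplication sends (p, q) to (n \<pi>(g)(p), g q) with g fixed, so its derivative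
  is diagonal and involves only derivatives of \<pi>(g) on N, none in the direction of G.\<close>

lemma left_translate_prod:
  assumes W: "(W, \<omega>) \<in> atlas (mfd N)" "n \<in> W" and Z: "(Z, \<zeta>) \<in> atlas (mfd G)" "g \<in> Z"
  shows "left_translate H (n, g) x (W \<times> Z, map_prod \<omega> \<zeta>) =
    (NN.tr \<omega> n (L (\<pi> g) (fst (x c0))), GG.tr \<zeta> g (snd (x c0)))"
proof -
  have n: "n \<in> carrier N" and g: "g \<in> carrier G" using W Z NN.atlas_carrier GG.atlas_carrier by auto
  let ?d = "(W \<times> Z, map_prod \<omega> \<zeta>)"
  have "?d \<in> atlas (prod_manifold (mfd N) (mfd G))"
    unfolding prod_manifold_def using W(1) Z(1) by (force intro!: image_eqI[of _ _ "((W, \<omega>), (Z, \<zeta>))"])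
  then have d: "?d \<in> charts_at (mfd H) ((n, g) \<otimes>\<^bsub>H\<^esub> \<one>\<^bsub>H\<^esub>)"
    using W Z n g by (simp add: charts_at_def)
  let ?F = "map_prod \<omega> \<zeta> \<circ> (\<lambda>y. (n, g) \<otimes>\<^bsub>H\<^esub> y) \<circ> inv_into (U \<times> V) (map_prod \<phi> \<psi>)"
  have lt: "left_translate H (n, g) x ?d = frechet_derivative ?F (at (\<phi> \<one>\<^bsub>N\<^esub>, \<psi> \<one>\<^bsub>G\<^esub>)) (x c0)"
    unfolding left_translate_def tangent_map_def Let_def using d base by simp
  note injN = banach_manifold_chart(3)[OF NN.manifold NN.chart] and injG = banach_manifold_chart(3)[OF GG.manifold GG.chart]
  note opN = banach_manifold_chart(2)[OF NN.manifold NN.chart] and opG = banach_manifold_chart(2)[OF GG.manifold GG.chart]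
  have N1: "((\<lambda>u. \<omega> (n \<otimes>\<^bsub>N\<^esub> \<pi> g (inv_into U \<phi> u))) has_derivative (\<lambda>w. NN.tr \<omega> n (L (\<pi> g) w))) (at (\<phi> \<one>\<^bsub>N\<^esub>))"
  proof -
    have "NN.lg (\<pi> g (NN.ex 0)) = 0" using g by (simp add: NN.ex_0 NN.lg_one)
    \<comment> \<open>The inserted \<open>NN.ex (NN.lg ...)\<close> sends the chain rule through the
      base chart. It may be removed near the identity, where \<pi>(g) maps into
      \<open>U\<close>.\<close>
    then have 1: "((\<lambda>v. \<omega> (n \<otimes>\<^bsub>N\<^esub> NN.ex (NN.lg (\<pi> g (NN.ex v))))) has_derivative (\<lambda>w. NN.tr \<omega> n (L (\<pi> g) w))) (at 0)"
      using has_derivative_compose[OF L_derivative[OF g], of "\<lambda>u. \<omega> (n \<otimes>\<^bsub>N\<^esub> NN.ex u)" "NN.tr \<omega> n"]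
        NN.tr_derivative_ex[OF W] by simp
    have 2: "((\<lambda>u. \<omega> (n \<otimes>\<^bsub>N\<^esub> NN.ex (NN.lg (\<pi> g (NN.ex (u - \<phi> \<one>\<^bsub>N\<^esub>)))))) has_derivative (\<lambda>w. NN.tr \<omega> n (L (\<pi> g) w))) (at (\<phi> \<one>\<^bsub>N\<^esub>))"
      by (rule has_derivative_compose[where f = "\<lambda>u. u - \<phi> \<one>\<^bsub>N\<^esub>" and f' = "\<lambda>u. u"])
        (use 1 in \<open>auto intro!: derivative_eq_intros\<close>)
    have "continuous_map NN.T NN.T (\<pi> g)" using \<pi>_smooth[OF g] by (simp add: smooth_map_def)
    then have "openin NN.T {p \<in> topspace NN.T. \<pi> g p \<in> U}"
      using NN.open_dom by (rule openin_continuous_map_preimage)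
    then obtain \<rho> where \<rho>: "0 < \<rho>" "\<rho> \<le> fst NN.RC" "NN.D \<rho> \<subseteq> {p \<in> topspace NN.T. \<pi> g p \<in> U}"
      using NN.nbhd_D[of "{p \<in> topspace NN.T. \<pi> g p \<in> U}"] g NN.topspace NN.one_U by auto
    show ?thesis
    proof (rule has_derivative_transform_within_open[OF 2 open_ball])
      show "\<phi> \<one>\<^bsub>N\<^esub> \<in> ball (\<phi> \<one>\<^bsub>N\<^esub>) \<rho>" using \<rho> by simp
      fix u assume "u \<in> ball (\<phi> \<one>\<^bsub>N\<^esub>) \<rho>"
      then have "norm (u - \<phi> \<one>\<^bsub>N\<^esub>) < \<rho>" by (simp add: dist_norm norm_minus_commute)
      then have "NN.ex (u - \<phi> \<one>\<^bsub>N\<^esub>) \<in> NN.D \<rho>" using \<rho> by (intro NN.ex_D) auto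
      then have "\<pi> g (NN.ex (u - \<phi> \<one>\<^bsub>N\<^esub>)) \<in> U" using \<rho>(3) by blast
      then show "\<omega> (n \<otimes>\<^bsub>N\<^esub> NN.ex (NN.lg (\<pi> g (NN.ex (u - \<phi> \<one>\<^bsub>N\<^esub>))))) = \<omega> (n \<otimes>\<^bsub>N\<^esub> \<pi> g (inv_into U \<phi> u))"
        by (subst NN.ex_lg) (auto simp: NN.ex_def)
    qed
  qed
  have "((\<lambda>z. (\<omega> (n \<otimes>\<^bsub>N\<^esub> \<pi> g (inv_into U \<phi> (fst z))), \<zeta> (g \<otimes>\<^bsub>G\<^esub> inv_into V \<psi> (snd z)))) has_derivative
     (\<lambda>w. (NN.tr \<omega> n (L (\<pi> g) (fst w)), GG.tr \<zeta> g (snd w)))) (at (\<phi> \<one>\<^bsub>N\<^esub>, \<psi> \<one>\<^bsub>G\<^esub>))"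
  proof (rule has_derivative_Pair)
    show "((\<lambda>z. \<omega> (n \<otimes>\<^bsub>N\<^esub> \<pi> g (inv_into U \<phi> (fst z)))) has_derivative (\<lambda>w. NN.tr \<omega> n (L (\<pi> g) (fst w)))) (at (\<phi> \<one>\<^bsub>N\<^esub>, \<psi> \<one>\<^bsub>G\<^esub>))"
      by (rule has_derivative_compose[where f = fst and f' = fst])
        (use N1 in \<open>auto intro!: derivative_eq_intros bounded_linear_imp_has_derivative bounded_linear_fst\<close>)
    show "((\<lambda>z. \<zeta> (g \<otimes>\<^bsub>G\<^esub> inv_into V \<psi> (snd z))) has_derivative (\<lambda>w. GG.tr \<zeta> g (snd w))) (at (\<phi> \<one>\<^bsub>N\<^esub>, \<psi> \<one>\<^bsub>G\<^esub>))"
      by (rule has_derivative_compose[where f = snd and f' = snd])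
        (use GG.tr_derivative[OF Z] in \<open>auto intro!: derivative_eq_intros bounded_linear_imp_has_derivative bounded_linear_snd\<close>)
  qed
  then have "(?F has_derivative (\<lambda>w. (NN.tr \<omega> n (L (\<pi> g) (fst w)), GG.tr \<zeta> g (snd w)))) (at (\<phi> \<one>\<^bsub>N\<^esub>, \<psi> \<one>\<^bsub>G\<^esub>))"
  proof (rule has_derivative_transform_within_open[OF _ open_Times[OF opN opG]])
    show "(\<phi> \<one>\<^bsub>N\<^esub>, \<psi> \<one>\<^bsub>G\<^esub>) \<in> \<phi> ` U \<times> \<psi> ` V" using NN.one_U GG.one_U by auto
    fix z assume "z \<in> \<phi> ` U \<times> \<psi> ` V"
    then obtain p q where pq: "z = (\<phi> p, \<psi> q)" "p \<in> U" "q \<in> V" by auto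
    then show "(\<omega> (n \<otimes>\<^bsub>N\<^esub> \<pi> g (inv_into U \<phi> (fst z))), \<zeta> (g \<otimes>\<^bsub>G\<^esub> inv_into V \<psi> (snd z))) = ?F z"
      using injN injG by (simp add: inv_into_map_prod)
  qed
  from frechet_derivative_at[OF this] show ?thesis unfolding lt by (metis (no_types, lifting))
qed

end

section \<open>Auxiliary facts on curves\<close>

text \<open>Freezing the function at the end points gives data on the whole line, as
  \<open>product_integral\<close> expects.\<close>

lemma bounded_uniformly_continuous_extension:
  fixes f :: "real \<Rightarrow> 'e::real_normed_vector"
  assumes f: "continuous_on {0..b} f" and b: "0 \<le> b"
  obtains y M where "\<And>t. t \<in> {0..b} \<Longrightarrow> y t = f t" "\<And>t. norm (y t) \<le> M" "uniformly_continuous_on UNIV y"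
proof -
  define c where "c t = max 0 (min b t)" for t
  have c: "c t \<in> {0..b}" "\<bar>c s - c t\<bar> \<le> \<bar>s - t\<bar>" "t \<in> {0..b} \<Longrightarrow> c t = t" for s t
    using b by (auto simp: c_def)
  have "bounded (f ` {0..b})" using f by (intro compact_imp_bounded compact_continuous_image) auto
  then obtain M where M: "\<And>t. t \<in> {0..b} \<Longrightarrow> norm (f t) \<le> M" unfolding bounded_iff by blast
  have "uniformly_continuous_on {0..b} f" using f by (intro compact_uniformly_continuous) auto
  then have "uniformly_continuous_on UNIV (\<lambda>t. f (c t))"
    unfolding uniformly_continuous_on_def dist_real_def using c(1,2) by (meson le_less_trans)
  then show thesis using that[of "\<lambda>t. f (c t)" M] c M by auto
qed

lemma C1_curve_has_derivative:
  assumes C1: "C1_curve M I \<gamma>" and c: "(U, \<phi>) \<in> atlas M" and t: "t \<in> I" "\<gamma> t \<in> U"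
  obtains v where "((\<phi> \<circ> \<gamma>) has_vector_derivative v) (at t within I)"
proof -
  have "\<forall>(U, \<phi>)\<in>atlas M. \<exists>\<gamma>'. continuous_on {t \<in> I. \<gamma> t \<in> U} \<gamma>' \<and>
      (\<forall>t\<in>I. \<gamma> t \<in> U \<longrightarrow> ((\<phi> \<circ> \<gamma>) has_vector_derivative \<gamma>' t) (at t within I))"
    using C1 unfolding C1_curve_def by (rule conjunct2)
  from bspec[OF this c] obtain \<gamma>' where
    "\<forall>t\<in>I. \<gamma> t \<in> U \<longrightarrow> ((\<phi> \<circ> \<gamma>) has_vector_derivative \<gamma>' t) (at t within I)"
    by (simp only: prod.case) (elim exE conjE)
  then show thesis using t that by blast
qed

lemma vector_derivative_unit_interval:
  assumes "t \<in> {0..1}" "(f has_vector_derivative f') (at t within {0..1})"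
  shows "vector_derivative f (at t within {0..1}) = f'"
proof (rule vector_derivative_within[OF _ assms(2)])
  show "at t within {0..1} \<noteq> bot" using assms(1) by (simp add: trivial_limit_within)
qed

section \<open>Continuity of the differentiated action\<close>

context semidirect
begin

lemma equicont_L:
  assumes eq: "NN.equicont (\<pi> ` P)" and P: "P \<subseteq> carrier G"
  obtains K \<delta> where "0 < K" "0 < \<delta>" "\<delta> \<le> fst NN.RC"
    "\<And>g u. g \<in> P \<Longrightarrow> norm u < \<delta> \<Longrightarrow> \<pi> g (NN.ex u) \<in> NN.D (fst NN.RC)"
    "\<And>g u. g \<in> P \<Longrightarrow> norm u < \<delta> \<Longrightarrow> norm (NN.lg (\<pi> g (NN.ex u)) - L (\<pi> g) u) \<le> K * (norm u)\<^sup>2"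
    "\<And>g u. g \<in> P \<Longrightarrow> norm (L (\<pi> g) u) \<le> K * norm u"
proof (rule NN.equicont_derivative[OF eq, of L])
  show "((\<lambda>v. NN.lg (f (NN.ex v))) has_derivative L f) (at 0)" if "f \<in> \<pi> ` P" for f
    using that L_derivative P by blast
qed (rule that; blast)

text \<open>For fixed v the functions m lg(\<pi>(\<beta>(t)) ex(v/m)) are continuous in t, and by
  the common quadratic remainder they differ from L(\<pi>(\<beta>(t))) v by at most K |v|^2 / m. So
  the limit is continuous although \<pi> is only continuous.\<close>

lemma L_continuous_on:
  fixes \<beta> :: "real \<Rightarrow> 'g"
  assumes eq: "NN.equicont (\<pi> ` P)" and P: "P \<subseteq> carrier G"
    and \<beta>: "continuous_map (top_of_set J) GG.T \<beta>" "\<beta> ` J \<subseteq> P"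
  shows "continuous_on J (\<lambda>t. L (\<pi> (\<beta> t)) v)"
proof -
  obtain K \<delta> where K: "0 < K" "0 < \<delta>" "\<delta> \<le> fst NN.RC"
    "\<And>g u. g \<in> P \<Longrightarrow> norm u < \<delta> \<Longrightarrow> \<pi> g (NN.ex u) \<in> NN.D (fst NN.RC)"
    "\<And>g u. g \<in> P \<Longrightarrow> norm u < \<delta> \<Longrightarrow> norm (NN.lg (\<pi> g (NN.ex u)) - L (\<pi> g) u) \<le> K * (norm u)\<^sup>2"
    by (rule equicont_L[OF eq P]) (rule that; blast)
  define F where "F m t = real m *\<^sub>R NN.lg (\<pi> (\<beta> t) (NN.ex (v /\<^sub>R real m)))" for m t
  have "(\<lambda>m. norm v / real m) \<longlonglongrightarrow> 0" by (rule lim_const_over_n)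
  then have small: "\<forall>\<^sub>F m in sequentially. norm v / real m < \<delta>" using K(2) order_tendstoD(2) by blast
  have "continuous_on J (F m)" if m: "norm v / real m < \<delta>" for m
  proof -
    have w: "norm (v /\<^sub>R real m) < \<delta>" using m by (simp add: divide_inverse mult.commute)
    have exc: "NN.ex (v /\<^sub>R real m) \<in> carrier N" using w K(3) NN.ex_dom NN.dom_carrier by simp
    have "continuous_map (top_of_set J) NN.T (\<lambda>t. \<pi> (\<beta> t) (NN.ex (v /\<^sub>R real m)))"
      using continuous_map_compose[OF \<beta>(1) \<pi>_cont_left[OF exc]] by (simp add: o_def)
    moreover have "\<pi> (\<beta> t) (NN.ex (v /\<^sub>R real m)) \<in> U" if "t \<in> J" for t
      using K(4)[OF _ w, of "\<beta> t"] that \<beta>(2) NN.D_dom by blast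
    ultimately have "continuous_map (top_of_set J) (subtopology NN.T U) (\<lambda>t. \<pi> (\<beta> t) (NN.ex (v /\<^sub>R real m)))"
      by (auto simp: continuous_map_in_subtopology)
    from continuous_map_compose[OF this NN.lg_cont]
    have "continuous_on J (\<lambda>t. NN.lg (\<pi> (\<beta> t) (NN.ex (v /\<^sub>R real m))))" by (simp add: o_def)
    then show ?thesis unfolding F_def by (intro continuous_intros)
  qed
  then have "\<forall>\<^sub>F m in sequentially. continuous_on J (F m)" using small by (auto elim: eventually_mono)
  moreover have "uniform_limit J F (\<lambda>t. L (\<pi> (\<beta> t)) v) sequentially"
  proof (rule uniform_limitI)
    fix e :: real assume e: "0 < e"
    have "(\<lambda>m. K * (norm v)\<^sup>2 / real m) \<longlonglongrightarrow> 0" by (rule lim_const_over_n)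
    then have "\<forall>\<^sub>F m in sequentially. K * (norm v)\<^sup>2 / real m < e" using e order_tendstoD(2) by blast
    with small eventually_gt_at_top[of 0]
    show "\<forall>\<^sub>F m in sequentially. \<forall>t\<in>J. dist (F m t) (L (\<pi> (\<beta> t)) v) < e"
    proof eventually_elim
      case (elim m)
      show ?case
      proof
        fix t assume t: "t \<in> J"
        then have \<beta>P: "\<beta> t \<in> P" using \<beta>(2) by blast
        have w: "norm (v /\<^sub>R real m) < \<delta>" using elim by (simp add: divide_inverse mult.commute)
        have lin: "linear (L (\<pi> (\<beta> t)))" using L_linear P \<beta>P by blast
        have "F m t - L (\<pi> (\<beta> t)) v = real m *\<^sub>R (NN.lg (\<pi> (\<beta> t) (NN.ex (v /\<^sub>R real m))) - L (\<pi> (\<beta> t)) (v /\<^sub>R real m))"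
          using elim by (simp add: F_def linear_scale[OF lin] scaleR_diff_right)
        then have "norm (F m t - L (\<pi> (\<beta> t)) v) \<le> real m * (K * (norm (v /\<^sub>R real m))\<^sup>2)"
          using K(5)[OF \<beta>P w] by (simp add: mult_left_mono)
        also have "\<dots> = K * (norm v)\<^sup>2 / real m"
          using elim by (simp add: power_mult_distrib power2_eq_square field_simps)
        also have "\<dots> < e" using elim by simp
        finally show "dist (F m t) (L (\<pi> (\<beta> t)) v) < e" by (simp add: dist_norm)
      qed
    qed
  qed
  ultimately show ?thesis by (rule uniform_limit_theorem) simp
qed

text \<open>Continuity for one fixed vector, with a rate on a chart ball of G. At a small scale s,
  lg(\<pi>(g) ex(s v)) is close to s L(\<pi>(g)) v by the quadratic remainder, and close to s v by
  continuity of the action at the fixed point ex(s v). First s is chosen so that the remainder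
  divided by s is at most \<epsilon>/2, then the ball depending on s.\<close>

lemma L_near_one:
  assumes eq: "NN.equicont (\<pi> ` P)" and P: "openin GG.T P" "\<one>\<^bsub>G\<^esub> \<in> P" and \<epsilon>: "0 < \<epsilon>"
  obtains \<rho> where "0 < \<rho>" "GG.D \<rho> \<subseteq> P" "\<And>g. g \<in> GG.D \<rho> \<Longrightarrow> norm (L (\<pi> g) v - v) \<le> \<epsilon>"
proof -
  have Pc: "P \<subseteq> carrier G" using openin_subset[OF P(1)] GG.topspace by simp
  obtain K \<delta> where K: "0 < K" "0 < \<delta>" "\<delta> \<le> fst NN.RC"
    "\<And>g u. g \<in> P \<Longrightarrow> norm u < \<delta> \<Longrightarrow> norm (NN.lg (\<pi> g (NN.ex u)) - L (\<pi> g) u) \<le> K * (norm u)\<^sup>2"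
    by (rule equicont_L[OF eq Pc]) (rule that; blast)
  define s where "s = Min {\<delta> / (norm v + 1) / 2, \<epsilon> / (2 * K * ((norm v)\<^sup>2 + 1))}"
  have nv: "0 < norm v + 1" "0 < (norm v)\<^sup>2 + 1" by (auto intro: add_nonneg_pos)
  have s: "0 < s" "s \<le> \<delta> / (norm v + 1) / 2" "s \<le> \<epsilon> / (2 * K * ((norm v)\<^sup>2 + 1))"
    using K \<epsilon> nv by (auto simp: s_def)
  have s1: "norm (s *\<^sub>R v) < \<delta>"
  proof -
    have "s * (2 * (norm v + 1)) \<le> \<delta>" using s(2) nv(1) by (simp add: field_simps)
    moreover have "s * norm v < s * (2 * (norm v + 1))" using s(1) nv(1) by (intro mult_strict_left_mono) auto
    ultimately have "s * norm v < \<delta>" by linarith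
    then show ?thesis using s(1) by simp
  qed
  have s2: "K * s * (norm v)\<^sup>2 \<le> \<epsilon> / 2"
  proof -
    have "s * (2 * K * ((norm v)\<^sup>2 + 1)) \<le> \<epsilon>" using s(3) K(1) nv(2) by (subst (asm) pos_le_divide_eq) auto
    moreover have "s * (2 * K * (norm v)\<^sup>2) \<le> s * (2 * K * ((norm v)\<^sup>2 + 1))"
      using s(1) K(1) by (intro mult_left_mono) auto
    ultimately show ?thesis by (simp add: mult_ac)
  qed
  have w: "norm (s *\<^sub>R v) < fst NN.RC" using s1 K(3) by simp
  have exc: "NN.ex (s *\<^sub>R v) \<in> carrier N" using w NN.ex_dom NN.dom_carrier by blast
  define B where "B = {p \<in> topspace (subtopology NN.T U). NN.lg p \<in> ball (s *\<^sub>R v) (\<epsilon> * s / 2)}"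
  have "openin (subtopology NN.T U) B" unfolding B_def
    using NN.lg_cont by (rule openin_continuous_map_preimage) auto
  then have "openin NN.T B" using NN.open_dom openin_trans_full by blast
  then have "openin GG.T {g \<in> topspace GG.T. \<pi> g (NN.ex (s *\<^sub>R v)) \<in> B}"
    using \<pi>_cont_left[OF exc] by (rule openin_continuous_map_preimage[rotated])
  then have "openin GG.T (P \<inter> {g \<in> topspace GG.T. \<pi> g (NN.ex (s *\<^sub>R v)) \<in> B})" using P(1) by blast
  moreover have "\<one>\<^bsub>G\<^esub> \<in> P \<inter> {g \<in> topspace GG.T. \<pi> g (NN.ex (s *\<^sub>R v)) \<in> B}"
    using P(2) exc NN.ex_dom[OF w] NN.lg_ex[OF w] GG.topspace NN.topspace s(1) \<epsilon> by (simp add: B_def)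
  ultimately obtain \<rho> where \<rho>: "0 < \<rho>" "GG.D \<rho> \<subseteq> P \<inter> {g \<in> topspace GG.T. \<pi> g (NN.ex (s *\<^sub>R v)) \<in> B}"
    using GG.nbhd_D by metis
  have "norm (L (\<pi> g) v - v) \<le> \<epsilon>" if g: "g \<in> GG.D \<rho>" for g
  proof -
    have gP: "g \<in> P" "\<pi> g (NN.ex (s *\<^sub>R v)) \<in> B" using g \<rho>(2) by auto
    have lin: "linear (L (\<pi> g))" using L_linear Pc gP by blast
    define z where "z = NN.lg (\<pi> g (NN.ex (s *\<^sub>R v)))"
    have 1: "norm (z - s *\<^sub>R v) < \<epsilon> * s / 2" using gP(2) by (simp add: B_def z_def dist_norm norm_minus_commute)
    have 2: "norm (z - s *\<^sub>R L (\<pi> g) v) \<le> K * (norm (s *\<^sub>R v))\<^sup>2"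
      using K(4)[OF gP(1) s1] by (simp add: z_def linear_scale[OF lin])
    have "s * norm (L (\<pi> g) v - v) = norm (s *\<^sub>R (L (\<pi> g) v - v))" using s(1) by simp
    also have "\<dots> = norm ((z - s *\<^sub>R v) - (z - s *\<^sub>R L (\<pi> g) v))" by (simp add: scaleR_diff_right)
    also have "\<dots> \<le> \<epsilon> * s / 2 + K * (norm (s *\<^sub>R v))\<^sup>2"
      using 1 2 norm_triangle_ineq4[of "z - s *\<^sub>R v" "z - s *\<^sub>R L (\<pi> g) v"] by linarith
    also have "K * (norm (s *\<^sub>R v))\<^sup>2 = s * (K * s * (norm v)\<^sup>2)" by (simp add: power_mult_distrib power2_eq_square)
    also have "\<epsilon> * s / 2 + s * (K * s * (norm v)\<^sup>2) \<le> \<epsilon> * s / 2 + s * (\<epsilon> / 2)"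
      using s2 s(1) by (intro add_mono mult_left_mono) auto
    also have "\<dots> = s * \<epsilon>" by simp
    finally show ?thesis using s(1) by simp
  qed
  then show thesis using that \<rho> by blast
qed

section \<open>The differential equation of the exponential function\<close>

text \<open>The equation in \<open>H\<close> is triangular: by \<open>left_translate_prod\<close>
  the component in G has a constant logarithmic derivative, and it determines the coefficient for
  the component in N. Any product chart around the point suffices to read this off.\<close>

lemma solution_logarithmic:
  assumes C1: "C1_curve (mfd H) {0..1} \<eta>"
    and vel: "\<forall>t\<in>{0..1}. velocity (mfd H) {0..1} \<eta> t = left_translate H (\<eta> t) x"
  shows "continuous_map (top_of_set {0..1}) NN.T (\<lambda>t. fst (\<eta> t))" "continuous_map (top_of_set {0..1}) GG.T (\<lambda>t. snd (\<eta> t))"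
    and "t \<in> {0..1} \<Longrightarrow> ((\<lambda>s. NN.lg (inv\<^bsub>N\<^esub> (fst (\<eta> t)) \<otimes>\<^bsub>N\<^esub> fst (\<eta> s))) has_vector_derivative L (\<pi> (snd (\<eta> t))) (fst (x c0))) (at t within {0..1})"
    and "t \<in> {0..1} \<Longrightarrow> ((\<lambda>s. GG.lg (inv\<^bsub>G\<^esub> (snd (\<eta> t)) \<otimes>\<^bsub>G\<^esub> snd (\<eta> s))) has_vector_derivative snd (x c0)) (at t within {0..1})"
proof -
  have "continuous_map (top_of_set {0..1}) (prod_topology NN.T GG.T) \<eta>"
    using C1 by (simp add: C1_curve_def prod_manifold_def)
  then show c: "continuous_map (top_of_set {0..1}) NN.T (\<lambda>t. fst (\<eta> t))" "continuous_map (top_of_set {0..1}) GG.T (\<lambda>t. snd (\<eta> t))"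
    by (simp_all add: continuous_map_pairwise o_def)
  assume t: "t \<in> {0..1}"
  have car: "fst (\<eta> t) \<in> carrier N" "snd (\<eta> t) \<in> carrier G"
    using c t NN.topspace GG.topspace by (auto simp: continuous_map_def Pi_iff)
  obtain W \<omega> where W: "(W, \<omega>) \<in> atlas (mfd N)" "fst (\<eta> t) \<in> W" using NN.atlas_cover[OF car(1)] by blast
  obtain Z \<zeta> where Z: "(Z, \<zeta>) \<in> atlas (mfd G)" "snd (\<eta> t) \<in> Z" using GG.atlas_cover[OF car(2)] by blast
  let ?d = "(W \<times> Z, map_prod \<omega> \<zeta>)"
  have at: "?d \<in> atlas (mfd H)"
    using W(1) Z(1) by (force simp: prod_manifold_def intro!: image_eqI[of _ _ "((W, \<omega>), (Z, \<zeta>))"])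
  have \<eta>d: "\<eta> t \<in> W \<times> Z" using W Z by (simp add: mem_Times_iff)
  obtain z where g: "((map_prod \<omega> \<zeta> \<circ> \<eta>) has_vector_derivative z) (at t within {0..1})"
    by (rule C1_curve_has_derivative[OF C1 at t \<eta>d])
  have "z = vector_derivative (map_prod \<omega> \<zeta> \<circ> \<eta>) (at t within {0..1})"
    using vector_derivative_unit_interval[OF t g] by simp
  also have "\<dots> = velocity (mfd H) {0..1} \<eta> t ?d"
    using at \<eta>d by (simp add: velocity_def charts_at_def)
  also have "\<dots> = left_translate H (fst (\<eta> t), snd (\<eta> t)) x ?d" using bspec[OF vel t] by simp
  also have "\<dots> = (NN.tr \<omega> (fst (\<eta> t)) (L (\<pi> (snd (\<eta> t))) (fst (x c0))), GG.tr \<zeta> (snd (\<eta> t)) (snd (x c0)))"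
    by (rule left_translate_prod[OF W Z])
  finally have gz: "z = (NN.tr \<omega> (fst (\<eta> t)) (L (\<pi> (snd (\<eta> t))) (fst (x c0))), GG.tr \<zeta> (snd (\<eta> t)) (snd (x c0)))" .
  have "((\<omega> \<circ> (\<lambda>t. fst (\<eta> t))) has_vector_derivative NN.tr \<omega> (fst (\<eta> t)) (L (\<pi> (snd (\<eta> t))) (fst (x c0)))) (at t within {0..1})"
    using bounded_linear.has_vector_derivative[OF bounded_linear_fst g] by (simp add: gz o_def)
  then show "((\<lambda>s. NN.lg (inv\<^bsub>N\<^esub> (fst (\<eta> t)) \<otimes>\<^bsub>N\<^esub> fst (\<eta> s))) has_vector_derivative L (\<pi> (snd (\<eta> t))) (fst (x c0))) (at t within {0..1})"
    using NN.chart_velocity_iff[OF W(1) c(1) t W(2)] by blast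
  have "((\<zeta> \<circ> (\<lambda>t. snd (\<eta> t))) has_vector_derivative GG.tr \<zeta> (snd (\<eta> t)) (snd (x c0))) (at t within {0..1})"
    using bounded_linear.has_vector_derivative[OF bounded_linear_snd g] by (simp add: gz o_def)
  then show "((\<lambda>s. GG.lg (inv\<^bsub>G\<^esub> (snd (\<eta> t)) \<otimes>\<^bsub>G\<^esub> snd (\<eta> s))) has_vector_derivative snd (x c0)) (at t within {0..1})"
    using GG.chart_velocity_iff[OF Z(1) c(2) t Z(2)] by blast
qed

text \<open>The converse of \<open>solution_logarithmic\<close>. The assumption \<open>cont\<close>
  enters because \<open>C1_curve\<close> asks for continuous derivatives. Velocities are compared as
  families over all charts; at charts that miss the point both are 0 by convention.\<close>

lemma logarithmic_solution:
  assumes \<nu>: "continuous_map (top_of_set {0..1}) NN.T \<nu>" and \<beta>: "continuous_map (top_of_set {0..1}) GG.T \<beta>"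
    and dN: "\<And>t. t \<in> {0..1} \<Longrightarrow> ((\<lambda>s. NN.lg (inv\<^bsub>N\<^esub> (\<nu> t) \<otimes>\<^bsub>N\<^esub> \<nu> s)) has_vector_derivative L (\<pi> (\<beta> t)) (fst (x c0))) (at t within {0..1})"
    and dG: "\<And>t. t \<in> {0..1} \<Longrightarrow> ((\<lambda>s. GG.lg (inv\<^bsub>G\<^esub> (\<beta> t) \<otimes>\<^bsub>G\<^esub> \<beta> s)) has_vector_derivative snd (x c0)) (at t within {0..1})"
    and cont: "continuous_on {0..1} (\<lambda>t. L (\<pi> (\<beta> t)) (fst (x c0)))"
  shows "C1_curve (mfd H) {0..1} (\<lambda>t. (\<nu> t, \<beta> t))"
    and "t \<in> {0..1} \<Longrightarrow> velocity (mfd H) {0..1} (\<lambda>t. (\<nu> t, \<beta> t)) t = left_translate H (\<nu> t, \<beta> t) x"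
proof -
  have der: "((map_prod \<omega> \<zeta> \<circ> (\<lambda>t. (\<nu> t, \<beta> t))) has_vector_derivative
     (NN.tr \<omega> (\<nu> t) (L (\<pi> (\<beta> t)) (fst (x c0))), GG.tr \<zeta> (\<beta> t) (snd (x c0)))) (at t within {0..1})"
    if W: "(W, \<omega>) \<in> atlas (mfd N)" "\<nu> t \<in> W" and Z: "(Z, \<zeta>) \<in> atlas (mfd G)" "\<beta> t \<in> Z" and t: "t \<in> {0..1}" for W \<omega> Z \<zeta> t
    using NN.chart_velocity_iff[OF W(1) \<nu> t W(2)] GG.chart_velocity_iff[OF Z(1) \<beta> t Z(2)] dN[OF t] dG[OF t]
    by (auto simp: o_def intro: has_vector_derivative_Pair)
  show "C1_curve (mfd H) {0..1} (\<lambda>t. (\<nu> t, \<beta> t))"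
    unfolding C1_curve_def
  proof (intro conjI ballI)
    show "continuous_map (top_of_set {0..1}) (mtop (mfd H)) (\<lambda>t. (\<nu> t, \<beta> t))"
      using \<nu> \<beta> by (simp add: prod_manifold_def continuous_map_pairedI)
    fix d assume "d \<in> atlas (mfd H)"
    then obtain W \<omega> Z \<zeta> where d: "d = (W \<times> Z, map_prod \<omega> \<zeta>)" and W: "(W, \<omega>) \<in> atlas (mfd N)" and Z: "(Z, \<zeta>) \<in> atlas (mfd G)"
      by (auto simp: prod_manifold_def)
    let ?g = "\<lambda>t. (NN.tr \<omega> (\<nu> t) (L (\<pi> (\<beta> t)) (fst (x c0))), GG.tr \<zeta> (\<beta> t) (snd (x c0)))"
    have "continuous_on {t \<in> {0..1}. (\<nu> t, \<beta> t) \<in> W \<times> Z} ?g"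
    proof (rule continuous_on_Pair)
      show "continuous_on {t \<in> {0..1}. (\<nu> t, \<beta> t) \<in> W \<times> Z} (\<lambda>t. NN.tr \<omega> (\<nu> t) (L (\<pi> (\<beta> t)) (fst (x c0))))"
        by (rule continuous_on_subset[OF NN.tr_continuous[OF W \<nu> cont]]) auto
      show "continuous_on {t \<in> {0..1}. (\<nu> t, \<beta> t) \<in> W \<times> Z} (\<lambda>t. GG.tr \<zeta> (\<beta> t) (snd (x c0)))"
        by (rule continuous_on_subset[OF GG.tr_continuous[OF Z \<beta> continuous_on_const]]) auto
    qed
    moreover have "\<forall>t\<in>{0..1}. (\<nu> t, \<beta> t) \<in> W \<times> Z \<longrightarrow>
       ((map_prod \<omega> \<zeta> \<circ> (\<lambda>t. (\<nu> t, \<beta> t))) has_vector_derivative ?g t) (at t within {0..1})"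
      using der[OF W _ Z] by blast
    ultimately show "case d of (U, \<phi>) \<Rightarrow> \<exists>\<gamma>'. continuous_on {t \<in> {0..1}. (\<nu> t, \<beta> t) \<in> U} \<gamma>' \<and>
        (\<forall>t\<in>{0..1}. (\<nu> t, \<beta> t) \<in> U \<longrightarrow> ((\<phi> \<circ> (\<lambda>t. (\<nu> t, \<beta> t))) has_vector_derivative \<gamma>' t) (at t within {0..1}))"
      unfolding d prod.case by blast
  qed
  assume t: "t \<in> {0..1}"
  show "velocity (mfd H) {0..1} (\<lambda>t. (\<nu> t, \<beta> t)) t = left_translate H (\<nu> t, \<beta> t) x"
  proof
    fix d
    show "velocity (mfd H) {0..1} (\<lambda>t. (\<nu> t, \<beta> t)) t d = left_translate H (\<nu> t, \<beta> t) x d"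
    proof (cases "d \<in> charts_at (prod_manifold (mfd N) (mfd G)) (\<nu> t, \<beta> t)")
      case True
      then obtain W \<omega> Z \<zeta> where d: "d = (W \<times> Z, map_prod \<omega> \<zeta>)" and W: "(W, \<omega>) \<in> atlas (mfd N)" "\<nu> t \<in> W"
        and Z: "(Z, \<zeta>) \<in> atlas (mfd G)" "\<beta> t \<in> Z" by (rule charts_at_prod)
      have "velocity (mfd H) {0..1} (\<lambda>t. (\<nu> t, \<beta> t)) t d =
          vector_derivative (map_prod \<omega> \<zeta> \<circ> (\<lambda>t. (\<nu> t, \<beta> t))) (at t within {0..1})"
        using True by (simp add: velocity_def d)
      also have "\<dots> = (NN.tr \<omega> (\<nu> t) (L (\<pi> (\<beta> t)) (fst (x c0))), GG.tr \<zeta> (\<beta> t) (snd (x c0)))"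
        using vector_derivative_unit_interval[OF t der[OF W Z t]] by simp
      finally show ?thesis unfolding d left_translate_prod[OF W Z] .
    next
      case False
      have "\<nu> t \<in> carrier N" "\<beta> t \<in> carrier G"
        using \<nu> \<beta> t NN.topspace GG.topspace by (auto simp: continuous_map_def Pi_iff)
      then have "left_translate H (\<nu> t, \<beta> t) x d = 0"
        using False by (simp add: left_translate_def tangent_map_def Let_def)
      then show ?thesis using False by (simp add: velocity_def)
    qed
  qed
qed

end

lemma has_vector_derivative_rescale:
  fixes F :: "real \<Rightarrow> 'e::real_normed_vector"
  assumes "(F has_vector_derivative v) (at (t * s0) within {0..})" "0 \<le> t"
  shows "((\<lambda>s. F (t * s)) has_vector_derivative t *\<^sub>R v) (at s0 within {0..1})"
proof -
  have "((\<lambda>s. t * s) has_vector_derivative t) (at s0 within {0..1})"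
    by (auto intro!: derivative_eq_intros simp: has_vector_derivative_def)
  moreover have "(F has_vector_derivative v) (at (t * s0) within (\<lambda>s. t * s) ` {0..1})"
    using assms by (intro has_vector_derivative_within_subset[OF assms(1)]) auto
  ultimately show ?thesis using vector_diff_chain_within[of "\<lambda>s. t * s" t s0 "{0..1}" F v] by (simp add: o_def)
qed

context semidirect
begin

text \<open>The curves s -> \<nu>(ts), \<beta>(ts) on the unit interval have their logarithmic
  derivatives multiplied by t, so they solve the equation for t v and end at time t. A competitor is
  identified first in G and then in N, since its coefficient in N is known only after its component
  in G. The function \<open>y\<close> replaces the coefficient outside [0, b].\<close>

lemma lie_exp_eq:
  assumes \<beta>: "GG.solves (\<lambda>_. x2) \<beta>" and \<nu>: "NN.solves y \<nu>"
    and M: "\<And>t. norm (y t) \<le> M" and cont: "continuous_on UNIV y"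
    and y: "\<And>t. t \<in> {0..b} \<Longrightarrow> y t = L (\<pi> (\<beta> t)) x1" and v: "v c0 = (x1, x2)" and t: "t \<in> {0..b}"
  shows "lie_exp H (\<lambda>c. t *\<^sub>R v c) = (\<nu> t, \<beta> t)"
proof -
  define x where "x c = t *\<^sub>R v c" for c
  have x: "x c0 = (t *\<^sub>R x1, t *\<^sub>R x2)" using v by (simp add: x_def)
  have t0: "0 \<le> t" using t by simp
  have ts: "t * s \<in> {0..b}" if "s \<in> {0..1}" for s
    using that t mult_left_le[of s t] by auto
  have \<beta>c: "continuous_map (top_of_set {0..}) GG.T \<beta>"
    using GG.solves_continuous[OF \<beta>, of "norm x2"] by simp
  have \<nu>c: "continuous_map (top_of_set {0..}) NN.T \<nu>"
    using NN.solves_continuous[OF \<nu> M cont] .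
  have sc: "continuous_map (top_of_set {0..1}) (top_of_set {0..}) (\<lambda>s. t * s)"
    using t0 by (auto simp: continuous_map_in_subtopology intro!: continuous_intros)
  have c1: "continuous_map (top_of_set {0..1}) GG.T (\<lambda>s. \<beta> (t * s))"
    using continuous_map_compose[OF sc \<beta>c] by (simp add: o_def)
  have c2: "continuous_map (top_of_set {0..1}) NN.T (\<lambda>s. \<nu> (t * s))"
    using continuous_map_compose[OF sc \<nu>c] by (simp add: o_def)
  have d1: "((\<lambda>r. GG.lg (inv\<^bsub>G\<^esub> (\<beta> (t * s)) \<otimes>\<^bsub>G\<^esub> \<beta> (t * r))) has_vector_derivative t *\<^sub>R x2) (at s within {0..1})"
    if "s \<in> {0..1}" for s
    using has_vector_derivative_rescale[OF GG.solves_derivative[OF \<beta>, of "norm x2"] t0] ts[OF that] by simp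
  have d2: "((\<lambda>r. NN.lg (inv\<^bsub>N\<^esub> (\<nu> (t * s)) \<otimes>\<^bsub>N\<^esub> \<nu> (t * r))) has_vector_derivative t *\<^sub>R y (t * s)) (at s within {0..1})"
    if "s \<in> {0..1}" for s
    using has_vector_derivative_rescale[OF NN.solves_derivative[OF \<nu> M cont] t0] ts[OF that] by simp
  have \<beta>car: "\<beta> s \<in> carrier G" if "0 \<le> s" for s using \<beta> that by (simp add: GG.solves_def)
  have Ly: "L (\<pi> (\<beta> (t * s))) (t *\<^sub>R x1) = t *\<^sub>R y (t * s)" if "s \<in> {0..1}" for s
    using y[OF ts[OF that]] L_linear[OF \<beta>car, of "t * s"] ts[OF that] by (simp add: linear_scale)
  have "continuous_on {0..1} (\<lambda>s. t *\<^sub>R y (t * s))"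
    by (intro continuous_intros continuous_on_compose2[OF cont]) auto
  then have Lc: "continuous_on {0..1} (\<lambda>s. L (\<pi> (\<beta> (t * s))) (fst (x c0)))"
    by (rule continuous_on_eq) (simp add: x Ly)
  have d2': "((\<lambda>r. NN.lg (inv\<^bsub>N\<^esub> (\<nu> (t * s)) \<otimes>\<^bsub>N\<^esub> \<nu> (t * r))) has_vector_derivative L (\<pi> (\<beta> (t * s))) (fst (x c0))) (at s within {0..1})"
    if "s \<in> {0..1}" for s using d2[OF that] Ly[OF that] by (simp add: x)
  have d1': "((\<lambda>r. GG.lg (inv\<^bsub>G\<^esub> (\<beta> (t * s)) \<otimes>\<^bsub>G\<^esub> \<beta> (t * r))) has_vector_derivative snd (x c0)) (at s within {0..1})"
    if "s \<in> {0..1}" for s using d1[OF that] by (simp add: x)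
  note sol = logarithmic_solution[where \<nu> = "\<lambda>s. \<nu> (t * s)" and \<beta> = "\<lambda>s. \<beta> (t * s)" and x = x, OF c2 c1 d2' d1' Lc]
  have zero: "\<nu> 0 = \<one>\<^bsub>N\<^esub>" "\<beta> 0 = \<one>\<^bsub>G\<^esub>" using \<nu> \<beta> by (auto simp: NN.solves_def GG.solves_def)
  show ?thesis unfolding lie_exp_def x_def[symmetric]
  proof (rule the_equality)
    show "\<exists>\<eta>. C1_curve (mfd H) {0..1} \<eta> \<and> \<eta> 0 = \<one>\<^bsub>H\<^esub> \<and>
       (\<forall>t\<in>{0..1}. velocity (mfd H) {0..1} \<eta> t = left_translate H (\<eta> t) x) \<and> (\<nu> t, \<beta> t) = \<eta> 1"
      using sol zero by (intro exI[of _ "\<lambda>s. (\<nu> (t * s), \<beta> (t * s))"]) simp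
    fix h assume "\<exists>\<eta>. C1_curve (mfd H) {0..1} \<eta> \<and> \<eta> 0 = \<one>\<^bsub>H\<^esub> \<and>
       (\<forall>t\<in>{0..1}. velocity (mfd H) {0..1} \<eta> t = left_translate H (\<eta> t) x) \<and> h = \<eta> 1"
    then obtain \<eta> where C1: "C1_curve (mfd H) {0..1} \<eta>" and \<eta>0: "\<eta> 0 = (\<one>\<^bsub>N\<^esub>, \<one>\<^bsub>G\<^esub>)"
      and vel: "\<forall>t\<in>{0..1}. velocity (mfd H) {0..1} \<eta> t = left_translate H (\<eta> t) x" and h: "h = \<eta> 1"
      by auto
    note log = solution_logarithmic[OF C1 vel]
    have G: "snd (\<eta> s) = \<beta> (t * s)" if s: "s \<in> {0..1}" for s
    proof (rule GG.log_derivative_unique[OF log(2) c1 _ _ _ _ s, where x = "\<lambda>_. t *\<^sub>R x2" and M = "norm (t *\<^sub>R x2)"])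
      show "snd (\<eta> 0) = \<beta> (t * 0)" using \<eta>0 zero by simp
    qed (use log(4) d1 x in auto)
    have "fst (\<eta> s) = \<nu> (t * s)" if s: "s \<in> {0..1}" for s
    proof (rule NN.log_derivative_unique[OF log(1) c2 _ _ _ _ s, where x = "\<lambda>s. t *\<^sub>R y (t * s)" and M = "t * M"])
      show "fst (\<eta> 0) = \<nu> (t * 0)" using \<eta>0 zero by simp
      show "norm (t *\<^sub>R y (t * s)) \<le> t * M" for s using M t0 by (simp add: mult_left_mono)
      show "((\<lambda>r. NN.lg (inv\<^bsub>N\<^esub> (fst (\<eta> s)) \<otimes>\<^bsub>N\<^esub> fst (\<eta> r))) has_vector_derivative t *\<^sub>R y (t * s)) (at s within {0..1})"
        if "s \<in> {0..1}" for s
        using log(3)[OF that] G[OF that] Ly[OF that] by (simp add: x)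
    qed (use d2 in auto)
    then show "h = (\<nu> t, \<beta> t)" using G[of 1] h by (simp add: prod_eq_iff)
  qed
qed

section \<open>Convergence of the powers of a curve\<close>

lemma curve_expansion:
  assumes C1: "C1_curve (mfd H) {0..1} \<gamma>" and \<gamma>0: "\<gamma> 0 = \<one>\<^bsub>H\<^esub>"
    and x: "velocity (mfd H) {0..1} \<gamma> 0 c0 = (x1, x2)" and \<epsilon>: "0 < \<epsilon>"
  shows "\<exists>h0>0. \<forall>h. 0 \<le> h \<and> h < h0 \<longrightarrow> fst (\<gamma> h) \<in> U \<and> norm (NN.lg (fst (\<gamma> h)) - h *\<^sub>R x1) \<le> \<epsilon> * h \<and>
     snd (\<gamma> h) \<in> V \<and> norm (GG.lg (snd (\<gamma> h)) - h *\<^sub>R x2) \<le> \<epsilon> * h"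
proof -
  have at: "c0 \<in> atlas (mfd H)"
    using NN.chart GG.chart by (force simp: prod_manifold_def intro!: image_eqI[of _ _ "((U, \<phi>), (V, \<psi>))"])
  have \<gamma>UV: "\<gamma> 0 \<in> U \<times> V" using \<gamma>0 NN.one_U GG.one_U by simp
  obtain z where g: "((map_prod \<phi> \<psi> \<circ> \<gamma>) has_vector_derivative z) (at 0 within {0..1})"
    using C1_curve_has_derivative[OF C1 at _ \<gamma>UV] by auto
  have "z = velocity (mfd H) {0..1} \<gamma> 0 c0"
    using vector_derivative_unit_interval[OF _ g] at \<gamma>UV by (simp add: velocity_def charts_at_def)
  then have g0: "z = (x1, x2)" using x by simp
  have "((\<lambda>s. \<phi> (fst (\<gamma> s))) has_vector_derivative x1) (at 0 within {0..1})"
    using bounded_linear.has_vector_derivative[OF bounded_linear_fst g] by (simp add: g0 o_def)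
  then obtain d1 where d1: "0 < d1" "\<And>s. s \<in> {0..1} \<Longrightarrow> norm (s - 0) < d1 \<Longrightarrow>
      norm (\<phi> (fst (\<gamma> s)) - \<phi> (fst (\<gamma> 0)) - (s - 0) *\<^sub>R x1) \<le> \<epsilon> * norm (s - 0)"
    unfolding has_vector_derivative_def has_derivative_within_alt using \<epsilon> by blast
  have "((\<lambda>s. \<psi> (snd (\<gamma> s))) has_vector_derivative x2) (at 0 within {0..1})"
    using bounded_linear.has_vector_derivative[OF bounded_linear_snd g] by (simp add: g0 o_def)
  then obtain d2 where d2: "0 < d2" "\<And>s. s \<in> {0..1} \<Longrightarrow> norm (s - 0) < d2 \<Longrightarrow>
      norm (\<psi> (snd (\<gamma> s)) - \<psi> (snd (\<gamma> 0)) - (s - 0) *\<^sub>R x2) \<le> \<epsilon> * norm (s - 0)"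
    unfolding has_vector_derivative_def has_derivative_within_alt using \<epsilon> by blast
  have "continuous_map (top_of_set {0..1}) (prod_topology NN.T GG.T) \<gamma>"
    using C1 by (simp add: C1_curve_def prod_manifold_def)
  moreover have "openin (prod_topology NN.T GG.T) (U \<times> V)"
    using NN.open_dom GG.open_dom by (simp add: openin_prod_Times_iff)
  ultimately have "openin (top_of_set {0..1}) {s \<in> topspace (top_of_set {0..1}). \<gamma> s \<in> U \<times> V}"
    by (rule openin_continuous_map_preimage)
  then have "\<exists>e>0. \<forall>s\<in>{0..1}. dist s 0 < e \<longrightarrow> s \<in> {s \<in> {0..1}. \<gamma> s \<in> U \<times> V}"
    using \<gamma>UV unfolding openin_euclidean_subtopology_iff by (elim conjE ballE[of _ _ 0]) auto
  then obtain d3 where d3: "0 < d3" "\<And>s. s \<in> {0..1} \<Longrightarrow> dist s 0 < d3 \<Longrightarrow> \<gamma> s \<in> U \<times> V" by blast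
  define h0 where "h0 = Min {d1, d2, d3, 1}"
  have h0: "0 < h0" "h0 \<le> d1" "h0 \<le> d2" "h0 \<le> d3" "h0 \<le> 1" using d1 d2 d3 by (auto simp: h0_def)
  have "fst (\<gamma> h) \<in> U \<and> norm (NN.lg (fst (\<gamma> h)) - h *\<^sub>R x1) \<le> \<epsilon> * h \<and>
     snd (\<gamma> h) \<in> V \<and> norm (GG.lg (snd (\<gamma> h)) - h *\<^sub>R x2) \<le> \<epsilon> * h" if h: "0 \<le> h" "h < h0" for h
    using d1(2)[of h] d2(2)[of h] d3(2)[of h] h h0 \<gamma>0 by (auto simp: NN.lg_def GG.lg_def mem_Times_iff)
  then show ?thesis using h0(1) by blast
qed

lemma strong_trotter: "strong_trotter_property H"
  unfolding strong_trotter_property_def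
proof (intro allI impI, elim conjE)
  fix \<gamma> and Kt :: "real set" and W
  assume C1: "C1_curve (mfd H) {0..1} \<gamma>" and \<gamma>0: "\<gamma> 0 = \<one>\<^bsub>H\<^esub>"
    and Kt: "compact Kt" "Kt \<subseteq> {0..}" and W: "openin (mtop (mfd H)) W" "\<one>\<^bsub>H\<^esub> \<in> W"
  define v where "v = velocity (mfd H) {0..1} \<gamma> 0"
  obtain x1 x2 where v: "v c0 = (x1, x2)" by (cases "v c0")
  obtain b where b: "0 \<le> b" "Kt \<subseteq> {0..b}"
  proof -
    obtain r where r: "\<forall>t\<in>Kt. norm t \<le> r" using compact_imp_bounded[OF Kt(1)] unfolding bounded_iff by blast
    then show thesis using that[of "max 0 r"] Kt(2) by fastforce
  qed
  obtain \<beta> where \<beta>: "GG.solves (\<lambda>_. x2) \<beta>"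
    using GG.product_integral[of "\<lambda>_. x2" "norm x2"] uniformly_continuous_on_const by blast
  have \<beta>c: "continuous_map (top_of_set {0..}) GG.T \<beta>"
    using GG.solves_continuous[OF \<beta>, of "norm x2"] by simp
  have \<beta>car: "\<beta> t \<in> carrier G" if "0 \<le> t" for t using \<beta> that by (simp add: GG.solves_def)
  have cb: "compactin (top_of_set {0..}) {0..b}" by (auto simp: compactin_subtopology)
  \<comment> \<open>The inverses are included because by \<open>H_diff\<close> the error in N is
    finally hit by \<pi>(\<beta>(t)^-1).\<close>
  define Q where "Q = \<beta> ` {0..b} \<union> (\<lambda>t. inv\<^bsub>G\<^esub> (\<beta> t)) ` {0..b}"
  have "compactin GG.T Q" unfolding Q_def
    using image_compactin[OF cb \<beta>c] image_compactin[OF cb continuous_map_compose[OF \<beta>c GG.cont_inv]]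
    by (intro compactin_Un) (simp_all add: o_def)
  then obtain P where P: "openin GG.T P" "Q \<subseteq> P" and eq: "NN.equicont (\<pi> ` P)" by (rule equicont_compact)
  have Pc: "P \<subseteq> carrier G" using openin_subset[OF P(1)] GG.topspace by simp
  have \<beta>P: "\<beta> t \<in> P" "inv\<^bsub>G\<^esub> (\<beta> t) \<in> P" if "t \<in> {0..b}" for t using P(2) that by (auto simp: Q_def)
  have oneP: "\<one>\<^bsub>G\<^esub> \<in> P" using \<beta>P(1)[of 0] b(1) \<beta> by (simp add: GG.solves_def)
  have "continuous_map (top_of_set {0..b}) GG.T \<beta>"
    using \<beta>c by (rule continuous_map_from_subtopology_mono) auto
  then have "continuous_on {0..b} (\<lambda>t. L (\<pi> (\<beta> t)) x1)"
    using \<beta>P by (intro L_continuous_on[OF eq Pc]) auto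
  then obtain y M where y: "\<And>t. t \<in> {0..b} \<Longrightarrow> y t = L (\<pi> (\<beta> t)) x1" and M: "\<And>t. norm (y t) \<le> M"
    and yuc: "uniformly_continuous_on UNIV y"
    using bounded_uniformly_continuous_extension[OF _ b(1)] by metis
  obtain \<nu> where \<nu>: "NN.solves y \<nu>" using NN.product_integral[OF M yuc] by blast
  have exp: "lie_exp H (\<lambda>c. t *\<^sub>R v c) = (\<nu> t, \<beta> t)" if "t \<in> {0..b}" for t
    by (rule lie_exp_eq[where v = v, OF \<beta> \<nu> M uniformly_continuous_imp_continuous[OF yuc] _ v that]) (rule y)
  obtain K \<delta> where K: "0 < K" "0 < \<delta>" "\<delta> \<le> fst NN.RC"
    "\<And>g u. g \<in> P \<Longrightarrow> norm u < \<delta> \<Longrightarrow> \<pi> g (NN.ex u) \<in> NN.D (fst NN.RC)"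
    "\<And>g u. g \<in> P \<Longrightarrow> norm u < \<delta> \<Longrightarrow> norm (NN.lg (\<pi> g (NN.ex u)) - L (\<pi> g) u) \<le> K * (norm u)\<^sup>2"
    "\<And>g u. g \<in> P \<Longrightarrow> norm (L (\<pi> g) u) \<le> K * norm u"
    by (rule equicont_L[OF eq Pc]) (rule that; blast)
  obtain W1 W2 where W12: "openin NN.T W1" "openin GG.T W2" "\<one>\<^bsub>N\<^esub> \<in> W1" "\<one>\<^bsub>G\<^esub> \<in> W2" "W1 \<times> W2 \<subseteq> W"
  proof -
    have "openin (prod_topology NN.T GG.T) W" "(\<one>\<^bsub>N\<^esub>, \<one>\<^bsub>G\<^esub>) \<in> W" using W by (simp_all add: prod_manifold_def)
    then have "\<exists>W1 W2. openin NN.T W1 \<and> openin GG.T W2 \<and> \<one>\<^bsub>N\<^esub> \<in> W1 \<and> \<one>\<^bsub>G\<^esub> \<in> W2 \<and> W1 \<times> W2 \<subseteq> W"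
      unfolding openin_prod_topology_alt by (elim allE impE) assumption
    then show thesis using that by (elim exE conjE)
  qed
  obtain \<rho>1 where \<rho>1: "0 < \<rho>1" "NN.D \<rho>1 \<subseteq> W1" using NN.nbhd_D[OF W12(1,3)] by metis
  obtain \<rho>2 where \<rho>2: "0 < \<rho>2" "GG.D \<rho>2 \<subseteq> W2" using GG.nbhd_D[OF W12(2,4)] by metis
  \<comment> \<open>Elements of size below \<delta>' \<le> 1 are mapped by \<pi>(g), g in P, to size
    at most K |u| + K |u|^2 \<le> 2 K |u| < \<rho>1. So \<delta>' is the accuracy to be reached in
    N.\<close>
  define \<delta>' where "\<delta>' = Min {\<delta>, 1, \<rho>1 / (2 * K)}"
  have \<delta>': "0 < \<delta>'" "\<delta>' \<le> \<delta>" "\<delta>' \<le> 1" "\<delta>' \<le> \<rho>1 / (2 * K)" using K \<rho>1 by (auto simp: \<delta>'_def)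
  have \<pi>small: "\<pi> g z \<in> W1" if g: "g \<in> P" and z: "z \<in> NN.D \<delta>'" for g z
  proof -
    define u where "u = NN.lg z"
    have u: "norm u < \<delta>'" "NN.ex u = z" using z by (auto simp: u_def NN.D_def NN.ex_lg)
    have "norm (NN.lg (\<pi> g z)) \<le> norm (L (\<pi> g) u) + norm (NN.lg (\<pi> g z) - L (\<pi> g) u)" by (rule norm_triangle_sub)
    also have "\<dots> \<le> K * norm u + K * (norm u)\<^sup>2" using K(5)[OF g, of u] K(6)[OF g, of u] u \<delta>' by simp
    also have "(norm u)\<^sup>2 \<le> norm u" using u(1) \<delta>'(3) by (simp add: power2_eq_square mult_left_le_one_le)
    then have "K * norm u + K * (norm u)\<^sup>2 \<le> K * norm u + K * norm u" using K(1) by simp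
    also have "\<dots> = 2 * K * norm u" by simp
    also have "\<dots> < 2 * K * \<delta>'" using u(1) K(1) by simp
    also have "\<dots> \<le> \<rho>1" using \<delta>'(4) K(1) by (simp add: field_simps)
    finally have "norm (NN.lg (\<pi> g z)) < \<rho>1" .
    moreover have "\<pi> g z \<in> U" using K(4)[OF g, of u] u \<delta>' NN.D_dom by auto
    ultimately show ?thesis using \<rho>1(2) by (auto simp: NN.D_def)
  qed
  obtain \<epsilon>N hN where N: "0 < \<epsilon>N" "0 < hN"
    "\<And>(h::real) (n::nat) w. 0 \<le> h \<Longrightarrow> h < hN \<Longrightarrow> n * h \<le> b \<Longrightarrow>
     (\<And>k. k < n \<Longrightarrow> w k \<in> U \<and> norm (NN.lg (w k) - h *\<^sub>R y (k * h)) \<le> \<epsilon>N * h) \<Longrightarrow>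
     inv\<^bsub>N\<^esub> (\<nu> (n * h)) \<otimes>\<^bsub>N\<^esub> NN.gprod w n \<in> NN.D \<delta>'"
    using NN.solves_trotter[OF \<nu> M \<delta>'(1) b(1)] by (metis order_refl)
  define A where "A = norm x1 + 1"
  have A: "0 < A" by (simp add: A_def add_nonneg_pos)
  \<comment> \<open>The accuracy, relative to h, required of \<pi>(d k) p: the subsequent
    \<pi>(\<beta>(kh)) magnifies it by K and may use up half of \<epsilon>N.\<close>
  define \<epsilon>3 where "\<epsilon>3 = min 1 (\<epsilon>N / (2 * K))"
  have e3: "0 < \<epsilon>3" "\<epsilon>3 \<le> 1" "K * \<epsilon>3 \<le> \<epsilon>N / 2"
  proof -
    show "0 < \<epsilon>3" "\<epsilon>3 \<le> 1" using N K by (auto simp: \<epsilon>3_def)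
    have "\<epsilon>3 \<le> \<epsilon>N / (2 * K)" by (simp add: \<epsilon>3_def)
    then show "K * \<epsilon>3 \<le> \<epsilon>N / 2" using K(1) by (simp add: field_simps)
  qed
  have "0 < \<epsilon>3 / 3" using e3 by simp
  then obtain \<rho>3 where \<rho>3: "0 < \<rho>3" "GG.D \<rho>3 \<subseteq> P" "\<And>g. g \<in> GG.D \<rho>3 \<Longrightarrow> norm (L (\<pi> g) x1 - x1) \<le> \<epsilon>3 / 3"
    using L_near_one[OF eq P(1) oneP, of "\<epsilon>3 / 3" x1] by metis
  have "0 < min \<rho>2 \<rho>3" using \<rho>2 \<rho>3 by simp
  then obtain \<epsilon>G hG where G: "0 < \<epsilon>G" "0 < hG"
    "\<And>(h::real) (n::nat) w k. 0 \<le> h \<Longrightarrow> h < hG \<Longrightarrow> n * h \<le> b \<Longrightarrow>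
     (\<And>k. k < n \<Longrightarrow> w k \<in> V \<and> norm (GG.lg (w k) - h *\<^sub>R x2) \<le> \<epsilon>G * h) \<Longrightarrow> k \<le> n \<Longrightarrow>
     inv\<^bsub>G\<^esub> (\<beta> (k * h)) \<otimes>\<^bsub>G\<^esub> GG.gprod w k \<in> GG.D (min \<rho>2 \<rho>3)"
    using GG.solves_trotter[OF \<beta> order_refl, of "min \<rho>2 \<rho>3" b] b(1) by metis
  \<comment> \<open>The accuracy required of the curve itself: K \<epsilon>1 is one of three thirds
    of \<epsilon>3, next to the quadratic remainder and the distance of L(\<pi>(d k)) x1 from x1;
    \<open>\<epsilon>G\<close> serves the comparison in G.\<close>
  define \<epsilon>1 where "\<epsilon>1 = Min {1, \<epsilon>3 / (3 * K), \<epsilon>G}"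
  have e1: "0 < \<epsilon>1" "\<epsilon>1 \<le> 1" "K * \<epsilon>1 \<le> \<epsilon>3 / 3" "\<epsilon>1 \<le> \<epsilon>G"
  proof -
    show "0 < \<epsilon>1" "\<epsilon>1 \<le> 1" "\<epsilon>1 \<le> \<epsilon>G" using e3 K G by (auto simp: \<epsilon>1_def)
    have "\<epsilon>1 \<le> \<epsilon>3 / (3 * K)" by (simp add: \<epsilon>1_def)
    then show "K * \<epsilon>1 \<le> \<epsilon>3 / 3" using K(1) by (simp add: field_simps)
  qed
  obtain h0 where h0: "0 < h0" "\<And>h. 0 \<le> h \<Longrightarrow> h < h0 \<Longrightarrow> fst (\<gamma> h) \<in> U \<and>
     norm (NN.lg (fst (\<gamma> h)) - h *\<^sub>R x1) \<le> \<epsilon>1 * h \<and> snd (\<gamma> h) \<in> V \<and> norm (GG.lg (snd (\<gamma> h)) - h *\<^sub>R x2) \<le> \<epsilon>1 * h"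
    using curve_expansion[OF C1 \<gamma>0 v[unfolded v_def] e1(1)] by blast
  define hm where "hm = Min {h0, hN, hG, \<delta> / A, \<epsilon>3 / (3 * K * A\<^sup>2), \<epsilon>N / (2 * K * A\<^sup>2)}"
  have hm: "0 < hm" "hm \<le> h0" "hm \<le> hN" "hm \<le> hG" "A * hm \<le> \<delta>" "K * A\<^sup>2 * hm \<le> \<epsilon>3 / 3" "K * A\<^sup>2 * hm \<le> \<epsilon>N / 2"
  proof -
    show "0 < hm" "hm \<le> h0" "hm \<le> hN" "hm \<le> hG" using h0 N G K A e3 by (auto simp: hm_def)
    have "hm \<le> \<delta> / A" "hm \<le> \<epsilon>3 / (3 * K * A\<^sup>2)" "hm \<le> \<epsilon>N / (2 * K * A\<^sup>2)" by (auto simp: hm_def)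
    then show "A * hm \<le> \<delta>" "K * A\<^sup>2 * hm \<le> \<epsilon>3 / 3" "K * A\<^sup>2 * hm \<le> \<epsilon>N / 2"
      using A K(1) by (simp_all add: field_simps)
  qed
  \<comment> \<open>One application of the action to an element h x1 + O(e h). It is used twice for
    each factor, for g = d k and for g = \<beta>(kh); \<open>A\<close> bounds |u| / h.\<close>
  have step: "\<pi> g (NN.ex u) \<in> U \<and> norm (NN.lg (\<pi> g (NN.ex u)) - h *\<^sub>R L (\<pi> g) x1) \<le> (K * A\<^sup>2 * h + K * e) * h"
    if g: "g \<in> P" and u: "norm (u - h *\<^sub>R x1) \<le> e * h" and e: "e \<le> 1" and h: "0 \<le> h" "h < hm" for g u e h
  proof -
    have lin: "linear (L (\<pi> g))" using L_linear Pc g by blast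
    have "norm u \<le> norm (h *\<^sub>R x1) + norm (u - h *\<^sub>R x1)" by (rule norm_triangle_sub)
    also have "\<dots> \<le> h * norm x1 + 1 * h" using u h mult_right_mono[OF e h(1)] by simp
    finally have nu: "norm u \<le> A * h" by (simp add: A_def algebra_simps)
    also have "\<dots> < A * hm" using h A by simp
    finally have u\<delta>: "norm u < \<delta>" using hm by simp
    have 1: "norm (NN.lg (\<pi> g (NN.ex u)) - L (\<pi> g) u) \<le> K * (A * h)\<^sup>2"
      using K(5)[OF g u\<delta>] nu K(1) by (meson mult_left_mono norm_ge_zero order_trans power_mono less_imp_le)
    have "L (\<pi> g) u - h *\<^sub>R L (\<pi> g) x1 = L (\<pi> g) (u - h *\<^sub>R x1)"
      by (simp add: linear_diff[OF lin] linear_scale[OF lin])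
    then have 2: "norm (L (\<pi> g) u - h *\<^sub>R L (\<pi> g) x1) \<le> K * (e * h)"
      using order_trans[OF K(6)[OF g, of "u - h *\<^sub>R x1"] mult_left_mono[OF u less_imp_le[OF K(1)]]] by simp
    have "norm (NN.lg (\<pi> g (NN.ex u)) - h *\<^sub>R L (\<pi> g) x1) \<le> K * (A * h)\<^sup>2 + K * (e * h)"
      using 1 2 norm_triangle_ineq[of "NN.lg (\<pi> g (NN.ex u)) - L (\<pi> g) u" "L (\<pi> g) u - h *\<^sub>R L (\<pi> g) x1"] by simp
    also have "\<dots> = (K * A\<^sup>2 * h + K * e) * h" by (simp add: power2_eq_square algebra_simps)
    finally show ?thesis using K(4)[OF g u\<delta>] NN.D_dom by blast
  qed
  have main: "inv\<^bsub>H\<^esub> (\<nu> t, \<beta> t) \<otimes>\<^bsub>H\<^esub> (\<gamma> (t / real n) [^]\<^bsub>H\<^esub> n) \<in> W" if t: "t \<in> {0..b}" and n: "0 < n" "b / real n < hm" for t n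
  proof -
    define h where "h = t / real n"
    have h: "0 \<le> h" "real n * h = t" "h < hm"
    proof -
      show "0 \<le> h" "real n * h = t" using t n by (auto simp: h_def)
      have "h \<le> b / real n" unfolding h_def using t by (intro divide_right_mono) auto
      then show "h < hm" using n by simp
    qed
    have hb: "real n * h \<le> b" using h t by simp
    define p where "p = fst (\<gamma> h)"
    define q where "q = snd (\<gamma> h)"
    have \<gamma>h: "p \<in> U" "norm (NN.lg p - h *\<^sub>R x1) \<le> \<epsilon>1 * h" "q \<in> V" "norm (GG.lg q - h *\<^sub>R x2) \<le> \<epsilon>1 * h"
      using h0(2)[of h] h hm by (auto simp: p_def q_def)
    have pc: "p \<in> carrier N" and qc: "q \<in> carrier G"
      using \<gamma>h NN.dom_carrier GG.dom_carrier by auto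
    \<comment> \<open>The error in G. Writing q^k = \<beta>(kh) d(k) splits the action of q^k into
      that of d(k), which is close to the identity on the single vector x1, and that of \<beta>(kh),
      which lies in the compact part. So L need not be compared at two distant points of G.\<close>
    define d where "d k = inv\<^bsub>G\<^esub> (\<beta> (real k * h)) \<otimes>\<^bsub>G\<^esub> q [^]\<^bsub>G\<^esub> k" for k :: nat
    have "\<epsilon>1 * h \<le> \<epsilon>G * h" using e1 h by (intro mult_right_mono) auto
    then have "q \<in> V \<and> norm (GG.lg q - h *\<^sub>R x2) \<le> \<epsilon>G * h" using \<gamma>h by linarith
    then have d: "d k \<in> GG.D (min \<rho>2 \<rho>3)" if "k \<le> n" for k
      using G(3)[of h n "\<lambda>_. q" k] h hm hb that by (simp add: d_def GG.gprod_const)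
    define w where "w k = \<pi> (q [^]\<^bsub>G\<^esub> k) p" for k :: nat
    have w: "w k \<in> U \<and> norm (NN.lg (w k) - h *\<^sub>R y (real k * h)) \<le> \<epsilon>N * h" if k: "k < n" for k
    proof -
      have "real k * h \<le> real n * h" using k h by (intro mult_right_mono) auto
      then have kh: "real k * h \<in> {0..b}" using h hb by auto
      have dk: "d k \<in> GG.D \<rho>3" using d[of k] k GG.D_mono by auto
      have dP: "d k \<in> P" using dk \<rho>3 by blast
      have dc: "d k \<in> carrier G" using dP Pc by blast
      define z where "z = \<pi> (d k) p"
      have pz: "NN.ex (NN.lg p) = p" using \<gamma>h(1) by (rule NN.ex_lg)
      have z1: "z \<in> U" "norm (NN.lg z - h *\<^sub>R L (\<pi> (d k)) x1) \<le> (K * A\<^sup>2 * h + K * \<epsilon>1) * h"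
        using step[OF dP \<gamma>h(2) e1(2) h(1,3)] by (simp_all add: pz z_def)
      have "norm (h *\<^sub>R (L (\<pi> (d k)) x1 - x1)) \<le> h * (\<epsilon>3 / 3)"
        using mult_left_mono[OF \<rho>3(3)[OF dk] h(1)] h(1) by simp
      then have "norm (NN.lg z - h *\<^sub>R x1) \<le> (K * A\<^sup>2 * h + K * \<epsilon>1) * h + h * (\<epsilon>3 / 3)"
        using z1(2) norm_triangle_ineq[of "NN.lg z - h *\<^sub>R L (\<pi> (d k)) x1" "h *\<^sub>R (L (\<pi> (d k)) x1 - x1)"]
        by (simp add: scaleR_diff_right)
      also have "\<dots> = (K * A\<^sup>2 * h + K * \<epsilon>1 + \<epsilon>3 / 3) * h" by (simp add: algebra_simps)
      also have "\<dots> \<le> \<epsilon>3 * h"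
      proof (rule mult_right_mono[OF _ h(1)])
        have "K * A\<^sup>2 * h \<le> K * A\<^sup>2 * hm" using h K(1) by (intro mult_left_mono) auto
        then show "K * A\<^sup>2 * h + K * \<epsilon>1 + \<epsilon>3 / 3 \<le> \<epsilon>3" using hm(6) e1(3) by linarith
      qed
      finally have z2: "norm (NN.lg z - h *\<^sub>R x1) \<le> \<epsilon>3 * h" .
      have zz: "NN.ex (NN.lg z) = z" using z1(1) by (rule NN.ex_lg)
      have "q [^]\<^bsub>G\<^esub> k = \<beta> (real k * h) \<otimes>\<^bsub>G\<^esub> d k"
        using \<beta>car[of "real k * h"] kh qc by (simp add: d_def GG.m_assoc[symmetric])
      then have wz: "w k = \<pi> (\<beta> (real k * h)) z"
        using \<pi>_comp[OF \<beta>car dc pc, of "real k * h"] kh by (simp add: w_def z_def)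
      have "w k \<in> U \<and> norm (NN.lg (w k) - h *\<^sub>R L (\<pi> (\<beta> (real k * h))) x1) \<le> (K * A\<^sup>2 * h + K * \<epsilon>3) * h"
        using step[OF \<beta>P(1)[OF kh] z2 e3(2) h(1,3)] by (simp add: zz wz)
      moreover have "(K * A\<^sup>2 * h + K * \<epsilon>3) * h \<le> \<epsilon>N * h"
      proof (rule mult_right_mono[OF _ h(1)])
        have "K * A\<^sup>2 * h \<le> K * A\<^sup>2 * hm" using h K(1) by (intro mult_left_mono) auto
        then show "K * A\<^sup>2 * h + K * \<epsilon>3 \<le> \<epsilon>N" using hm(7) e3(3) by linarith
      qed
      ultimately show ?thesis using y[OF kh] by simp
    qed
    have N1: "inv\<^bsub>N\<^esub> (\<nu> t) \<otimes>\<^bsub>N\<^esub> NN.gprod w n \<in> NN.D \<delta>'"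
      using N(3)[of h n w] h hm hb w by simp
    have G1: "inv\<^bsub>G\<^esub> (\<beta> t) \<otimes>\<^bsub>G\<^esub> q [^]\<^bsub>G\<^esub> n \<in> W2"
      using d[of n] \<rho>2(2) GG.D_mono h(2) by (auto simp: d_def)
    have wc: "NN.gprod w n \<in> carrier N"
      unfolding w_def using pc qc by (intro NN.gprod_closed) auto
    have nc: "\<nu> t \<in> carrier N" using \<nu> t by (simp add: NN.solves_def)
    have "\<gamma> (t / real n) [^]\<^bsub>H\<^esub> n = (NN.gprod w n, q [^]\<^bsub>G\<^esub> n)"
      using H_pow[OF pc qc, of n] by (simp add: h_def p_def q_def w_def[abs_def])
    then have "inv\<^bsub>H\<^esub> (\<nu> t, \<beta> t) \<otimes>\<^bsub>H\<^esub> (\<gamma> (t / real n) [^]\<^bsub>H\<^esub> n) =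
        (\<pi> (inv\<^bsub>G\<^esub> (\<beta> t)) (inv\<^bsub>N\<^esub> (\<nu> t) \<otimes>\<^bsub>N\<^esub> NN.gprod w n), inv\<^bsub>G\<^esub> (\<beta> t) \<otimes>\<^bsub>G\<^esub> q [^]\<^bsub>G\<^esub> n)"
      using H_diff[OF nc \<beta>car wc] qc t by simp
    moreover have "(\<pi> (inv\<^bsub>G\<^esub> (\<beta> t)) (inv\<^bsub>N\<^esub> (\<nu> t) \<otimes>\<^bsub>N\<^esub> NN.gprod w n), inv\<^bsub>G\<^esub> (\<beta> t) \<otimes>\<^bsub>G\<^esub> q [^]\<^bsub>G\<^esub> n) \<in> W1 \<times> W2"
      by (rule SigmaI[OF \<pi>small[OF \<beta>P(2)[OF t] N1] G1])
    ultimately show ?thesis using W12(5) by (simp only:) (rule subsetD)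
  qed
  have "(\<lambda>n. b / real n) \<longlonglongrightarrow> 0" by (rule lim_const_over_n)
  then have "\<forall>\<^sub>F n in sequentially. b / real n < hm" using hm(1) order_tendstoD(2) by blast
  with eventually_gt_at_top[of 0]
  show "\<forall>\<^sub>F n in sequentially. \<forall>t\<in>Kt. inv\<^bsub>H\<^esub> (lie_exp H (\<lambda>c. t *\<^sub>R velocity (mfd H) {0..1} \<gamma> 0 c)) \<otimes>\<^bsub>H\<^esub> (\<gamma> (t / real n) [^]\<^bsub>H\<^esub> n) \<in> W"
  proof eventually_elim
    case (elim n)
    show ?case
    proof
      fix t assume "t \<in> Kt"
      then have t: "t \<in> {0..b}" using b by blast
      show "inv\<^bsub>H\<^esub> (lie_exp H (\<lambda>c. t *\<^sub>R velocity (mfd H) {0..1} \<gamma> 0 c)) \<otimes>\<^bsub>H\<^esub> (\<gamma> (t / real n) [^]\<^bsub>H\<^esub> n) \<in> W"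
        using main[OF t elim] exp[OF t] unfolding v_def by (simp only:)
    qed
  qed
qed

end

theorem theorem2:
  fixes N :: "('n, 'e::banach) manifold_group"
    and G :: "('g, 'f::banach) manifold_group"
    and \<pi> :: "'g \<Rightarrow> 'n \<Rightarrow> 'n"
  assumes "banach_lie_group G"
    and "banach_lie_group N"
    and "\<pi> \<in> hom G (lie_Aut N)"
    and "continuous_map (prod_topology (mtop (mfd G)) (mtop (mfd N))) (mtop (mfd N))
           (\<lambda>(g, n). \<pi> g n)"
  shows "strong_trotter_property (semidirect_product N G \<pi>)"
proof -
  let ?C = "charts_at (prod_manifold (mfd N) (mfd G)) (\<one>\<^bsub>N\<^esub>, \<one>\<^bsub>G\<^esub>)"
  have one: "\<one>\<^bsub>L\<^esub> \<in> (\<Union>(U, \<phi>)\<in>atlas (mfd L). U)" if "banach_lie_group L" for L :: "('x, 'y::banach) manifold_group"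
    using that by (auto simp: banach_lie_group_def banach_manifold_def monoid.one_closed group.is_monoid)
  obtain U0 \<phi>0 V0 \<psi>0 where "(U0, \<phi>0) \<in> atlas (mfd N)" "\<one>\<^bsub>N\<^esub> \<in> U0" "(V0, \<psi>0) \<in> atlas (mfd G)" "\<one>\<^bsub>G\<^esub> \<in> V0"
    using one[OF assms(1)] one[OF assms(2)] by auto
  then have "(U0 \<times> V0, map_prod \<phi>0 \<psi>0) \<in> ?C"
    by (force simp: charts_at_def prod_manifold_def intro!: image_eqI[of _ _ "((U0, \<phi>0), (V0, \<psi>0))"])
  \<comment> \<open>The chart that \<open>tangent_map\<close> selects is arbitrary, but every chart
    in the product atlas is a product, so it provides charts at both identities.\<close>
  then have "(SOME c. c \<in> ?C) \<in> ?C" by (rule someI)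
  then obtain U \<phi> V \<psi> where base: "(SOME c. c \<in> ?C) = (U \<times> V, map_prod \<phi> \<psi>)"
    and U: "(U, \<phi>) \<in> atlas (mfd N)" "\<one>\<^bsub>N\<^esub> \<in> U" and V: "(V, \<psi>) \<in> atlas (mfd G)" "\<one>\<^bsub>G\<^esub> \<in> V"
    unfolding charts_at_def prod_manifold_def by auto
  interpret semidirect N U \<phi> G V \<psi> \<pi>
    by unfold_locales (use assms base U V in auto)
  show ?thesis by (rule strong_trotter)
qed

end
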